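(* Let $s>\frac{9}{2}$, $f\in C^{\lfloor s\rfloor +1}(\mathbb{R})$ with $f(0)=0$, let $\varphi, \psi \in H^{s}(\mathbb{R})$, and let $u\in C^{2}\left([0,T],H^{s}(\mathbb{R})\right)$ be the solution of the initial-value problem $$u_{tt} =(\beta \ast f(u))_{xx},\quad x\in \mathbb{R},\ t>0,\qquad u(x,0)=\varphi(x),\quad u_{t}(x,0)=\psi(x),\quad x\in\mathbb{R}.$$ Then for all sufficiently small $h>0$ and $\epsilon >0$, there is an $N$ so that the solution $\mathbf{u}_{h}^{N}$ of the truncated system $$\frac{d^{2}v_{i}^{N}}{dt^{2}}=\sum_{j=-N}^{N}h\,(D^{+}D^{-}\boldsymbol{\beta}_h)_{i-j}\,f(v_{j}^{N}),\qquad -N\leq i\leq N,$$ with initial values $\mathbf{u}_{h}^{N}(0)=\mathcal{T}^{N}\boldsymbol{\varphi}_{h}$, $(\mathbf{u}_{h}^{N})^{\prime}(0)=\mathcal{T}^{N}\boldsymbol{\psi}_{h}$ exists for times $t\in [0,T]$ and $$\Big\vert u(ih,t) -\left(\mathbf{u}_{h}^{N}\right)_{i}(t)\Big\vert+\Big\vert u_{t}(ih,t)-\left(\mathbf{u}_{h}^{N}\right)^{\prime}_{i}(t)\Big\vert = \mathcal{O}\left(h^{2}+\epsilon\right),\qquad t\in [0,T],$$ for all $-N\leq i\leq N$.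
   Context: Standing assumptions on the kernel: $\beta:\mathbb{R}\to\mathbb{R}$ is even with $\int_{\mathbb{R}}\beta(x)\,dx=1$, $\beta\in W^{1,1}(\mathbb{R})$ (identified with its continuous representative), and its second distributional derivative $\beta''=\mu$ is a finite Borel measure on $\mathbb{R}$. The continuous convolution is $(\beta\ast v)(x)=\int_{\mathbb{R}}\beta(x-y)v(y)\,dy$, in the space variable. $H^s(\mathbb{R})$ is the usual $L^2$-based Sobolev space. Notation: $N$ is a positive integer. $\boldsymbol{\beta}_h=(\beta(ih))_{i\in\mathbb{Z}}$, $\boldsymbol{\varphi}_h=(\varphi(ih))_{i\in\mathbb{Z}}$, $\boldsymbol{\psi}_h=(\psi(ih))_{i\in\mathbb{Z}}$. For a sequence $\mathbf{u}=(u_i)_{i\in\mathbb{Z}}$, $(D^+D^-\mathbf{u})_i=\frac1{h^2}(u_{i+1}-2u_i+u_{i-1})$. The truncation operator $\mathcal{T}^N:l^\infty(\mathbb{Z})\to\mathbb{R}^{2N+1}$ is $\mathcal{T}^N\mathbf{v}=(v_{-N},v_{-N+1},\ldots,v_{N-1},v_N)$. The notation $\mathcal{O}(h^2+\epsilon)$ means bounded by $C(h^2+\epsilon)$ with a constant $C$ independent of $h$, $\epsilon$, $N$, $i$ and $t\in[0,T]$. *)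

theory Defs
  imports "HOL-Analysis.Analysis"
begin

definition Ck :: "nat \<Rightarrow> (real \<Rightarrow> real) \<Rightarrow> bool" where
  "Ck k g \<longleftrightarrow> (\<forall>j<k. \<forall>x. (deriv ^^ j) g differentiable at x)
     \<and> continuous_on UNIV ((deriv ^^ k) g)"

definition test_function :: "(real \<Rightarrow> real) \<Rightarrow> bool" where
  "test_function \<theta> \<longleftrightarrow> (\<forall>k. Ck k \<theta>) \<and> bounded {x. \<theta> x \<noteq> 0}"

definition weak_derivative :: "(real \<Rightarrow> real) \<Rightarrow> (real \<Rightarrow> real) \<Rightarrow> bool" where
  "weak_derivative v w \<longleftrightarrow> (\<forall>\<theta>. test_function \<theta> \<longrightarrow>
     (LINT x|lborel. v x * deriv \<theta> x) = - (LINT x|lborel. w x * \<theta> x))"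

definition in_W11 :: "(real \<Rightarrow> real) \<Rightarrow> bool" where
  "in_W11 v \<longleftrightarrow> integrable lborel v \<and> (\<exists>w. integrable lborel w \<and> weak_derivative v w)"

definition finite_borel :: "real measure \<Rightarrow> bool" where
  "finite_borel M \<longleftrightarrow> finite_measure M \<and> sets M = sets borel"

text \<open>The measure \<open>\<beta>''\<close> is signed (a nonnegative one is incompatible with an integrable
  \<open>\<beta> \<noteq> 0\<close>); it is given as the difference \<open>\<mu> - \<nu>\<close> of two finite nonnegative measures.\<close>

definition second_distributional_derivative ::
    "(real \<Rightarrow> real) \<Rightarrow> real measure \<Rightarrow> real measure \<Rightarrow> bool" where
  "second_distributional_derivative v \<mu> \<nu> \<longleftrightarrow> (\<forall>\<theta>. test_function \<theta> \<longrightarrow>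
     (LINT x|lborel. v x * (deriv ^^ 2) \<theta> x) = (LINT x|\<mu>. \<theta> x) - (LINT x|\<nu>. \<theta> x))"

definition conv :: "(real \<Rightarrow> real) \<Rightarrow> (real \<Rightarrow> real) \<Rightarrow> real \<Rightarrow> real" where
  "conv b v x = (LINT y|lborel. b (x - y) * v y)"

definition in_L2 :: "(real \<Rightarrow> 'a::{real_normed_vector, second_countable_topology}) \<Rightarrow> bool" where
  "in_L2 g \<longleftrightarrow> g \<in> borel_measurable lborel \<and> integrable lborel (\<lambda>x. (norm (g x))\<^sup>2)"

text \<open>\<open>g\<close> is (a representative of) the Plancherel transform of \<open>v\<close>: the limit in \<open>L\<^sup>2\<close> of the
  Fourier integrals over \<open>[-R, R]\<close> as \<open>R\<close> tends to infinity.  The \<open>L\<^sup>2\<close> distance is measured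
  with the nonnegative integral, so that it is infinite rather than zero where not finite.\<close>

definition L2_fourier :: "(real \<Rightarrow> real) \<Rightarrow> (real \<Rightarrow> complex) \<Rightarrow> bool" where
  "L2_fourier v g \<longleftrightarrow> in_L2 v \<and> in_L2 g \<and>
     ((\<lambda>R. \<integral>\<^sup>+\<xi>. ennreal ((cmod (g \<xi> -
          (LINT x:{-R..R}|lborel. exp (- \<i> * of_real (x * \<xi>)) * of_real (v x))))\<^sup>2) \<partial>lborel)
        \<longlongrightarrow> 0) at_top"

text \<open>\<open>H\<^sup>s(\<real>)\<close> for \<open>s \<ge> 0\<close>.  Elements are functions, not classes modulo null sets; \<open>Hs_norm\<close>
  does not depend on the chosen transform, which is unique up to null sets, and is
  meaningful only on functions in \<open>H\<^sup>s\<close>.\<close>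

definition in_Hs :: "real \<Rightarrow> (real \<Rightarrow> real) \<Rightarrow> bool" where
  "in_Hs s v \<longleftrightarrow> (\<exists>g. L2_fourier v g \<and>
     integrable lborel (\<lambda>\<xi>. (1 + \<xi>\<^sup>2) powr s * (cmod (g \<xi>))\<^sup>2))"

definition Hs_norm :: "real \<Rightarrow> (real \<Rightarrow> real) \<Rightarrow> real" where
  "Hs_norm s v = sqrt (LINT \<xi>|lborel. (1 + \<xi>\<^sup>2) powr s * (cmod ((SOME g. L2_fourier v g) \<xi>))\<^sup>2)"

definition Hs_continuous :: "real \<Rightarrow> real \<Rightarrow> (real \<Rightarrow> real \<Rightarrow> real) \<Rightarrow> bool" where
  "Hs_continuous s T w \<longleftrightarrow> (\<forall>t\<in>{0..T}. in_Hs s (w t) \<and>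
     ((\<lambda>r. Hs_norm s (\<lambda>x. w r x - w t x)) \<longlongrightarrow> 0) (at t within {0..T}))"

definition Hs_derivative ::
    "real \<Rightarrow> real \<Rightarrow> (real \<Rightarrow> real \<Rightarrow> real) \<Rightarrow> (real \<Rightarrow> real \<Rightarrow> real) \<Rightarrow> bool" where
  "Hs_derivative s T w w' \<longleftrightarrow> (\<forall>t\<in>{0..T}.
     ((\<lambda>r. Hs_norm s (\<lambda>x. (w r x - w t x) / (r - t) - w' t x)) \<longlongrightarrow> 0) (at t within {0..T}))"

text \<open>\<open>u \<in> C\<^sup>2([0,T], H\<^sup>s(\<real>))\<close> with first and second time derivatives \<open>ut\<close> and \<open>utt\<close>;
  the time variable is the first argument.\<close>

definition C2_Hs :: "real \<Rightarrow> real \<Rightarrow> (real \<Rightarrow> real \<Rightarrow> real) \<Rightarrow> (real \<Rightarrow> real \<Rightarrow> real) \<Rightarrow>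
    (real \<Rightarrow> real \<Rightarrow> real) \<Rightarrow> bool" where
  "C2_Hs s T u ut utt \<longleftrightarrow>
     Hs_continuous s T u \<and> Hs_continuous s T ut \<and> Hs_continuous s T utt \<and>
     Hs_derivative s T u ut \<and> Hs_derivative s T ut utt"

definition grid :: "real \<Rightarrow> (real \<Rightarrow> real) \<Rightarrow> int \<Rightarrow> real" where
  "grid h v i = v (of_int i * h)"

definition DpDm :: "real \<Rightarrow> (int \<Rightarrow> real) \<Rightarrow> int \<Rightarrow> real" where
  "DpDm h w i = (w (i + 1) - 2 * w i + w (i - 1)) / h\<^sup>2"

text \<open>A vector in \<open>\<real>\<^bsup>2N+1\<^esup>\<close> is a function on \<open>int\<close> of which only the values on
  \<open>{-N..N}\<close> matter, so truncation to \<open>\<real>\<^bsup>2N+1\<^esup>\<close> is restriction to these indices.\<close>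

definition truncated_solution ::
    "(real \<Rightarrow> real) \<Rightarrow> (real \<Rightarrow> real) \<Rightarrow> (real \<Rightarrow> real) \<Rightarrow> (real \<Rightarrow> real) \<Rightarrow> real \<Rightarrow> real \<Rightarrow> nat \<Rightarrow>
     (real \<Rightarrow> int \<Rightarrow> real) \<Rightarrow> (real \<Rightarrow> int \<Rightarrow> real) \<Rightarrow> bool" where
  "truncated_solution \<beta> f \<phi> \<psi> T h N v v' \<longleftrightarrow> (\<forall>i\<in>{-int N..int N}.
     v 0 i = grid h \<phi> i \<and> v' 0 i = grid h \<psi> i \<and>
     (\<forall>t\<in>{0..T}.
        ((\<lambda>r. v r i) has_real_derivative v' t i) (at t within {0..T}) \<and>
        ((\<lambda>r. v' r i) has_real_derivative
           (\<Sum>j = -int N..int N. h * DpDm h (grid h \<beta>) (i - j) * f (v t j))) (at t within {0..T})))"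

end

theory Submission
  imports Defs "HOL-Probability.Characteristic_Functions" "HOL-Probability.Sinc_Integral"
begin

text \<open>
  By Sobolev embedding, obtained from Fourier inversion against Gaussians, \<open>u\<close> and its first three
  space derivatives are bounded uniformly on \<open>[0,T]\<close>, \<open>u\<close> decays at spatial infinity uniformly in
  \<open>t\<close>, and the \<open>H\<^sup>s\<close> time derivatives are pointwise ones.  The scheme is then controlled by the
  following observation: the second difference of \<open>\<beta>\<close> with step \<open>h\<close> is the integral of a hat
  function of width \<open>h\<close> against the signed measure \<open>\<beta>''\<close>.  Hence the discrete convolution
  with \<open>D\<^sup>+D\<^sup>-\<beta>\<close> is the convolution of \<open>\<beta>''\<close> with the piecewise linear interpolant of the grid
  values; it is bounded by the total variation of \<open>\<beta>''\<close> and, since \<open>(\<beta> * w)'' = \<beta>'' * w\<close>, consistent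
  of order \<open>h\<^sup>2\<close> whenever \<open>w''\<close> is bounded, with truncation contributing only the size of \<open>w\<close>
  outside the grid.  A comparison argument for second-order systems turns this into
  the error bound, and also keeps the discrete solution in the region where a clamped, globally
  Lipschitz nonlinearity agrees with \<open>f\<close>, which gives existence on all of \<open>[0,T]\<close>.
\<close>

section \<open>Smooth test functions\<close>

text \<open>The measure \<open>\<beta>''\<close> is known only through smooth, compactly supported
  test functions. Neither a hat function nor \<open>w = f (u t)\<close>, which decays without having
  compact support, is one, so the formulas for both are limits: smooth second differences replace
  the hat, and the hat, rescaled, mollifies \<open>w\<close>. Membership in \<open>H^s\<close> is
  stated through an \<open>L^2\<close> limit of truncated Fourier integrals, whereas the scheme
  samples point values. Testing against Gaussians turns the former into a pointwise inversion
  formula at every point of continuity. One power of \<open>1 + \<xi>^2\<close> is spent on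
  integrability in \<open>\<xi>\<close>, which is how \<open>s \<ge> 4\<close> pays for three
  bounded derivatives. The number \<open>N\<close> is chosen last: \<open>h\<close> and
  \<open>\<epsilon>\<close> fix a radius outside which \<open>|u| \<le> \<epsilon>\<close> at all
  times, and the grid must cover it. One error estimate with a variable nonlinearity is used twice,
  for the clamped system (existence) and for an arbitrary solution of the original one (the
  bound).\<close>

lemma DERIV_imp_continuous_on:
  fixes g :: "real \<Rightarrow> real"
  assumes "\<And>x. (g has_real_derivative g' x) (at x)"
  shows "continuous_on S g"
  using assms by (blast intro: continuous_at_imp_continuous_on DERIV_isCont)

text \<open>\<open>Ck\<close> iterates \<open>deriv\<close>, which hides the shape of a derivative.
  This rule and \<open>Ck_SucE\<close> trade it for a recursion on an explicit derivative; the
  closure properties below are inductions along that recursion.\<close>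

lemma Ck_SucI:
  assumes "\<And>x. (g has_real_derivative g' x) (at x)" "Ck k g'"
  shows "Ck (Suc k) g"
proof -
  have d: "deriv g = g'" using assms(1) DERIV_imp_deriv by blast
  have "(deriv ^^ j) g differentiable at x" if "j < Suc k" for j x
  proof (cases j)
    case 0
    then show ?thesis using assms(1) real_differentiable_def by auto
  next
    case (Suc i)
    then show ?thesis using that assms(2) d unfolding Ck_def by (simp add: funpow_swap1)
  qed
  then show ?thesis using assms(2) d unfolding Ck_def by (simp add: funpow_swap1)
qed

lemma Ck_SucE:
  assumes "Ck (Suc k) g"
  obtains g' where "\<And>x. (g has_real_derivative g' x) (at x)" "Ck k g'"
proof
  show "(g has_real_derivative deriv g x) (at x)" for x
  proof -
    have "g differentiable at x" using assms unfolding Ck_def by (metis funpow_0 zero_less_Suc)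
    then show ?thesis by (simp add: DERIV_deriv_iff_real_differentiable)
  qed
  show "Ck k (deriv g)"
    unfolding Ck_def
  proof (intro conjI allI impI)
    fix j x assume "j < k"
    then have "(deriv ^^ Suc j) g differentiable at x" using assms unfolding Ck_def by blast
    then show "(deriv ^^ j) (deriv g) differentiable at x" by (simp add: funpow_swap1)
  next
    show "continuous_on UNIV ((deriv ^^ k) (deriv g))"
      using assms unfolding Ck_def by (simp add: funpow_swap1)
  qed
qed

lemma Ck_imp_continuous: "Ck k g \<Longrightarrow> continuous_on UNIV g"
proof (cases k)
  case (Suc n)
  moreover assume "Ck k g"
  ultimately obtain g' where "\<And>x. (g has_real_derivative g' x) (at x)"
    using Ck_SucE by blast
  then show ?thesis by (rule DERIV_imp_continuous_on)
qed (simp add: Ck_def)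

lemma Ck_Suc_imp: "Ck (Suc k) g \<Longrightarrow> Ck k g"
proof (induction k arbitrary: g)
  case 0
  from Ck_imp_continuous[OF this] show ?case by (simp add: Ck_def)
next
  case (Suc k)
  then obtain g' where "\<And>x. (g has_real_derivative g' x) (at x)" "Ck (Suc k) g'"
    using Ck_SucE by blast
  with Suc.IH show ?case by (blast intro: Ck_SucI)
qed

lemma Ck_mono: "Ck n g \<Longrightarrow> m \<le> n \<Longrightarrow> Ck m g"
  by (induction n) (use Ck_Suc_imp in \<open>auto simp: le_Suc_eq\<close>)

lemma Ck_const: "Ck k (\<lambda>_. c)"
proof (induction k arbitrary: c)
  case (Suc k)
  show ?case by (rule Ck_SucI[where g' = "\<lambda>_. 0"]) (use Suc in auto)
qed (simp add: Ck_def)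

lemma Ck_add: "Ck k f \<Longrightarrow> Ck k g \<Longrightarrow> Ck k (\<lambda>x. f x + g x)"
proof (induction k arbitrary: f g)
  case (Suc k)
  obtain f' g' where
    "\<And>x. (f has_real_derivative f' x) (at x)" "Ck k f'"
    "\<And>x. (g has_real_derivative g' x) (at x)" "Ck k g'"
    using Suc.prems Ck_SucE by metis
  then show ?case
    by (intro Ck_SucI[where g' = "\<lambda>x. f' x + g' x"] Suc.IH DERIV_add)
qed (auto simp: Ck_def intro: continuous_on_add)

lemma Ck_mult: "Ck k f \<Longrightarrow> Ck k g \<Longrightarrow> Ck k (\<lambda>x. f x * g x)"
proof (induction k arbitrary: f g)
  case (Suc k)
  obtain f' g' where fg:
    "\<And>x. (f has_real_derivative f' x) (at x)" "Ck k f'"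
    "\<And>x. (g has_real_derivative g' x) (at x)" "Ck k g'"
    using Suc.prems Ck_SucE by metis
  \<comment> \<open>The product rule multiplies \<open>f'\<close> by \<open>g\<close> itself, so the
    induction hypothesis also needs the undifferentiated factors at order \<open>k\<close>.\<close>
  have "Ck k f" "Ck k g" using Suc.prems Ck_Suc_imp by auto
  with fg show ?case
    by (intro Ck_SucI[where g' = "\<lambda>x. f' x * g x + g' x * f x"] Suc.IH Ck_add DERIV_mult)
qed (auto simp: Ck_def intro: continuous_on_mult)

lemma Ck_affine: "Ck k f \<Longrightarrow> Ck k (\<lambda>x. f (a + c * x))"
proof (induction k arbitrary: f)
  case 0
  then show ?case
    by (auto simp: Ck_def intro!: continuous_intros continuous_on_compose2[of UNIV f])
next
  case (Suc k)
  obtain f' where f: "\<And>x. (f has_real_derivative f' x) (at x)" "Ck k f'"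
    using Suc.prems Ck_SucE by metis
  show ?case
  proof (rule Ck_SucI[where g' = "\<lambda>x. f' (a + c * x) * c"])
    show "((\<lambda>x. f (a + c * x)) has_real_derivative f' (a + c * x) * c) (at x)" for x
      by (rule DERIV_chain2[OF f(1)]) (auto intro!: derivative_eq_intros)
    show "Ck k (\<lambda>x. f' (a + c * x) * c)" by (rule Ck_mult[OF Suc.IH[OF f(2)] Ck_const])
  qed
qed

text \<open>The functions \<open>flat p\<close> are closed under differentiation, so all of them are smooth.\<close>

definition flat :: "real poly \<Rightarrow> real \<Rightarrow> real" where
  "flat p x = (if x > 0 then poly p (1 / x) * exp (- (1 / x)) else 0)"

lemma poly_exp_tendsto_0: "((\<lambda>x::real. poly p x * exp (- x)) \<longlongrightarrow> 0) at_top"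
proof -
  have "((\<lambda>x::real. \<Sum>i\<le>degree p. coeff p i * (x ^ i / exp x)) \<longlongrightarrow> (\<Sum>i\<le>degree p. coeff p i * 0)) at_top"
    by (intro tendsto_intros tendsto_power_div_exp_0)
  then show ?thesis
    by (simp add: poly_altdef sum_distrib_right sum_divide_distrib exp_minus field_simps)
qed

text \<open>This is the difference quotient at the origin. For \<open>x > 0\<close>, dividing by
  \<open>x\<close> only raises the degree of the polynomial in \<open>1 / x\<close>, and the
  exponential beats every polynomial.\<close>

lemma flat_tendsto_0: "((\<lambda>x. flat p x / x) \<longlongrightarrow> 0) (at 0)"
  unfolding filterlim_at_split
proof
  show "((\<lambda>x. flat p x / x) \<longlongrightarrow> 0) (at_left 0)"
    by (rule tendsto_eventually) (auto simp: eventually_at_filter flat_def)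
  have "((\<lambda>x. poly (pCons 0 p) (inverse x) * exp (- inverse x)) \<longlongrightarrow> 0) (at_right (0::real))"
    using filterlim_compose[OF poly_exp_tendsto_0 filterlim_inverse_at_top_right] .
  moreover have "eventually (\<lambda>x. poly (pCons 0 p) (inverse x) * exp (- inverse x) = flat p x / x)
      (at_right (0::real))"
    by (auto simp: eventually_at_filter flat_def field_simps)
  ultimately show "((\<lambda>x. flat p x / x) \<longlongrightarrow> 0) (at_right 0)"
    by (rule Lim_transform_eventually)
qed

text \<open>With \<open>y = 1 / x\<close> one has \<open>dy/dx = - y^2\<close>, so
  \<open>p y * exp (- y)\<close> has derivative \<open>y^2 * (p y - p' y) * exp (- y)\<close>; the
  polynomial \<open>[:0, 0, 1:]\<close> is the factor \<open>y^2\<close>.\<close>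

lemma flat_deriv:
  "(flat p has_real_derivative flat ([:0, 0, 1:] * (p - pderiv p)) x) (at x)"
proof -
  consider "x > 0" | "x = 0" | "x < 0" by linarith
  then show ?thesis
  proof cases
    case 1
    have inv: "((\<lambda>x. 1 / x) has_real_derivative - (1 / x\<^sup>2)) (at x)"
      using 1 by (auto intro!: derivative_eq_intros simp: power2_eq_square)
    have "((\<lambda>x. poly p (1 / x)) has_real_derivative poly (pderiv p) (1 / x) * (- (1 / x\<^sup>2))) (at x)"
      by (rule DERIV_chain2[OF poly_DERIV inv])
    moreover have "((\<lambda>x. exp (- (1 / x))) has_real_derivative exp (- (1 / x)) * (- (- (1 / x\<^sup>2)))) (at x)"
      by (rule DERIV_chain2[OF DERIV_exp DERIV_minus[OF inv]])
    ultimately have "((\<lambda>x. poly p (1 / x) * exp (- (1 / x))) has_real_derivative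
        poly (pderiv p) (1 / x) * (- (1 / x\<^sup>2)) * exp (- (1 / x))
        + exp (- (1 / x)) * (- (- (1 / x\<^sup>2))) * poly p (1 / x)) (at x)"
      by (rule DERIV_mult)
    also have "poly (pderiv p) (1 / x) * (- (1 / x\<^sup>2)) * exp (- (1 / x))
        + exp (- (1 / x)) * (- (- (1 / x\<^sup>2))) * poly p (1 / x)
        = flat ([:0, 0, 1:] * (p - pderiv p)) x"
      using 1 by (simp add: flat_def power2_eq_square algebra_simps)
    finally have "((\<lambda>x. poly p (1 / x) * exp (- (1 / x))) has_real_derivative
        flat ([:0, 0, 1:] * (p - pderiv p)) x) (at x)" .
    then show ?thesis
      by (rule has_field_derivative_transform_within_open[where S = "{0<..}"])
        (use 1 in \<open>auto simp: flat_def\<close>)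
  next
    case 2
    then show ?thesis
      using flat_tendsto_0[of p] by (simp add: has_field_derivative_iff flat_def)
  next
    case 3
    have "((\<lambda>x. 0) has_real_derivative flat ([:0, 0, 1:] * (p - pderiv p)) x) (at x)"
      using 3 by (auto simp: flat_def)
    then show ?thesis
      by (rule has_field_derivative_transform_within_open[where S = "{..<0}"])
        (use 3 in \<open>auto simp: flat_def\<close>)
  qed
qed

lemma Ck_flat: "Ck k (flat p)"
proof (induction k arbitrary: p)
  case 0
  have "continuous_on UNIV (flat p)"
    using flat_deriv by (rule DERIV_imp_continuous_on)
  then show ?case by (simp add: Ck_def)
next
  case (Suc k)
  then show ?case using flat_deriv by (blast intro: Ck_SucI)
qed

section \<open>Antiderivatives and a smooth version of the positive part\<close>

lemma antiderivative_real_ex: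
  fixes g :: "real \<Rightarrow> real"
  assumes "continuous_on UNIV g"
  obtains G where "\<And>x. (G has_real_derivative g x) (at x)" "G a = 0"
proof -
  have "\<exists>F. \<forall>x. - \<infinity> < ereal x \<longrightarrow> ereal x < \<infinity> \<longrightarrow> (F has_vector_derivative g x) (at x)"
    by (rule einterval_antiderivative) (use assms in \<open>auto simp: continuous_on_eq_continuous_at\<close>)
  then obtain F where "\<And>x. (F has_real_derivative g x) (at x)"
    by (auto simp: has_real_derivative_iff_has_vector_derivative)
  then have "((\<lambda>x. F x - F a) has_real_derivative g x) (at x)" for x
    by (auto intro!: derivative_eq_intros)
  then show ?thesis using that[of "\<lambda>x. F x - F a"] by simp
qed

text \<open>\<open>\<eta>\<close> is a bump of mass one, \<open>H\<close> a smooth Heaviside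
  function and \<open>E\<close> a smooth version of \<open>max 0\<close>. The offset
  \<open>m\<close> is the first moment of \<open>\<eta>\<close>, a constant that second differences
  of \<open>E\<close> cancel.\<close>

lemma smooth_kernel_ex:
  obtains E H \<eta> :: "real \<Rightarrow> real" and m :: real
  where "\<And>k. Ck k E" "\<And>x. (E has_real_derivative H x) (at x)"
    "\<And>x. (H has_real_derivative \<eta> x) (at x)" "continuous_on UNIV \<eta>"
    "\<And>x. 1 \<le> \<bar>x\<bar> \<Longrightarrow> \<eta> x = 0" "has_bochner_integral lborel \<eta> 1"
    "\<And>x. x \<le> -1 \<Longrightarrow> E x = 0" "\<And>x. 1 \<le> x \<Longrightarrow> E x = x - m"
proof -
  define b where "b x = flat 1 (1 + x) * flat 1 (1 - x)" for x
  have Ckb: "Ck k b" for k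
    using Ck_mult[OF Ck_affine[OF Ck_flat, of k 1 1 1] Ck_affine[OF Ck_flat, of k 1 1 "-1"]]
    unfolding b_def by simp
  have b0: "b x = 0" if "1 \<le> \<bar>x\<bar>" for x
    using that by (auto simp: b_def flat_def)
  have bpos: "b x > 0" if "\<bar>x\<bar> < 1" for x
    using that by (auto simp: b_def flat_def)
  obtain G where G: "\<And>x. (G has_real_derivative b x) (at x)" "G (-1) = 0"
    using antiderivative_real_ex[OF Ck_imp_continuous[OF Ckb[of 0]]] by metis
  \<comment> \<open>The mass of the unnormalised bump; being positive, it can be divided out of
    \<open>H\<close> and \<open>\<eta>\<close>.\<close>
  have "G (-1) < G 1"
  proof (rule DERIV_pos_imp_increasing_open[of "-1" 1 G])
    show "continuous_on {-1..1} G"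
      using G(1) by (rule DERIV_imp_continuous_on)
  qed (use G bpos in \<open>auto intro!: exI\<close>)
  then have c: "G 1 > 0" using G by simp
  define H \<eta> where "H x = G x / G 1" and "\<eta> x = b x / G 1" for x
  have dH: "(H has_real_derivative \<eta> x) (at x)" for x
    unfolding H_def \<eta>_def by (intro DERIV_cdivide G)
  have Cketa: "Ck k \<eta>" for k
    using Ck_mult[OF Ckb Ck_const[of k "1 / G 1"]] by (simp add: \<eta>_def[abs_def])
  have eta0: "\<eta> x = 0" if "1 \<le> \<bar>x\<bar>" for x using b0[OF that] by (simp add: \<eta>_def)
  have contH: "continuous_on UNIV H"
    using dH by (rule DERIV_imp_continuous_on)
  obtain E where E: "\<And>x. (E has_real_derivative H x) (at x)" "E (-1) = 0"
    using antiderivative_real_ex[OF contH] by metis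
  have H0: "H x = 0" if "x \<le> -1" for x
  proof (cases "x = -1")
    case False
    then have "x < -1" using that by simp
    then obtain z where "x < z" "z < -1" "H (-1) - H x = (-1 - x) * \<eta> z"
      using MVT2[of x "-1" H \<eta>] dH by blast
    then show ?thesis using eta0[of z] G by (simp add: H_def)
  qed (use G in \<open>simp add: H_def\<close>)
  have H1: "H x = 1" if "1 \<le> x" for x
  proof (cases "x = 1")
    case False
    then have "1 < x" using that by simp
    then obtain z where "1 < z" "z < x" "H x - H 1 = (x - 1) * \<eta> z"
      using MVT2[of 1 x H \<eta>] dH by blast
    then show ?thesis using eta0[of z] c by (simp add: H_def)
  qed (use c in \<open>simp add: H_def\<close>)
  have E0: "E x = 0" if "x \<le> -1" for x
  proof (cases "x = -1")
    case False
    then have "x < -1" using that by simp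
    then obtain z where "x < z" "z < -1" "E (-1) - E x = (-1 - x) * H z"
      using MVT2[of x "-1" E H] E by blast
    then show ?thesis using H0[of z] E by simp
  qed (use E in simp)
  have E1: "E x = x - (1 - E 1)" if "1 \<le> x" for x
  proof (cases "x = 1")
    case False
    then have "1 < x" using that by simp
    then obtain z where "1 < z" "z < x" "E x - E 1 = (x - 1) * H z"
      using MVT2[of 1 x E H] E by blast
    then show ?thesis using H1[of z] by simp
  qed simp
  have "has_bochner_integral lborel (\<lambda>x. \<eta> x * indicator {-1..1} x) (H 1 - H (-1))"
    by (rule has_bochner_integral_FTC_Icc_real)
      (use dH Ck_imp_continuous[OF Cketa] in
        \<open>auto simp: continuous_on_eq_continuous_at\<close>)
  moreover have "(\<lambda>x. \<eta> x * indicator {-1..1} x) = \<eta>"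
    using eta0 by (fastforce split: split_indicator simp: fun_eq_iff)
  ultimately have int: "has_bochner_integral lborel \<eta> 1" using H0 H1 by simp
  have CkE: "Ck k E" for k
    using Ck_SucI[OF E(1) Ck_SucI[OF dH Cketa]] Ck_Suc_imp by blast
  show ?thesis
    by (rule that[of E H \<eta> "1 - E 1"])
       (fact CkE E dH Ck_imp_continuous[OF Cketa] eta0 int E0 E1)+
qed

section \<open>Second differences and the measure of the second derivative\<close>

lemma continuous_on_Icc_bounded:
  fixes g :: "real \<Rightarrow> real"
  assumes "continuous_on UNIV g"
  obtains B where "\<And>x. x \<in> {a..b} \<Longrightarrow> \<bar>g x\<bar> \<le> B"
proof -
  have "compact (g ` {a..b})"
    by (intro compact_continuous_image continuous_on_subset[OF assms]) auto
  then have "\<exists>B. \<forall>x\<in>{a..b}. \<bar>g x\<bar> \<le> B"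
    by (auto dest!: compact_imp_bounded simp: bounded_iff)
  then show ?thesis using that by blast
qed

text \<open>The Peano kernel of the second difference: for smooth \<open>g\<close>, the value
  \<open>g (a + h) - 2 * g a + g (a - h)\<close> is the integral of
  \<open>hat h (a - z) * g'' z\<close>. It has height \<open>h\<close> and integral
  \<open>h^2\<close>; divided by \<open>h\<close> it is the nodal function of piecewise linear
  interpolation.\<close>

definition hat :: "real \<Rightarrow> real \<Rightarrow> real" where
  "hat h z = max 0 (h - \<bar>z\<bar>)"

lemma hat_nonneg: "0 \<le> hat h z"
  by (simp add: hat_def)

lemma hat_le: "0 \<le> h \<Longrightarrow> hat h z \<le> h"
  by (simp add: hat_def)

lemma hat_eq_0: "h \<le> \<bar>z\<bar> \<Longrightarrow> hat h z = 0"
  by (simp add: hat_def)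

lemma continuous_on_hat [continuous_intros]:
  "continuous_on S g \<Longrightarrow> continuous_on S (\<lambda>x. hat h (g x))"
  unfolding hat_def by (intro continuous_intros)

lemma measurable_hat [measurable]: "hat h \<in> borel_measurable borel"
  by (intro borel_measurable_continuous_onI continuous_intros)

lemma second_deriv_eqI:
  assumes "\<And>x. (g has_real_derivative g1 x) (at x)" "\<And>x. (g1 has_real_derivative g2 x) (at x)"
  shows "(deriv ^^ 2) g = g2"
proof -
  have "deriv g = g1" "deriv g1 = g2" using assms DERIV_imp_deriv by blast+
  then show ?thesis by (simp add: numeral_2_eq_2)
qed

text \<open>With \<open>r = Suc n\<close>, substituting \<open>x = b - y / r\<close> moves the
  dependence on \<open>n\<close> into the argument of \<open>g\<close>. Although \<open>g\<close>
  may be unbounded, the support of \<open>\<eta>\<close> keeps that argument within distance one of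
  \<open>b\<close>, which supplies the dominating function.\<close>

lemma mollifier_tendsto:
  fixes g \<eta> :: "real \<Rightarrow> real"
  assumes g: "continuous_on UNIV g" and \<eta>: "continuous_on UNIV \<eta>"
    "\<And>x. 1 \<le> \<bar>x\<bar> \<Longrightarrow> \<eta> x = 0" "has_bochner_integral lborel \<eta> 1"
  shows "(\<lambda>n. LINT x|lborel. g x * (real (Suc n) * \<eta> (real (Suc n) * (b - x)))) \<longlonglongrightarrow> g b"
    and "integrable lborel (\<lambda>x. g x * (real (Suc n) * \<eta> (real (Suc n) * (b - x))))"
proof -
  have [measurable]: "g \<in> borel_measurable borel" "\<eta> \<in> borel_measurable borel"
    using g \<eta> by (simp_all add: borel_measurable_continuous_onI)
  obtain B where B: "\<And>x. x \<in> {b-1..b+1} \<Longrightarrow> \<bar>g x\<bar> \<le> B"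
    using continuous_on_Icc_bounded[OF g] by metis
  have ptb: "\<bar>g (b + (- 1 / real (Suc n)) * y) * \<eta> y\<bar> \<le> B * \<bar>\<eta> y\<bar>" for n y
  proof (cases "1 \<le> \<bar>y\<bar>")
    case False
    then have "\<bar>y\<bar> \<le> 1 + real n" by linarith
    moreover have "\<bar>(- 1 / real (Suc n)) * y\<bar> = \<bar>y\<bar> / (1 + real n)" by (simp add: abs_mult)
    ultimately have "\<bar>(- 1 / real (Suc n)) * y\<bar> \<le> 1" by simp
    then have "b + (- 1 / real (Suc n)) * y \<in> {b-1..b+1}" unfolding abs_le_iff atLeastAtMost_iff by linarith
    then have "\<bar>g (b + (- 1 / real (Suc n)) * y)\<bar> \<le> B" by (rule B)
    then show ?thesis by (auto simp: abs_mult intro: mult_right_mono)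
  qed (simp add: \<eta>)
  have inteta: "integrable lborel \<eta>" "(LINT x|lborel. \<eta> x) = 1"
    using \<eta>(3) by (auto simp: has_bochner_integral_iff)
  have ii: "integrable lborel (\<lambda>y. g (b + (- 1 / real (Suc n)) * y) * \<eta> y)" for n
    by (rule Bochner_Integration.integrable_bound[of _ "\<lambda>y. B * \<bar>\<eta> y\<bar>"])
      (use inteta ptb[of n] in \<open>auto intro!: AE_I2 order_trans[OF _ abs_ge_self]\<close>)
  have sub: "(\<lambda>y. g (b + (- 1 / real (Suc n)) * y) *
      (real (Suc n) * \<eta> (real (Suc n) * (b - (b + (- 1 / real (Suc n)) * y)))))
    = (\<lambda>y. real (Suc n) * (g (b + (- 1 / real (Suc n)) * y) * \<eta> y))" for n
    by (auto simp: fun_eq_iff)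
  show "integrable lborel (\<lambda>x. g x * (real (Suc n) * \<eta> (real (Suc n) * (b - x))))"
    by (subst lborel_integrable_real_affine_iff[symmetric, of "- 1 / real (Suc n)" _ b])
      (use ii[of n] in \<open>simp_all only: sub, simp_all\<close>)
  have eq: "(LINT x|lborel. g x * (real (Suc n) * \<eta> (real (Suc n) * (b - x))))
    = (LINT y|lborel. g (b + (- 1 / real (Suc n)) * y) * \<eta> y)" for n
    by (subst lborel_integral_real_affine[of "- 1 / real (Suc n)" _ b]) (simp_all only: sub, simp_all)
  have "(\<lambda>n. LINT y|lborel. g (b + (- 1 / real (Suc n)) * y) * \<eta> y) \<longlonglongrightarrow> (LINT y|lborel. g b * \<eta> y)"
  proof (rule integral_dominated_convergence[where w = "\<lambda>y. B * \<bar>\<eta> y\<bar>"])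
    show "AE y in lborel. (\<lambda>n. g (b + (- 1 / real (Suc n)) * y) * \<eta> y) \<longlonglongrightarrow> g b * \<eta> y"
    proof (intro AE_I2 tendsto_intros)
      fix y
      have "(\<lambda>n. b + (- 1 * (1 / real (Suc n))) * y) \<longlonglongrightarrow> b + (- 1 * 0) * y"
        by (intro tendsto_intros LIMSEQ_Suc[OF lim_1_over_n])
      then have "(\<lambda>n. b + (- 1 / real (Suc n)) * y) \<longlonglongrightarrow> b" by simp
      moreover have "isCont g b" using g by (simp add: continuous_on_eq_continuous_at)
      ultimately show "(\<lambda>n. g (b + (- 1 / real (Suc n)) * y)) \<longlonglongrightarrow> g b"
        by (rule isCont_tendsto_compose[rotated])
    qed
  qed (use inteta ptb in \<open>auto intro!: AE_I2\<close>)
  then show "(\<lambda>n. LINT x|lborel. g x * (real (Suc n) * \<eta> (real (Suc n) * (b - x)))) \<longlonglongrightarrow> g b"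
    unfolding eq using inteta by simp
qed

text \<open>Integration against the signed measure \<open>\<beta>'' = \<mu> - \<nu>\<close>.\<close>

definition diff_integral :: "real measure \<Rightarrow> real measure \<Rightarrow> (real \<Rightarrow> real) \<Rightarrow> real" where
  "diff_integral \<mu> \<nu> g = (LINT x|\<mu>. g x) - (LINT x|\<nu>. g x)"

lemma finite_borel_integrable:
  fixes g :: "real \<Rightarrow> real"
  assumes "finite_borel M" "g \<in> borel_measurable borel" "\<And>x. \<bar>g x\<bar> \<le> B"
  shows "integrable M g"
proof -
  interpret finite_measure M using assms by (simp add: finite_borel_def)
  have "g \<in> borel_measurable M"
    using assms(1,2) measurable_cong_sets[of M borel] by (auto simp: finite_borel_def)
  then show ?thesis by (intro integrable_const_bound[of _ B]) (use assms in auto)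
qed

lemma finite_borel_tendsto:
  fixes g :: "nat \<Rightarrow> real \<Rightarrow> real"
  assumes M: "finite_borel M" and m: "\<And>n. g n \<in> borel_measurable borel" "g' \<in> borel_measurable borel"
    and b: "\<And>n x. \<bar>g n x\<bar> \<le> B" and l: "\<And>x. (\<lambda>n. g n x) \<longlonglongrightarrow> g' x"
  shows "(\<lambda>n. LINT x|M. g n x) \<longlonglongrightarrow> (LINT x|M. g' x)"
proof (rule integral_dominated_convergence[where w = "\<lambda>_. B"])
  have "borel_measurable M = borel_measurable borel"
    using M measurable_cong_sets[of M borel] by (auto simp: finite_borel_def)
  then show "g' \<in> borel_measurable M" "\<And>n. g n \<in> borel_measurable M" using m by auto
  show "integrable M (\<lambda>_. B)" using finite_borel_integrable[OF M, of "\<lambda>_. B" "\<bar>B\<bar>"] by simp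
qed (use b l in auto)

lemma diff_integral_tendsto:
  fixes g :: "nat \<Rightarrow> real \<Rightarrow> real"
  assumes "finite_borel \<mu>" "finite_borel \<nu>" "\<And>n. g n \<in> borel_measurable borel"
    "g' \<in> borel_measurable borel" "\<And>n x. \<bar>g n x\<bar> \<le> B" "\<And>x. (\<lambda>n. g n x) \<longlonglongrightarrow> g' x"
  shows "(\<lambda>n. diff_integral \<mu> \<nu> (g n)) \<longlonglongrightarrow> diff_integral \<mu> \<nu> g'"
  unfolding diff_integral_def
  by (intro tendsto_diff finite_borel_tendsto[OF assms(1) assms(3-6)]
      finite_borel_tendsto[OF assms(2) assms(3-6)])

text \<open>The hat function is the second difference of \<open>max 0\<close>; the test functions are the second
  differences of smooth approximations of \<open>max 0\<close>, so their second derivatives are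
  combinations of three mollifiers.\<close>

lemma second_difference_eq_hat:
  assumes \<beta>: "continuous_on UNIV \<beta>" and M: "finite_borel \<mu>" "finite_borel \<nu>"
    "second_distributional_derivative \<beta> \<mu> \<nu>" and h: "h > 0"
  shows "\<beta> (a + h) - 2 * \<beta> a + \<beta> (a - h) = diff_integral \<mu> \<nu> (\<lambda>z. hat h (a - z))"
proof -
  obtain E H \<eta> :: "real \<Rightarrow> real" and m :: real where
    E: "\<And>k. Ck k E" and dE: "\<And>x. (E has_real_derivative H x) (at x)"
    and dH: "\<And>x. (H has_real_derivative \<eta> x) (at x)"
    and \<eta>: "continuous_on UNIV \<eta>" "\<And>x. 1 \<le> \<bar>x\<bar> \<Longrightarrow> \<eta> x = 0" "has_bochner_integral lborel \<eta> 1"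
    and E0: "\<And>x. x \<le> -1 \<Longrightarrow> E x = 0" and E1: "\<And>x. 1 \<le> x \<Longrightarrow> E x = x - m"
    using smooth_kernel_ex by metis
  obtain B where B: "\<And>x. x \<in> {-1..1} \<Longrightarrow> \<bar>E x\<bar> \<le> B"
    using continuous_on_Icc_bounded[OF Ck_imp_continuous[OF E]] by metis
  \<comment> \<open>\<open>E\<close> stays within a bounded distance of \<open>max 0\<close>:
    \<open>|m|\<close> on the right, at most \<open>B + 1\<close> on the middle interval, zero on
    the left.\<close>
  define C where "C = 1 + \<bar>B\<bar> + \<bar>m\<bar>"
  have EC: "\<bar>E x - max 0 x\<bar> \<le> C" for x
  proof -
    consider "x \<le> -1" | "1 \<le> x" | "x \<in> {-1..1}" by force
    then show ?thesis
    proof cases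
      case 3
      then show ?thesis using B[OF 3] by (auto simp: C_def abs_if max_def split: if_splits)
    qed (auto simp: E0 E1 C_def)
  qed
  define r where "r n = real (Suc n)" for n
  have r: "r n \<ge> 1" for n by (simp add: r_def)
  \<comment> \<open>Since \<open>max 0\<close> is positively homogeneous,
    \<open>E (r * y) / r\<close> is within \<open>C / r\<close> of \<open>max 0 y\<close>, while its
    second derivative in \<open>y\<close> is the mollifier
    \<open>r * \<eta> (r * y)\<close>.\<close>
  define \<theta> where "\<theta> n x = (E (r n * (a + h - x)) - 2 * E (r n * (a - x)) + E (r n * (a - h - x))) / r n" for n x
  define \<theta>1 where "\<theta>1 n x = - (H (r n * (a + h - x)) - 2 * H (r n * (a - x)) + H (r n * (a - h - x)))" for n x
  define \<theta>2 where "\<theta>2 n x = r n * \<eta> (r n * (a + h - x)) - 2 * (r n * \<eta> (r n * (a - x))) + r n * \<eta> (r n * (a - h - x))" for n x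
  have d1: "(\<theta> n has_real_derivative \<theta>1 n x) (at x)" for n x
    unfolding \<theta>_def \<theta>1_def using r[of n]
    by (auto intro!: derivative_eq_intros DERIV_chain2[OF dE] simp: field_simps)
  have d2: "(\<theta>1 n has_real_derivative \<theta>2 n x) (at x)" for n x
    unfolding \<theta>1_def \<theta>2_def using r[of n]
    by (auto intro!: derivative_eq_intros DERIV_chain2[OF dH] simp: field_simps)
  have Ckr: "Ck k (\<lambda>x. E (r n * (b - x)))" for k n b
    using Ck_affine[OF E, of k "r n * b" "- r n"] by (simp add: algebra_simps)
  have Ck\<theta>: "Ck k (\<theta> n)" for k n
    using Ck_mult[OF Ck_const[of k "1 / r n"] Ck_add[OF Ck_add[OF Ckr[of k n "a + h"]
      Ck_mult[OF Ck_const[of k "-2"] Ckr[of k n a]]] Ckr[of k n "a - h"]]]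
    by (simp add: \<theta>_def[abs_def])
  \<comment> \<open>On one side all three terms vanish; on the other \<open>E\<close> is affine, so
    its second difference vanishes. Thus \<open>\<theta> n\<close> has compact support although
    \<open>E\<close> has not.\<close>
  have supp: "\<theta> n x = 0" if far: "h + 1 \<le> \<bar>x - a\<bar>" for n x
  proof -
    have *: "r n * 1 \<le> r n * y" if "1 \<le> y" for y using that r[of n] by (intro mult_left_mono) auto
    have **: "r n * y \<le> r n * (-1)" if "y \<le> -1" for y using that r[of n] by (intro mult_left_mono) auto
    consider "x - a \<ge> h + 1" | "x - a \<le> - (h + 1)" using far by linarith
    then show ?thesis
    proof cases
      case 1
      then have "r n * (a + h - x) \<le> -1" "r n * (a - x) \<le> -1" "r n * (a - h - x) \<le> -1"
        using **[of "a + h - x"] **[of "a - x"] **[of "a - h - x"] r[of n] h by linarith+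
      then show ?thesis by (simp add: \<theta>_def E0)
    next
      case 2
      then have "1 \<le> r n * (a + h - x)" "1 \<le> r n * (a - x)" "1 \<le> r n * (a - h - x)"
        using *[of "a + h - x"] *[of "a - x"] *[of "a - h - x"] r[of n] h by linarith+
      then show ?thesis by (simp add: \<theta>_def E1 algebra_simps)
    qed
  qed
  have test: "test_function (\<theta> n)" for n
    unfolding test_function_def
  proof (intro conjI allI)
    have "{x. \<theta> n x \<noteq> 0} \<subseteq> {a - (h + 1)..a + (h + 1)}"
    proof
      fix x assume "x \<in> {x. \<theta> n x \<noteq> 0}"
      then have "\<bar>x - a\<bar> < h + 1" using supp[of x n] not_le by blast
      then show "x \<in> {a - (h + 1)..a + (h + 1)}" by (auto simp: abs_less_iff)
    qed
    then show "bounded {x. \<theta> n x \<noteq> 0}" using bounded_subset bounded_closed_interval by blast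
  qed (rule Ck\<theta>)
  have key: "(LINT x|lborel. \<beta> x * \<theta>2 n x) = diff_integral \<mu> \<nu> (\<theta> n)" for n
    using M(3)[unfolded second_distributional_derivative_def, rule_format, OF test[of n]]
    unfolding second_deriv_eqI[OF d1 d2] diff_integral_def .
  note mol = mollifier_tendsto[OF \<beta> \<eta>, folded r_def]
  have "(LINT x|lborel. \<beta> x * \<theta>2 n x) =
      (LINT x|lborel. \<beta> x * (r n * \<eta> (r n * (a + h - x))))
      - 2 * (LINT x|lborel. \<beta> x * (r n * \<eta> (r n * (a - x))))
      + (LINT x|lborel. \<beta> x * (r n * \<eta> (r n * (a - h - x))))" for n
  proof -
    have "(\<lambda>x. \<beta> x * \<theta>2 n x) = (\<lambda>x. \<beta> x * (r n * \<eta> (r n * (a + h - x)))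
      - 2 * (\<beta> x * (r n * \<eta> (r n * (a - x)))) + \<beta> x * (r n * \<eta> (r n * (a - h - x))))"
      by (auto simp: \<theta>2_def algebra_simps)
    then show ?thesis
      using mol(2)[of n "a + h"] mol(2)[of n a] mol(2)[of n "a - h"] by simp
  qed
  then have "(\<lambda>n. LINT x|lborel. \<beta> x * \<theta>2 n x) \<longlonglongrightarrow> \<beta> (a + h) - 2 * \<beta> a + \<beta> (a - h)"
    using tendsto_add[OF tendsto_diff[OF mol(1)[of "a + h"] tendsto_mult[OF tendsto_const[of 2] mol(1)[of a]]]
        mol(1)[of "a - h"]] by simp
  moreover have "(\<lambda>n. diff_integral \<mu> \<nu> (\<theta> n)) \<longlonglongrightarrow> diff_integral \<mu> \<nu> (\<lambda>z. hat h (a - z))"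
  proof (rule diff_integral_tendsto[OF M(1,2)])
    have hat: "hat h (a - z) = (max 0 (r n * (a + h - z)) - 2 * max 0 (r n * (a - z)) + max 0 (r n * (a - h - z))) / r n"
      for n z
    proof -
      have max: "max 0 (r n * y) = r n * max 0 y" for y using r[of n]
        by (simp add: max_def zero_le_mult_iff)
      then have "(max 0 (r n * (a + h - z)) - 2 * max 0 (r n * (a - z)) + max 0 (r n * (a - h - z))) / r n
        = max 0 (a + h - z) - 2 * max 0 (a - z) + max 0 (a - h - z)"
        unfolding max using r[of n] by (simp add: add_divide_distrib diff_divide_distrib)
      also have "\<dots> = hat h (a - z)" using h by (auto simp: hat_def max_def)
      finally show ?thesis by simp
    qed
    have err: "\<bar>\<theta> n z - hat h (a - z)\<bar> \<le> 4 * C / r n" for n z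
    proof -
      have "\<theta> n z - hat h (a - z) = ((E (r n * (a + h - z)) - max 0 (r n * (a + h - z)))
        - 2 * (E (r n * (a - z)) - max 0 (r n * (a - z)))
        + (E (r n * (a - h - z)) - max 0 (r n * (a - h - z)))) / r n"
        unfolding \<theta>_def hat[of z n] by (simp add: diff_divide_distrib add_divide_distrib)
      also have "\<bar>\<dots>\<bar> = \<bar>(E (r n * (a + h - z)) - max 0 (r n * (a + h - z)))
        - 2 * (E (r n * (a - z)) - max 0 (r n * (a - z)))
        + (E (r n * (a - h - z)) - max 0 (r n * (a - h - z)))\<bar> / r n" using r[of n] by simp
      also have "\<dots> \<le> 4 * C / r n"
      proof (rule divide_right_mono)
        have "\<bar>p - 2 * q + s\<bar> \<le> 4 * C" if "\<bar>p\<bar> \<le> C" "\<bar>q\<bar> \<le> C" "\<bar>s\<bar> \<le> C" for p q s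
          using that by linarith
        from this[OF EC EC EC]
        show "\<bar>(E (r n * (a + h - z)) - max 0 (r n * (a + h - z)))
          - 2 * (E (r n * (a - z)) - max 0 (r n * (a - z)))
          + (E (r n * (a - h - z)) - max 0 (r n * (a - h - z)))\<bar> \<le> 4 * C" .
      qed (use r[of n] in simp)
      finally show ?thesis .
    qed
    have C0: "0 \<le> C" by (simp add: C_def)
    show "\<bar>\<theta> n z\<bar> \<le> h + 4 * C" for n z
    proof -
      have "4 * C / r n \<le> 4 * C" using r[of n] C0 by (simp add: divide_le_eq mult_le_cancel_left1)
      then show ?thesis using err[of n z] hat_le[of h "a - z"] hat_nonneg[of h "a - z"] h by linarith
    qed
    show "(\<lambda>n. \<theta> n z) \<longlonglongrightarrow> hat h (a - z)" for z
    proof (rule LIM_zero_cancel, rule Lim_null_comparison)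
      show "\<forall>\<^sub>F n in sequentially. norm (\<theta> n z - hat h (a - z)) \<le> 4 * C / r n"
        using err by (simp add: real_norm_def)
      show "(\<lambda>n. 4 * C / r n) \<longlonglongrightarrow> 0"
        unfolding r_def using LIMSEQ_Suc[OF lim_const_over_n[of "4 * C"]] by simp
    qed
    show "\<theta> n \<in> borel_measurable borel" for n
      by (rule borel_measurable_continuous_onI[OF Ck_imp_continuous[OF Ck\<theta>]])
    show "(\<lambda>z. hat h (a - z)) \<in> borel_measurable borel" by measurable
  qed
  ultimately show ?thesis using LIMSEQ_unique unfolding key by blast
qed

section \<open>Second derivative of a convolution\<close>

text \<open>The mean value inequality bounds every difference quotient in \<open>x\<close> by
  \<open>b\<close>, so dominated convergence applies along each sequence approaching the
  point.\<close>

lemma has_real_derivative_integral: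
  fixes K K' :: "real \<Rightarrow> 'a \<Rightarrow> real"
  assumes int: "\<And>x. integrable M (K x)"
    and K': "\<And>x y. ((\<lambda>x. K x y) has_real_derivative K' x y) (at x)"
    and le: "\<And>x y. \<bar>K' x y\<bar> \<le> b y" and b: "integrable M b"
    and meas: "\<And>x. K' x \<in> borel_measurable M"
  shows "((\<lambda>x. LINT y|M. K x y) has_real_derivative (LINT y|M. K' x y)) (at x)"
  unfolding has_field_derivative_iff tendsto_at_iff_sequentially comp_def
proof (intro allI impI)
  fix X :: "nat \<Rightarrow> real" assume X: "\<forall>i. X i \<in> UNIV - {x}" "X \<longlonglongrightarrow> x"
  have quot: "((LINT y|M. K (X i) y) - (LINT y|M. K x y)) / (X i - x)
      = (LINT y|M. (K (X i) y - K x y) / (X i - x))" for i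
    using int by simp
  show "(\<lambda>i. ((LINT y|M. K (X i) y) - (LINT y|M. K x y)) / (X i - x)) \<longlonglongrightarrow> (LINT y|M. K' x y)"
    unfolding quot
  proof (rule integral_dominated_convergence[where w = b])
    show "(\<lambda>y. (K (X i) y - K x y) / (X i - x)) \<in> borel_measurable M" for i
      using int borel_measurable_integrable by (intro borel_measurable_divide borel_measurable_diff) auto
    show "AE y in M. (\<lambda>i. (K (X i) y - K x y) / (X i - x)) \<longlonglongrightarrow> K' x y"
    proof (rule AE_I2)
      fix y
      have "((\<lambda>z. (K z y - K x y) / (z - x)) \<longlongrightarrow> K' x y) (at x)"
        using K'[of y x] by (simp add: has_field_derivative_iff)
      then show "(\<lambda>i. (K (X i) y - K x y) / (X i - x)) \<longlonglongrightarrow> K' x y"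
        using X by (auto simp: tendsto_at_iff_sequentially comp_def)
    qed
    show "AE y in M. norm ((K (X i) y - K x y) / (X i - x)) \<le> b y" for i
    proof (rule AE_I2)
      fix y
      have "norm (K (X i) y - K x y) \<le> b y * norm (X i - x)"
        by (rule field_differentiable_bound[of UNIV "\<lambda>x. K x y" "\<lambda>x. K' x y"]) (use K' le in auto)
      then show "norm ((K (X i) y - K x y) / (X i - x)) \<le> b y"
        using X(1) by (simp add: norm_divide divide_le_eq)
    qed
  qed (use meas b in auto)
qed

lemma hat_1_integral: "has_bochner_integral lborel (hat 1) 1"
proof -
  define A :: "real \<Rightarrow> real" where "A x = x - x * \<bar>x\<bar> / 2" for x
  have dA: "(A has_real_derivative 1 - \<bar>x\<bar>) (at x)" for x
  proof -
    consider "x > 0" | "x = 0" | "x < 0" by linarith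
    then have "((\<lambda>x. x * \<bar>x\<bar>) has_real_derivative 2 * \<bar>x\<bar>) (at x)"
    proof cases
      case 1
      have "((\<lambda>x. x * x) has_real_derivative 2 * \<bar>x\<bar>) (at x)"
        using 1 by (auto intro!: derivative_eq_intros)
      then show ?thesis
        by (rule has_field_derivative_transform_within_open[where S = "{0<..}"]) (use 1 in auto)
    next
      case 2
      have "((\<lambda>y::real. \<bar>y\<bar>) \<longlongrightarrow> \<bar>0\<bar>) (at 0)" by (intro tendsto_intros)
      moreover have "\<forall>\<^sub>F y::real in at 0. \<bar>y\<bar> = (y * \<bar>y\<bar> - 0 * \<bar>0\<bar>) / (y - 0)"
        by (rule eventually_at_filter[THEN iffD2], rule always_eventually) auto
      ultimately have "((\<lambda>y::real. (y * \<bar>y\<bar> - 0 * \<bar>0\<bar>) / (y - 0)) \<longlongrightarrow> \<bar>0\<bar>) (at 0)"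
        by (rule Lim_transform_eventually)
      then show ?thesis unfolding 2 has_field_derivative_iff by simp
    next
      case 3
      have "((\<lambda>x. - (x * x)) has_real_derivative 2 * \<bar>x\<bar>) (at x)"
        using 3 by (auto intro!: derivative_eq_intros)
      then show ?thesis
        by (rule has_field_derivative_transform_within_open[where S = "{..<0}"]) (use 3 in auto)
    qed
    from DERIV_diff[OF DERIV_ident DERIV_cdivide[OF this, of 2]] show ?thesis
      unfolding A_def by simp
  qed
  have "has_bochner_integral lborel (\<lambda>x. (1 - \<bar>x\<bar>) * indicator {-1..1} x) (A 1 - A (-1))"
    by (rule has_bochner_integral_FTC_Icc_real) (use dA in \<open>auto intro!: continuous_intros\<close>)
  moreover have "(\<lambda>x. (1 - \<bar>x\<bar>) * indicator {-1..1} x) = hat 1"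
    by (auto simp: fun_eq_iff hat_def max_def split: split_indicator)
  ultimately show ?thesis by (simp add: A_def)
qed

lemma integrable_hat: "h > 0 \<Longrightarrow> integrable lborel (\<lambda>y. hat h (y - z))"
proof -
  assume h: "h > 0"
  have "integrable lborel (\<lambda>y. hat 1 (- z / h + 1 / h * y))"
    using hat_1_integral h by (intro lborel_integrable_real_affine) (auto simp: has_bochner_integral_iff)
  then have "integrable lborel (\<lambda>y. h * hat 1 (- z / h + 1 / h * y))" by simp
  moreover have "h * hat 1 (- z / h + 1 / h * y) = hat h (y - z)" for y
  proof -
    have "- z / h + 1 / h * y = (y - z) / h" by (simp add: diff_divide_distrib)
    then show ?thesis using h by (simp add: hat_def max_def field_simps abs_divide)
  qed
  ultimately show ?thesis by (simp only:)
qed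

text \<open>The inner integral over \<open>y\<close> is at most \<open>B\<close> times the integral
  of one hat, uniformly in \<open>z\<close>, and a finite measure integrates constants; this gives
  the absolute convergence that Fubini requires.\<close>

lemma hat_Fubini:
  fixes w :: "real \<Rightarrow> real"
  assumes M: "finite_borel M" and w: "w \<in> borel_measurable borel" "\<And>x. \<bar>w x\<bar> \<le> B" and h: "h > 0"
  shows "(LINT y|lborel. (LINT z|M. hat h (y - z)) * w y) = (LINT z|M. LINT y|lborel. hat h (y - z) * w y)"
    and "integrable lborel (\<lambda>y. (LINT z|M. hat h (y - z)) * w y)"
proof -
  interpret M: finite_measure M using M by (simp add: finite_borel_def)
  have sM [measurable_cong]: "sets M = sets borel" using M by (simp add: finite_borel_def)
  interpret P: pair_sigma_finite M lborel by standard
  note w(1) [measurable]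
  have i: "integrable lborel (\<lambda>y. hat h (y - z) * w y)" for z
  proof (rule Bochner_Integration.integrable_bound[of _ "\<lambda>y. B * hat h (y - z)"])
    show "AE y in lborel. norm (hat h (y - z) * w y) \<le> norm (B * hat h (y - z))"
      using w(2) abs_ge_self[of B] by (intro AE_I2)
        (auto simp: abs_mult hat_nonneg mult.commute[of B] intro!: mult_left_mono intro: order_trans)
  qed (use integrable_hat[OF h] in auto)
  have bnd: "\<bar>LINT y|lborel. norm (hat h (y - z) * w y)\<bar> \<le> B * (LINT y|lborel. hat h y)" for z
  proof -
    have "\<bar>LINT y|lborel. norm (hat h (y - z) * w y)\<bar> = (LINT y|lborel. norm (hat h (y - z) * w y))"
      by (intro abs_of_nonneg integral_nonneg_AE) auto
    also have "\<dots> \<le> (LINT y|lborel. B * hat h (y - z))"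
      using integrable_hat[OF h] w(2)
      by (intro integral_mono[OF integrable_norm[OF i[of z]]])
        (auto simp: abs_mult hat_nonneg mult.commute[of B] intro!: mult_left_mono)
    also have "\<dots> = B * (LINT y|lborel. hat h (y - z))" by simp
    also have "(LINT y|lborel. hat h (y - z)) = (LINT y|lborel. hat h y)"
      using lborel_integral_real_affine[of 1 "\<lambda>y. hat h (y - z)" z] by simp
    finally show ?thesis .
  qed
  have int: "integrable (M \<Otimes>\<^sub>M lborel) (\<lambda>(z, y). hat h (y - z) * w y)"
  proof (rule P.Fubini_integrable)
    show "integrable M (\<lambda>z. LINT y|lborel. norm (case (z, y) of (z, y) \<Rightarrow> hat h (y - z) * w y))"
      by (rule finite_borel_integrable[OF M]) (use bnd in \<open>auto\<close>)
  qed (use i in auto)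
  from P.Fubini_integral[OF int]
  show "(LINT y|lborel. (LINT z|M. hat h (y - z)) * w y) = (LINT z|M. LINT y|lborel. hat h (y - z) * w y)"
    by simp
  from P.integrable_snd[OF int]
  show "integrable lborel (\<lambda>y. (LINT z|M. hat h (y - z)) * w y)"
    by simp
qed

text \<open>One application of l'Hopital leaves the symmetric difference quotient of
  \<open>w1\<close>, whose limit follows from differentiability of \<open>w1\<close> at the single
  point \<open>x\<close>. A second application would ask for continuity of the second
  derivative.\<close>

lemma symmetric_difference_tendsto:
  fixes w :: "real \<Rightarrow> real"
  assumes w: "\<And>x. (w has_real_derivative w1 x) (at x)" "(w1 has_real_derivative w2) (at x)"
  shows "((\<lambda>h. (w (x + h) - 2 * w x + w (x - h)) / h\<^sup>2) \<longlongrightarrow> w2) (at_right 0)"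
proof (rule lhopital_right_0[where g' = "\<lambda>h. 2 * h" and f' = "\<lambda>h. w1 (x + h) - w1 (x - h)"])
  have "isCont w x" using w(1) DERIV_isCont by blast
  then have c: "((\<lambda>h. w (x + h)) \<longlongrightarrow> w x) (at 0)" "((\<lambda>h. w (x - h)) \<longlongrightarrow> w x) (at 0)"
    by (auto intro!: isCont_tendsto_compose[of x w] tendsto_eq_intros)
  have "((\<lambda>h. w (x + h) - 2 * w x + w (x - h)) \<longlongrightarrow> w x - 2 * w x + w x) (at 0)"
    by (intro tendsto_intros c)
  then show "((\<lambda>h. w (x + h) - 2 * w x + w (x - h)) \<longlongrightarrow> 0) (at_right 0)"
    by (simp add: filterlim_at_split)
  show "((\<lambda>h::real. h\<^sup>2) \<longlongrightarrow> 0) (at_right 0)" by (auto intro!: tendsto_eq_intros)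
  show "\<forall>\<^sub>F h::real in at_right 0. h\<^sup>2 \<noteq> 0" "\<forall>\<^sub>F h::real in at_right 0. 2 * h \<noteq> 0"
    by (auto simp: eventually_at_filter)
  show "\<forall>\<^sub>F h in at_right 0. ((\<lambda>h. w (x + h) - 2 * w x + w (x - h)) has_real_derivative
      w1 (x + h) - w1 (x - h)) (at h)"
    by (intro always_eventually allI) (auto intro!: derivative_eq_intros DERIV_chain2[OF w(1)])
  show "\<forall>\<^sub>F h in at_right 0. ((\<lambda>h::real. h\<^sup>2) has_real_derivative 2 * h) (at h)"
    by (intro always_eventually allI) (auto intro!: derivative_eq_intros)
  have "((\<lambda>h. w1 (x + h) - w1 (x - h)) has_real_derivative w2 * 1 - w2 * - 1) (at 0)"
    by (intro DERIV_diff DERIV_chain2[of w1]) (use w(2) in \<open>auto intro!: derivative_eq_intros\<close>)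
  then have "((\<lambda>h. (w1 (x + h) - w1 (x - h)) / h) \<longlongrightarrow> 2 * w2) (at 0)"
    by (simp add: has_field_derivative_iff)
  from tendsto_mult[OF tendsto_const[of "1/2"] this]
  have "((\<lambda>h. (w1 (x + h) - w1 (x - h)) / (2 * h)) \<longlongrightarrow> w2) (at 0)" by simp
  then show "((\<lambda>h. (w1 (x + h) - w1 (x - h)) / (2 * h)) \<longlongrightarrow> w2) (at_right 0)"
    by (simp add: filterlim_at_split)
qed

lemma second_difference_bound:
  fixes w :: "real \<Rightarrow> real"
  assumes w: "\<And>x. (w has_real_derivative w1 x) (at x)" "\<And>x. (w1 has_real_derivative w2 x) (at x)"
    and B: "\<And>x. \<bar>w2 x\<bar> \<le> B" and h: "h > 0"
  shows "\<bar>(w (x + h) - 2 * w x + w (x - h)) / h\<^sup>2\<bar> \<le> 2 * B"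
proof -
  obtain p where p: "x < p" "p < x + h" "w (x + h) - w x = (x + h - x) * w1 p"
    using MVT2[of x "x + h" w w1] w(1) h by auto
  obtain q where q: "x - h < q" "q < x" "w x - w (x - h) = (x - (x - h)) * w1 q"
    using MVT2[of "x - h" x w w1] w(1) h by auto
  have "norm (w1 p - w1 q) \<le> B * norm (p - q)"
    by (rule field_differentiable_bound[of UNIV w1 w2]) (use w(2) B in auto)
  \<comment> \<open>The intermediate points lie in adjacent intervals of length \<open>h\<close>,
    hence at distance below \<open>2 * h\<close>; this is the origin of the factor 2.\<close>
  also have "\<dots> \<le> B * (2 * h)"
    using p q B[of x] by (intro mult_left_mono) auto
  finally have "\<bar>w1 p - w1 q\<bar> \<le> 2 * B * h" by simp
  moreover have "(w (x + h) - 2 * w x + w (x - h)) / h\<^sup>2 = (w1 p - w1 q) / h"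
    using p q h by (simp add: field_simps power2_eq_square)
  ultimately show ?thesis using h by (simp add: divide_le_eq)
qed

lemma conv_eq: "conv b v x = (LINT y|lborel. b y * v (x - y))"
  unfolding conv_def using lborel_integral_real_affine[of "-1" "\<lambda>y. b (x - y) * v y" x] by simp

text \<open>The weak formula for \<open>\<beta>''\<close> cannot be applied to
  \<open>w (x - z)\<close>, which need not have compact support. Instead both derivatives fall on
  \<open>w\<close>, \<open>w2\<close> is approximated by second difference quotients, and these are
  translated onto \<open>\<beta>\<close>, where they become hats integrated against
  \<open>\<beta>''\<close>. After Fubini the hats act on \<open>w\<close> as a mollifier, and the
  step tends to zero.\<close>

lemma conv_second_deriv:
  assumes \<beta>: "continuous_on UNIV \<beta>" "integrable lborel \<beta>"
    and M: "finite_borel \<mu>" "finite_borel \<nu>" "second_distributional_derivative \<beta> \<mu> \<nu>"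
    and w: "\<And>x. (w has_real_derivative w1 x) (at x)" "\<And>x. (w1 has_real_derivative w2 x) (at x)"
    and w2: "continuous_on UNIV w2"
    and B: "\<And>x. \<bar>w x\<bar> \<le> B" "\<And>x. \<bar>w1 x\<bar> \<le> B" "\<And>x. \<bar>w2 x\<bar> \<le> B"
  shows "(deriv ^^ 2) (conv \<beta> w) x = diff_integral \<mu> \<nu> (\<lambda>z. w (x - z))"
proof -
  have wc: "continuous_on UNIV w" "continuous_on UNIV w1"
    using w by (auto intro: DERIV_imp_continuous_on)
  have [measurable]: "\<beta> \<in> borel_measurable borel" "w \<in> borel_measurable borel"
    "w1 \<in> borel_measurable borel" "w2 \<in> borel_measurable borel"
    using \<beta>(1) wc w2 by (simp_all add: borel_measurable_continuous_onI)
  have int: "integrable lborel (\<lambda>y. \<beta> y * g (x - y))"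
    if [measurable]: "g \<in> borel_measurable borel" and "\<And>x. \<bar>g x\<bar> \<le> B" for g x
  proof (rule Bochner_Integration.integrable_bound[of _ "\<lambda>y. B * \<bar>\<beta> y\<bar>"])
    show "AE y in lborel. norm (\<beta> y * g (x - y)) \<le> norm (B * \<bar>\<beta> y\<bar>)"
      using that(2) abs_ge_self[of B]
      by (intro AE_I2) (auto simp: abs_mult mult.commute[of "\<bar>B\<bar>"] intro!: mult_left_mono intro: order_trans)
  qed (use \<beta> in auto)
  have step: "((\<lambda>x. LINT y|lborel. \<beta> y * g (x - y)) has_real_derivative (LINT y|lborel. \<beta> y * g' (x - y))) (at x)"
    if [measurable]: "g \<in> borel_measurable borel" "g' \<in> borel_measurable borel"
      and g: "\<And>x. \<bar>g x\<bar> \<le> B" "\<And>x. \<bar>g' x\<bar> \<le> B" "\<And>x. (g has_real_derivative g' x) (at x)" for g g' x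
  proof (rule has_real_derivative_integral[where b = "\<lambda>y. \<bar>\<beta> y\<bar> * B"])
    show "((\<lambda>x. \<beta> y * g (x - y)) has_real_derivative \<beta> y * g' (x - y)) (at x)" for x y
      by (auto intro!: derivative_eq_intros DERIV_chain2[OF g(3)])
    show "\<bar>\<beta> y * g' (x - y)\<bar> \<le> \<bar>\<beta> y\<bar> * B" for x y
      using g(2) by (auto simp: abs_mult intro: mult_left_mono)
  qed (use int that \<beta> in auto)
  have deriv: "(deriv ^^ 2) (conv \<beta> w) x = (LINT y|lborel. \<beta> y * w2 (x - y))"
    unfolding conv_eq[abs_def]
  proof -
    have "(deriv ^^ 2) (\<lambda>x. LINT y|lborel. \<beta> y * w (x - y)) = (\<lambda>x. LINT y|lborel. \<beta> y * w2 (x - y))"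
      by (rule second_deriv_eqI[of _ "\<lambda>x. LINT y|lborel. \<beta> y * w1 (x - y)"]; rule step) (use w B in auto)
    then show "(deriv ^^ 2) (\<lambda>x. LINT y|lborel. \<beta> y * w (x - y)) x = (LINT y|lborel. \<beta> y * w2 (x - y))"
      by simp
  qed
  define r where "r n = 1 / real (Suc n)" for n
  have r: "r n > 0" for n by (simp add: r_def)
  have r0: "filterlim r (at_right 0) sequentially"
    unfolding filterlim_at using LIMSEQ_Suc[OF lim_1_over_n] r by (auto simp: r_def[abs_def] intro!: always_eventually)
  have lim: "(\<lambda>n. LINT y|lborel. \<beta> y * ((w (x - y + r n) - 2 * w (x - y) + w (x - y - r n)) / (r n)\<^sup>2))
      \<longlonglongrightarrow> (LINT y|lborel. \<beta> y * w2 (x - y))"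
  proof (rule integral_dominated_convergence[where w = "\<lambda>y. \<bar>\<beta> y\<bar> * (2 * B)"])
    show "AE y in lborel. (\<lambda>n. \<beta> y * ((w (x - y + r n) - 2 * w (x - y) + w (x - y - r n)) / (r n)\<^sup>2))
      \<longlonglongrightarrow> \<beta> y * w2 (x - y)"
      by (intro AE_I2 tendsto_intros filterlim_compose[OF symmetric_difference_tendsto[OF w(1) w(2)] r0])
    show "AE y in lborel. norm (\<beta> y * ((w (x - y + r n) - 2 * w (x - y) + w (x - y - r n)) / (r n)\<^sup>2))
      \<le> \<bar>\<beta> y\<bar> * (2 * B)" for n
      unfolding real_norm_def abs_mult
      by (intro AE_I2 mult_left_mono second_difference_bound[OF w B(3) r]) auto
  qed (use \<beta> in auto)
  have eq: "(LINT y|lborel. \<beta> y * ((w (x - y + r n) - 2 * w (x - y) + w (x - y - r n)) / (r n)\<^sup>2))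
     = diff_integral \<mu> \<nu> (\<lambda>z. LINT y|lborel. w (x - y) * (real (Suc n) * hat 1 (real (Suc n) * (z - y))))" for n
  proof -
    \<comment> \<open>Translation invariance of the Lebesgue integral moves each shift by
      \<open>c\<close> from \<open>w\<close> to \<open>\<beta>\<close>.\<close>
    have sh: "(LINT y|lborel. \<beta> y * w (x - y + c)) = (LINT y|lborel. \<beta> (y + c) * w (x - y))"
      "integrable lborel (\<lambda>y. \<beta> (y + c) * w (x - y))" for c
    proof -
      have e: "(\<lambda>y. \<beta> (c + 1 * y) * w (x - (c + 1 * y) + c)) = (\<lambda>y. \<beta> (y + c) * w (x - y))"
        by (auto simp: add.commute)
      show "(LINT y|lborel. \<beta> y * w (x - y + c)) = (LINT y|lborel. \<beta> (y + c) * w (x - y))"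
        using lborel_integral_real_affine[of 1 "\<lambda>y. \<beta> y * w (x - y + c)" c] e by simp
      have "integrable lborel (\<lambda>y. \<beta> y * w (x + c - y))" by (rule int) (use B in auto)
      then have "integrable lborel (\<lambda>y. \<beta> y * w (x - y + c))" by (simp add: algebra_simps)
      from lborel_integrable_real_affine[OF this, of 1 c] e
      show "integrable lborel (\<lambda>y. \<beta> (y + c) * w (x - y))" by simp
    qed
    have i: "integrable lborel (\<lambda>y. \<beta> y * w (x - y + c))" for c
      using int[of w "x + c"] B by (simp add: algebra_simps)
    have "(LINT y|lborel. \<beta> y * ((w (x - y + r n) - 2 * w (x - y) + w (x - y - r n)) / (r n)\<^sup>2))
      = (LINT y|lborel. (\<beta> y * w (x - y + r n) - 2 * (\<beta> y * w (x - y + 0)) + \<beta> y * w (x - y + (- r n))) / (r n)\<^sup>2)"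
      by (simp add: algebra_simps)
    also have "\<dots> = ((LINT y|lborel. \<beta> y * w (x - y + r n)) - 2 * (LINT y|lborel. \<beta> y * w (x - y + 0))
       + (LINT y|lborel. \<beta> y * w (x - y + (- r n)))) / (r n)\<^sup>2"
      using i[of "r n"] i[of 0] i[of "- r n"] by simp
    also have "\<dots> = (LINT y|lborel. (\<beta> (y + r n) * w (x - y) - 2 * (\<beta> (y + 0) * w (x - y)) + \<beta> (y + (- r n)) * w (x - y)) / (r n)\<^sup>2)"
      unfolding sh(1) using sh(2)[of "r n"] sh(2)[of 0] sh(2)[of "- r n"] by simp
    also have "\<dots> = (LINT y|lborel. (\<beta> (y + r n) - 2 * \<beta> y + \<beta> (y - r n)) * w (x - y) / (r n)\<^sup>2)"
      by (simp add: algebra_simps)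
    also have "\<dots> = (LINT y|lborel. ((LINT z|\<mu>. hat (r n) (y - z)) * w (x - y)
        - (LINT z|\<nu>. hat (r n) (y - z)) * w (x - y)) / (r n)\<^sup>2)"
      unfolding second_difference_eq_hat[OF \<beta>(1) M r] diff_integral_def by (simp add: algebra_simps)
    also have "\<dots> = ((LINT z|\<mu>. LINT y|lborel. hat (r n) (y - z) * w (x - y))
        - (LINT z|\<nu>. LINT y|lborel. hat (r n) (y - z) * w (x - y))) / (r n)\<^sup>2"
      using hat_Fubini[OF M(1), of "\<lambda>y. w (x - y)" B "r n"] hat_Fubini[OF M(2), of "\<lambda>y. w (x - y)" B "r n"] B r
      by simp
    also have "\<dots> = diff_integral \<mu> \<nu> (\<lambda>z. LINT y|lborel. hat (r n) (y - z) * w (x - y) / (r n)\<^sup>2)"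
      by (simp add: diff_integral_def diff_divide_distrib)
    \<comment> \<open>Homogeneity of the hat: \<open>hat r z / r^2\<close> equals
      \<open>hat 1 (z / r) / r\<close>, a kernel of mass one. Its symmetry permits exchanging
      \<open>y - z\<close> for \<open>z - y\<close>.\<close>
    also have "(\<lambda>z y. hat (r n) (y - z) * w (x - y) / (r n)\<^sup>2)
      = (\<lambda>z y. w (x - y) * (real (Suc n) * hat 1 (real (Suc n) * (z - y))))"
    proof (intro ext)
      fix z y
      have "hat (r n) (y - z) / (r n)\<^sup>2 = real (Suc n) * hat 1 (real (Suc n) * (z - y))"
      proof -
        have "\<bar>real (Suc n) * (z - y)\<bar> = real (Suc n) * \<bar>y - z\<bar>" by (simp add: abs_mult abs_minus_commute)
        then have "hat 1 (real (Suc n) * (z - y)) = real (Suc n) * hat (r n) (y - z)"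
          unfolding hat_def r_def max_mult_distrib_left by (simp add: right_diff_distrib max_def)
        then show ?thesis by (simp add: r_def power2_eq_square)
      qed
      then show "hat (r n) (y - z) * w (x - y) / (r n)\<^sup>2 = w (x - y) * (real (Suc n) * hat 1 (real (Suc n) * (z - y)))"
        by (metis mult.commute times_divide_eq_left)
    qed
    finally show ?thesis by meson
  qed
  have "(\<lambda>n. diff_integral \<mu> \<nu> (\<lambda>z. LINT y|lborel. w (x - y) * (real (Suc n) * hat 1 (real (Suc n) * (z - y)))))
    \<longlonglongrightarrow> diff_integral \<mu> \<nu> (\<lambda>z. w (x - z))"
  proof (rule diff_integral_tendsto[OF M(1,2)])
    have wcx: "continuous_on UNIV (\<lambda>y. w (x - y))"
      by (intro continuous_on_compose2[OF wc(1)] continuous_intros) auto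
    note mol = mollifier_tendsto[OF wcx, of "hat 1"]
    have hc: "continuous_on UNIV (hat 1)" by (intro continuous_intros)
    show "(\<lambda>n. LINT y|lborel. w (x - y) * (real (Suc n) * hat 1 (real (Suc n) * (z - y)))) \<longlonglongrightarrow> w (x - z)" for z
      by (rule mol(1)) (use hat_1_integral hc hat_eq_0 in auto)
    \<comment> \<open>The kernel is nonnegative with integral one, so averaging does not increase
      the bound \<open>B\<close>; this constant dominates the passage to the limit under
      \<open>\<mu>\<close> and \<open>\<nu>\<close>.\<close>
    show "\<bar>LINT y|lborel. w (x - y) * (real (Suc n) * hat 1 (real (Suc n) * (z - y)))\<bar> \<le> B" for n z
    proof -
      have i1: "has_bochner_integral lborel (\<lambda>y. real (Suc n) * hat 1 (real (Suc n) * (z - y))) 1"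
      proof -
        have "has_bochner_integral lborel (\<lambda>y. hat 1 (real (Suc n) * z + (- real (Suc n)) * y)) (1 /\<^sub>R \<bar>- real (Suc n)\<bar>)"
          by (rule lborel_has_bochner_integral_real_affine_iff[THEN iffD1, rotated]) (use hat_1_integral in auto)
        then have "has_bochner_integral lborel (\<lambda>y. real (Suc n) * hat 1 (real (Suc n) * z + (- real (Suc n)) * y)) (real (Suc n) * (1 /\<^sub>R \<bar>- real (Suc n)\<bar>))"
          by (rule has_bochner_integral_mult_right)
        then show ?thesis by (simp add: right_diff_distrib del: of_nat_Suc)
      qed
      have "\<bar>LINT y|lborel. w (x - y) * (real (Suc n) * hat 1 (real (Suc n) * (z - y)))\<bar>
        \<le> (LINT y|lborel. \<bar>w (x - y) * (real (Suc n) * hat 1 (real (Suc n) * (z - y)))\<bar>)"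
        by (rule integral_abs_bound)
      also have "\<dots> \<le> (LINT y|lborel. B * (real (Suc n) * hat 1 (real (Suc n) * (z - y))))"
        using B(1) i1 hat_nonneg
        by (intro integral_mono' ) (auto simp: has_bochner_integral_iff abs_mult intro!: mult_right_mono mult_nonneg_nonneg order_trans[OF abs_ge_zero B(1)])
      also have "\<dots> = B" using i1 by (simp add: has_bochner_integral_iff)
      finally show ?thesis .
    qed
  qed auto
  from LIMSEQ_unique[OF lim[unfolded eq] this] show ?thesis by (simp only: deriv)
qed

section \<open>Plancherel transforms and Sobolev norms\<close>

definition trunc_fourier :: "real \<Rightarrow> (real \<Rightarrow> real) \<Rightarrow> real \<Rightarrow> complex" where
  "trunc_fourier R v \<xi> = (LINT x:{-R..R}|lborel. exp (- \<i> * of_real (x * \<xi>)) * of_real (v x))"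

lemma L2_fourier_iff:
  "L2_fourier v g \<longleftrightarrow> in_L2 v \<and> in_L2 g \<and>
    ((\<lambda>R. \<integral>\<^sup>+\<xi>. ennreal ((cmod (g \<xi> - trunc_fourier R v \<xi>))\<^sup>2) \<partial>lborel) \<longlongrightarrow> 0) at_top"
  by (simp add: L2_fourier_def trunc_fourier_def)

lemma in_L2_measurable [measurable_dest]: "in_L2 g \<Longrightarrow> g \<in> borel_measurable borel"
  by (simp add: in_L2_def)

lemma trunc_fourier_measurable [measurable]:
  assumes [measurable]: "v \<in> borel_measurable borel"
  shows "trunc_fourier R v \<in> borel_measurable borel"
  unfolding trunc_fourier_def[abs_def] set_lebesgue_integral_def by measurable

lemma in_L2_set_integrable:
  fixes v :: "real \<Rightarrow> real"
  assumes "in_L2 v"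
  shows "set_integrable lborel {-R..R} v"
  unfolding set_integrable_def
proof (rule Bochner_Integration.integrable_bound)
  note in_L2_measurable[OF assms, measurable]
  show "integrable lborel (\<lambda>x. indicator {-R..R} x + (norm (v x))\<^sup>2)"
    using assms unfolding in_L2_def
    by (intro Bochner_Integration.integrable_add integrable_real_indicator) (auto simp: emeasure_lborel_Icc_eq)
  show "(\<lambda>x. indicator {-R..R} x *\<^sub>R v x) \<in> borel_measurable lborel" by measurable
  have "\<bar>y\<bar> \<le> 1 + y\<^sup>2" for y :: real
    using zero_le_power2[of "\<bar>y\<bar> - 1"] abs_ge_zero[of y] by (simp add: power2_diff) 
  then show "AE x in lborel. norm (indicator {-R..R} x *\<^sub>R v x) \<le> norm (indicator {-R..R} x + (norm (v x))\<^sup>2)"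
    by (intro AE_I2) (auto split: split_indicator)
qed

lemma trunc_fourier_integrable:
  assumes "in_L2 v"
  shows "set_integrable lborel {-R..R} (\<lambda>x. exp (- \<i> * of_real (x * \<xi>)) * complex_of_real (v x))"
  unfolding set_integrable_def
proof (rule Bochner_Integration.integrable_bound)
  note in_L2_measurable[OF assms, measurable]
  show "integrable lborel (\<lambda>x. indicator {-R..R} x *\<^sub>R v x)"
    using in_L2_set_integrable[OF assms] by (simp add: set_integrable_def)
  show "(\<lambda>x. indicator {-R..R} x *\<^sub>R (exp (- \<i> * of_real (x * \<xi>)) * complex_of_real (v x))) \<in> borel_measurable lborel"
    by measurable
  show "AE x in lborel. norm (indicator {-R..R} x *\<^sub>R (exp (- \<i> * of_real (x * \<xi>)) * complex_of_real (v x)))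
      \<le> norm (indicator {-R..R} x *\<^sub>R v x)"
    by (intro AE_I2) (simp add: norm_mult)
qed

text \<open>Stands in for the triangle inequality in \<open>L^2\<close>. The factor 2 is harmless,
  because the estimate only serves to show that quantities are finite or tend to zero.\<close>

lemma norm_add_square_le:
  fixes a b :: "'a::real_normed_vector"
  shows "(norm (a + b))\<^sup>2 \<le> 2 * (norm a)\<^sup>2 + 2 * (norm b)\<^sup>2"
proof -
  have "(norm (a + b))\<^sup>2 \<le> (norm a + norm b)\<^sup>2"
    by (intro power_mono norm_triangle_ineq) auto
  also have "\<dots> \<le> 2 * (norm a)\<^sup>2 + 2 * (norm b)\<^sup>2"
    using zero_le_power2[of "norm a - norm b"] by (simp add: power2_eq_square algebra_simps)
  finally show ?thesis .
qed

lemma nn_integral_square_add_le: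
  fixes f g :: "real \<Rightarrow> complex"
  assumes [measurable]: "f \<in> borel_measurable borel" "g \<in> borel_measurable borel"
  shows "(\<integral>\<^sup>+x. ennreal ((cmod (f x + g x))\<^sup>2) \<partial>lborel)
    \<le> 2 * (\<integral>\<^sup>+x. ennreal ((cmod (f x))\<^sup>2) \<partial>lborel) + 2 * (\<integral>\<^sup>+x. ennreal ((cmod (g x))\<^sup>2) \<partial>lborel)"
proof -
  have "(\<integral>\<^sup>+x. ennreal ((cmod (f x + g x))\<^sup>2) \<partial>lborel)
    \<le> (\<integral>\<^sup>+x. 2 * ennreal ((cmod (f x))\<^sup>2) + 2 * ennreal ((cmod (g x))\<^sup>2) \<partial>lborel)"
  proof (rule nn_integral_mono)
    fix x
    have "ennreal ((cmod (f x + g x))\<^sup>2) \<le> ennreal (2 * (cmod (f x))\<^sup>2 + 2 * (cmod (g x))\<^sup>2)"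
      by (intro ennreal_leI norm_add_square_le)
    also have "\<dots> = 2 * ennreal ((cmod (f x))\<^sup>2) + 2 * ennreal ((cmod (g x))\<^sup>2)"
      by (simp add: ennreal_mult ennreal_plus)
    finally show "ennreal ((cmod (f x + g x))\<^sup>2) \<le> 2 * ennreal ((cmod (f x))\<^sup>2) + 2 * ennreal ((cmod (g x))\<^sup>2)" .
  qed
  also have "\<dots> = 2 * (\<integral>\<^sup>+x. ennreal ((cmod (f x))\<^sup>2) \<partial>lborel) + 2 * (\<integral>\<^sup>+x. ennreal ((cmod (g x))\<^sup>2) \<partial>lborel)"
    by (simp add: nn_integral_add nn_integral_cmult)
  finally show ?thesis .
qed

text \<open>Both transforms are \<open>L^2\<close> limits of the same truncated integrals. This
  makes the arbitrary choice inside \<open>Hs_norm\<close> immaterial.\<close>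

lemma L2_fourier_unique:
  assumes 1: "L2_fourier v g" and 2: "L2_fourier v k"
  shows "AE x in lborel. g x = k x"
proof -
  have [measurable]: "v \<in> borel_measurable borel" "g \<in> borel_measurable borel" "k \<in> borel_measurable borel"
    using 1 2 by (auto simp: L2_fourier_iff dest: in_L2_measurable)
  let ?I = "\<lambda>f. \<integral>\<^sup>+x. ennreal ((cmod (f x))\<^sup>2) \<partial>lborel"
  have "((\<lambda>R. 2 * ?I (\<lambda>x. g x - trunc_fourier R v x) + 2 * ?I (\<lambda>x. k x - trunc_fourier R v x))
      \<longlongrightarrow> 2 * 0 + 2 * 0) at_top"
    using 1 2 by (intro tendsto_add ennreal_tendsto_cmult) (auto simp: L2_fourier_iff)
  moreover have "?I (\<lambda>x. g x - k x) \<le> 2 * ?I (\<lambda>x. g x - trunc_fourier R v x) + 2 * ?I (\<lambda>x. k x - trunc_fourier R v x)" for R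
    using nn_integral_square_add_le[of "\<lambda>x. g x - trunc_fourier R v x" "\<lambda>x. trunc_fourier R v x - k x"]
    by (simp add: norm_minus_commute[of "trunc_fourier _ _ _"])
  ultimately have "?I (\<lambda>x. g x - k x) \<le> 2 * 0 + 2 * 0"
    by (intro tendsto_lowerbound) (auto intro!: always_eventually)
  then have "?I (\<lambda>x. g x - k x) = 0" by simp
  then show ?thesis by (subst (asm) nn_integral_0_iff_AE) auto
qed

lemma in_L2_add:
  fixes f g :: "real \<Rightarrow> 'a::{real_normed_vector, second_countable_topology}"
  assumes f: "in_L2 f" and g: "in_L2 g"
  shows "in_L2 (\<lambda>x. f x + g x)"
  unfolding in_L2_def
proof
  note in_L2_measurable[OF f, measurable] in_L2_measurable[OF g, measurable]
  show m: "(\<lambda>x. f x + g x) \<in> borel_measurable lborel" by measurable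
  show "integrable lborel (\<lambda>x. (norm (f x + g x))\<^sup>2)"
  proof (rule Bochner_Integration.integrable_bound)
    show "integrable lborel (\<lambda>x. 2 * (norm (f x))\<^sup>2 + 2 * (norm (g x))\<^sup>2)"
      using f g by (intro Bochner_Integration.integrable_add) (auto simp: in_L2_def)
    show "AE x in lborel. norm ((norm (f x + g x))\<^sup>2) \<le> norm (2 * (norm (f x))\<^sup>2 + 2 * (norm (g x))\<^sup>2)"
      using norm_add_square_le by (intro AE_I2) (auto intro: order_trans[OF _ abs_ge_self])
  qed measurable
qed

lemma in_L2_scaleR:
  fixes f :: "real \<Rightarrow> 'a::{real_normed_vector, second_countable_topology}"
  assumes f: "in_L2 f"
  shows "in_L2 (\<lambda>x. a *\<^sub>R f x)"
  using f by (auto simp: in_L2_def power_mult_distrib)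

lemma L2_fourier_add:
  assumes v: "L2_fourier v g" and w: "L2_fourier w k"
  shows "L2_fourier (\<lambda>x. v x + w x) (\<lambda>x. g x + k x)"
  unfolding L2_fourier_iff
proof (intro conjI)
  have L2: "in_L2 v" "in_L2 w" "in_L2 g" "in_L2 k" using v w by (auto simp: L2_fourier_iff)
  then show "in_L2 (\<lambda>x. v x + w x)" "in_L2 (\<lambda>x. g x + k x)" by (auto intro: in_L2_add)
  note L2(1,2,3,4)[THEN in_L2_measurable, measurable]
  let ?I = "\<lambda>f. \<integral>\<^sup>+x. ennreal ((cmod (f x))\<^sup>2) \<partial>lborel"
  have lin: "trunc_fourier R (\<lambda>x. v x + w x) x = trunc_fourier R v x + trunc_fourier R w x" for R x
    unfolding trunc_fourier_def of_real_add distrib_left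
    by (rule set_integral_add(2)[OF trunc_fourier_integrable[OF L2(1)] trunc_fourier_integrable[OF L2(2)]])
  show "((\<lambda>R. ?I (\<lambda>x. g x + k x - trunc_fourier R (\<lambda>x. v x + w x) x)) \<longlongrightarrow> 0) at_top"
  proof (rule tendsto_sandwich[OF _ _ tendsto_const])
    show "((\<lambda>R. 2 * ?I (\<lambda>x. g x - trunc_fourier R v x) + 2 * ?I (\<lambda>x. k x - trunc_fourier R w x)) \<longlongrightarrow> 0) at_top"
    proof -
      have "((\<lambda>R. 2 * ?I (\<lambda>x. g x - trunc_fourier R v x) + 2 * ?I (\<lambda>x. k x - trunc_fourier R w x))
          \<longlongrightarrow> 2 * 0 + 2 * 0) at_top"
        using v w by (intro tendsto_add ennreal_tendsto_cmult) (auto simp: L2_fourier_iff)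
      then show ?thesis by simp
    qed
    show "\<forall>\<^sub>F R in at_top. ?I (\<lambda>x. g x + k x - trunc_fourier R (\<lambda>x. v x + w x) x)
      \<le> 2 * ?I (\<lambda>x. g x - trunc_fourier R v x) + 2 * ?I (\<lambda>x. k x - trunc_fourier R w x)"
    proof (rule always_eventually, rule allI)
      fix R
      show "?I (\<lambda>x. g x + k x - trunc_fourier R (\<lambda>x. v x + w x) x)
        \<le> 2 * ?I (\<lambda>x. g x - trunc_fourier R v x) + 2 * ?I (\<lambda>x. k x - trunc_fourier R w x)"
        using nn_integral_square_add_le[of "\<lambda>x. g x - trunc_fourier R v x" "\<lambda>x. k x - trunc_fourier R w x"]
        by (simp add: lin algebra_simps)
    qed
  qed auto
qed

lemma L2_fourier_scale:
  assumes v: "L2_fourier v g"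
  shows "L2_fourier (\<lambda>x. a * v x) (\<lambda>x. of_real a * g x)"
  unfolding L2_fourier_iff
proof (intro conjI)
  have L2: "in_L2 v" "in_L2 g" using v by (auto simp: L2_fourier_iff)
  from in_L2_scaleR[OF L2(1), of a] in_L2_scaleR[OF L2(2), of a]
  show "in_L2 (\<lambda>x. a * v x)" "in_L2 (\<lambda>x. of_real a * g x)" by (simp_all add: scaleR_conv_of_real)
  note L2(1,2)[THEN in_L2_measurable, measurable]
  have lin: "trunc_fourier R (\<lambda>x. a * v x) x = of_real a * trunc_fourier R v x" for R x
    unfolding trunc_fourier_def
    by (subst set_integral_mult_right[symmetric]) (simp add: mult.left_commute)
  have "((\<lambda>R. ennreal (a\<^sup>2) * (\<integral>\<^sup>+x. ennreal ((cmod (g x - trunc_fourier R v x))\<^sup>2) \<partial>lborel)) \<longlongrightarrow> ennreal (a\<^sup>2) * 0) at_top"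
    using v by (intro ennreal_tendsto_cmult) (auto simp: L2_fourier_iff)
  moreover have "(\<integral>\<^sup>+x. ennreal ((cmod (of_real a * g x - trunc_fourier R (\<lambda>x. a * v x) x))\<^sup>2) \<partial>lborel)
     = ennreal (a\<^sup>2) * (\<integral>\<^sup>+x. ennreal ((cmod (g x - trunc_fourier R v x))\<^sup>2) \<partial>lborel)" for R
    unfolding lin right_diff_distrib[symmetric] norm_mult power_mult_distrib
    by (simp add: ennreal_mult nn_integral_cmult)
  ultimately show "((\<lambda>R. \<integral>\<^sup>+x. ennreal ((cmod (of_real a * g x - trunc_fourier R (\<lambda>x. a * v x) x))\<^sup>2) \<partial>lborel)
      \<longlongrightarrow> 0) at_top" by simp
qed

lemma in_Hs_add:
  assumes "in_Hs s v" "in_Hs s w"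
  shows "in_Hs s (\<lambda>x. v x + w x)"
proof -
  obtain g k where g: "L2_fourier v g" "integrable lborel (\<lambda>x. (1 + x\<^sup>2) powr s * (cmod (g x))\<^sup>2)"
    and k: "L2_fourier w k" "integrable lborel (\<lambda>x. (1 + x\<^sup>2) powr s * (cmod (k x))\<^sup>2)"
    using assms unfolding in_Hs_def by blast
  have [measurable]: "g \<in> borel_measurable borel" "k \<in> borel_measurable borel"
    using g k by (auto simp: L2_fourier_iff dest: in_L2_measurable)
  have "integrable lborel (\<lambda>x. (1 + x\<^sup>2) powr s * (cmod (g x + k x))\<^sup>2)"
  proof (rule Bochner_Integration.integrable_bound)
    show "integrable lborel (\<lambda>x. 2 * ((1 + x\<^sup>2) powr s * (cmod (g x))\<^sup>2) + 2 * ((1 + x\<^sup>2) powr s * (cmod (k x))\<^sup>2))"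
      by (intro Bochner_Integration.integrable_add integrable_mult_right g k)
    show "AE x in lborel. norm ((1 + x\<^sup>2) powr s * (cmod (g x + k x))\<^sup>2)
      \<le> norm (2 * ((1 + x\<^sup>2) powr s * (cmod (g x))\<^sup>2) + 2 * ((1 + x\<^sup>2) powr s * (cmod (k x))\<^sup>2))"
    proof (rule AE_I2)
      fix x :: real
      have "(1 + x\<^sup>2) powr s * (cmod (g x + k x))\<^sup>2 \<le> (1 + x\<^sup>2) powr s * (2 * (cmod (g x))\<^sup>2 + 2 * (cmod (k x))\<^sup>2)"
        by (intro mult_left_mono norm_add_square_le) auto
      then show "norm ((1 + x\<^sup>2) powr s * (cmod (g x + k x))\<^sup>2)
      \<le> norm (2 * ((1 + x\<^sup>2) powr s * (cmod (g x))\<^sup>2) + 2 * ((1 + x\<^sup>2) powr s * (cmod (k x))\<^sup>2))"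
        by (simp add: algebra_simps)
    qed
  qed measurable
  with L2_fourier_add[OF g(1) k(1)] show ?thesis unfolding in_Hs_def by blast
qed

lemma in_Hs_scale:
  assumes "in_Hs s v"
  shows "in_Hs s (\<lambda>x. a * v x)"
proof -
  obtain g where g: "L2_fourier v g" "integrable lborel (\<lambda>x. (1 + x\<^sup>2) powr s * (cmod (g x))\<^sup>2)"
    using assms unfolding in_Hs_def by blast
  have "integrable lborel (\<lambda>x. a\<^sup>2 * ((1 + x\<^sup>2) powr s * (cmod (g x))\<^sup>2))"
    by (intro integrable_mult_right g)
  then have "integrable lborel (\<lambda>x. (1 + x\<^sup>2) powr s * (cmod (of_real a * g x))\<^sup>2)"
    by (simp add: norm_mult power_mult_distrib mult.left_commute)
  with L2_fourier_scale[OF g(1)] show ?thesis unfolding in_Hs_def by blast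
qed

lemma in_Hs_diff: "in_Hs s v \<Longrightarrow> in_Hs s w \<Longrightarrow> in_Hs s (\<lambda>x. v x - w x)"
  using in_Hs_add[of s v "\<lambda>x. -1 * w x"] in_Hs_scale[of s w "-1"] by simp

text \<open>The transform chosen by \<open>SOME\<close> agrees almost everywhere with the one
  witnessing membership in \<open>H^s\<close>, so it inherits the weighted integrability; a single
  \<open>g\<close> then serves for membership, norm and inversion.\<close>

lemma Hs_norm_eq:
  assumes "in_Hs s v"
  obtains g where "L2_fourier v g" "integrable lborel (\<lambda>x. (1 + x\<^sup>2) powr s * (cmod (g x))\<^sup>2)"
    "Hs_norm s v = sqrt (LINT x|lborel. (1 + x\<^sup>2) powr s * (cmod (g x))\<^sup>2)"
proof -
  obtain g where g: "L2_fourier v g" "integrable lborel (\<lambda>x. (1 + x\<^sup>2) powr s * (cmod (g x))\<^sup>2)"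
    using assms unfolding in_Hs_def by blast
  define k where "k = (SOME g. L2_fourier v g)"
  have k: "L2_fourier v k" unfolding k_def using someI[of "L2_fourier v", OF g(1)] .
  have [measurable]: "g \<in> borel_measurable borel" "k \<in> borel_measurable borel"
    using g k by (auto simp: L2_fourier_iff dest: in_L2_measurable)
  have "AE x in lborel. (1 + x\<^sup>2) powr s * (cmod (g x))\<^sup>2 = (1 + x\<^sup>2) powr s * (cmod (k x))\<^sup>2"
    using L2_fourier_unique[OF g(1) k] by eventually_elim simp
  from integrable_cong_AE[THEN iffD1, OF _ _ this g(2)]
  have "integrable lborel (\<lambda>x. (1 + x\<^sup>2) powr s * (cmod (k x))\<^sup>2)" by simp
  with k show ?thesis by (rule that) (simp add: Hs_norm_def k_def)
qed

section \<open>Fourier inversion\<close>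

text \<open>A rescaling of the characteristic function of the standard normal distribution, which is
  again Gaussian.\<close>

lemma gaussian_fourier:
  assumes t: "t > 0"
  shows "(LINT \<xi>|lborel. exp (\<i> * of_real (c * \<xi>)) * of_real (std_normal_density (\<xi> / t)))
    = of_real (sqrt (2 * pi) * (t * std_normal_density (t * c)))"
proof -
  have "(LINT \<xi>|lborel. exp (\<i> * of_real (c * \<xi>)) * complex_of_real (std_normal_density (\<xi> / t)))
      = \<bar>t\<bar> *\<^sub>R (LINT \<xi>|lborel. exp (\<i> * of_real (c * (0 + t * \<xi>))) * of_real (std_normal_density ((0 + t * \<xi>) / t)))"
    using t by (subst lborel_integral_real_affine[of t _ 0]) auto
  also have "\<dots> = t *\<^sub>R (LINT \<xi>|lborel. std_normal_density \<xi> *\<^sub>R iexp (t * c * \<xi>))"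
    using t by (simp add: scaleR_conv_of_real mult_ac)
  also have "(LINT \<xi>|lborel. std_normal_density \<xi> *\<^sub>R iexp (t * c * \<xi>)) = char std_normal_distribution (t * c)"
    unfolding char_def by (subst integral_density) (auto simp: normal_density_nonneg)
  also have "\<dots> = of_real (sqrt (2 * pi) * std_normal_density (t * c))"
    unfolding char_std_normal_distribution by (simp add: std_normal_density_def)
  finally show ?thesis by (simp add: scaleR_conv_of_real mult_ac)
qed

lemma std_normal_density_integral: "has_bochner_integral lborel std_normal_density 1"
  using integrable_normal_density[of 1 0] integral_normal_density[of 1 0]
  by (simp add: has_bochner_integral_iff)

lemma std_normal_density_le_1: "std_normal_density x \<le> 1"
proof -
  have "1 / sqrt (2 * pi) \<le> 1" using pi_ge_two by (simp add: divide_le_eq real_le_rsqrt)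
  then show ?thesis
    unfolding std_normal_density_def by (intro mult_le_one) auto
qed

section \<open>Gaussian kernels as approximate identities on continuous \<open>L^2\<close>
  functions\<close>

lemma in_L2_mult_integrable:
  fixes v w :: "real \<Rightarrow> 'a::{real_normed_div_algebra, banach, second_countable_topology}"
  assumes v: "in_L2 v" and w: "in_L2 w"
  shows "integrable lborel (\<lambda>x. v x * w x)"
proof (rule Bochner_Integration.integrable_bound)
  show "integrable lborel (\<lambda>x. (norm (v x))\<^sup>2 + (norm (w x))\<^sup>2)"
    using v w by (intro Bochner_Integration.integrable_add) (auto simp: in_L2_def)
  have "p * q \<le> p\<^sup>2 + q\<^sup>2" for p q :: real
    using zero_le_square[of "p - q"] zero_le_square[of p] zero_le_square[of q]
    unfolding power2_eq_square left_diff_distrib right_diff_distrib mult.commute[of q p] by linarith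
  then show "AE x in lborel. norm (v x * w x) \<le> norm ((norm (v x))\<^sup>2 + (norm (w x))\<^sup>2)"
    by (intro AE_I2) (simp add: norm_mult)
  show "(\<lambda>x. v x * w x) \<in> borel_measurable lborel"
    using in_L2_measurable[OF v] in_L2_measurable[OF w] by simp
qed

lemma in_L2_gaussian:
  assumes "t \<noteq> 0"
  shows "in_L2 (\<lambda>x. std_normal_density (c + t * x))"
  unfolding in_L2_def
proof
  have i: "integrable lborel (\<lambda>x. std_normal_density (c + t * x))"
    using std_normal_density_integral assms
    by (intro lborel_integrable_real_affine) (auto simp: has_bochner_integral_iff)
  show m: "(\<lambda>x. std_normal_density (c + t * x)) \<in> borel_measurable lborel"
    using i by (rule borel_measurable_integrable)
  show "integrable lborel (\<lambda>x. (norm (std_normal_density (c + t * x)))\<^sup>2)"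
  proof (rule Bochner_Integration.integrable_bound[OF i])
    show "AE x in lborel. norm ((norm (std_normal_density (c + t * x)))\<^sup>2) \<le> norm (std_normal_density (c + t * x))"
      using std_normal_density_le_1
      by (intro AE_I2) (auto simp: power2_eq_square intro!: mult_left_le)
  qed (use m in measurable)
qed

text \<open>Away from the origin the concentrated kernel is at most \<open>2 / t\<close> times a
  fixed Gaussian. The inequality \<open>exp y \<ge> 1 + y\<close> is used at
  \<open>y = (t^2 - 1) / 2 * z^2\<close>, where \<open>z^2 \<ge> 1\<close> makes the right side at
  least \<open>t^2 / 2\<close>.\<close>

lemma gaussian_scaled_le:
  assumes t: "t \<ge> 1" and z: "\<bar>z\<bar> \<ge> 1"
  shows "t * std_normal_density (t * z) \<le> 2 / t * std_normal_density z"
proof -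
  have z1: "1 \<le> z\<^sup>2" using z power_mono[OF z, of 2] by simp
  have "t\<^sup>2 \<ge> 1" using t power_mono[of 1 t 2] by simp
  then have "(t\<^sup>2 - 1) / 2 * 1 \<le> (t\<^sup>2 - 1) / 2 * z\<^sup>2" using z1 by (intro mult_left_mono) auto
  then have "t\<^sup>2 / 2 \<le> 1 + (t\<^sup>2 - 1) / 2 * z\<^sup>2" by (simp add: field_simps)
  also have "\<dots> \<le> exp ((t\<^sup>2 - 1) / 2 * z\<^sup>2)" by (rule exp_ge_add_one_self)
  finally have "t\<^sup>2 / 2 * exp (- (t * z)\<^sup>2 / 2) \<le> exp ((t\<^sup>2 - 1) / 2 * z\<^sup>2) * exp (- (t * z)\<^sup>2 / 2)"
    by (intro mult_right_mono) auto
  also have "\<dots> = exp (- z\<^sup>2 / 2)"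
    by (simp add: exp_add[symmetric] power_mult_distrib field_simps)
  finally have "t\<^sup>2 * exp (- (t * z)\<^sup>2 / 2) \<le> 2 * exp (- z\<^sup>2 / 2)" by simp
  then have "t * exp (- (t * z)\<^sup>2 / 2) \<le> 2 / t * exp (- z\<^sup>2 / 2)"
    using t by (simp add: field_simps power2_eq_square)
  then have "1 / sqrt (2 * pi) * (t * exp (- (t * z)\<^sup>2 / 2)) \<le> 1 / sqrt (2 * pi) * (2 / t * exp (- z\<^sup>2 / 2))"
    by (intro mult_left_mono) auto
  then show ?thesis by (simp add: std_normal_density_def mult_ac)
qed

text \<open>The kernel has unbounded support and \<open>v\<close> need not be bounded, so the
  integral is split. Near \<open>b\<close> continuity bounds \<open>v\<close> and dominated
  convergence applies; far from \<open>b\<close> the kernel is \<open>O(1/n)\<close> times a fixed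
  Gaussian, whose product with \<open>v\<close> is integrable because both are in
  \<open>L^2\<close>.\<close>

lemma gaussian_mollifier_tendsto:
  fixes v :: "real \<Rightarrow> real"
  assumes c: "continuous_on UNIV v" and L2: "in_L2 v"
  shows "(\<lambda>n. LINT x|lborel. v x * (real (Suc n) * std_normal_density (real (Suc n) * (b - x)))) \<longlonglongrightarrow> v b"
proof -
  define p where "p n x = real (Suc n) * std_normal_density (real (Suc n) * (b - x))" for n x
  define near where "near = {b - 1..b + 1}"
  note in_L2_measurable[OF L2, measurable]
  have [measurable]: "p n \<in> borel_measurable borel" for n unfolding p_def by measurable
  have [measurable]: "near \<in> sets borel" by (simp add: near_def)
  have p0: "0 \<le> p n x" for n x by (simp add: p_def normal_density_nonneg)
  have int: "integrable lborel (\<lambda>x. v x * std_normal_density (c * (b - x)))" if "c \<noteq> 0" for c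
    using in_L2_mult_integrable[OF L2 in_L2_gaussian[of "-c" "c * b"]] that by (simp add: algebra_simps)
  have intp: "integrable lborel (\<lambda>x. v x * p n x)" for n
  proof -
    have "integrable lborel (\<lambda>x. real (Suc n) * (v x * std_normal_density (real (Suc n) * (b - x))))"
      by (intro integrable_mult_right int) simp
    then show ?thesis by (simp add: p_def mult.left_commute)
  qed
  obtain B where B: "\<And>x. x \<in> near \<Longrightarrow> \<bar>v x\<bar> \<le> B"
    using continuous_on_Icc_bounded[OF c] unfolding near_def by metis
  have nint: "integrable lborel std_normal_density" "(LINT y|lborel. std_normal_density y) = 1"
    using std_normal_density_integral by (auto simp: has_bochner_integral_iff)
  have near_eq: "(LINT x|lborel. indicator near x * (v x * p n x))
      = (LINT y|lborel. indicator near (b + (- 1 / real (Suc n)) * y) * v (b + (- 1 / real (Suc n)) * y) * std_normal_density y)" for n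
  proof -
    have "(\<lambda>y. indicator near (b + (- 1 / real (Suc n)) * y) * (v (b + (- 1 / real (Suc n)) * y) * p n (b + (- 1 / real (Suc n)) * y)))
      = (\<lambda>y. real (Suc n) * (indicator near (b + (- 1 / real (Suc n)) * y) * v (b + (- 1 / real (Suc n)) * y) * std_normal_density y))"
      by (auto simp: fun_eq_iff p_def)
    then show ?thesis
      by (subst lborel_integral_real_affine[of "- 1 / real (Suc n)" _ b]) (simp_all only:, simp_all)
  qed
  have "(\<lambda>n. LINT x|lborel. indicator near x * (v x * p n x)) \<longlonglongrightarrow> (LINT y|lborel. v b * std_normal_density y)"
    unfolding near_eq
  proof (rule integral_dominated_convergence[where w = "\<lambda>y. B * std_normal_density y"])
    show "AE y in lborel. (\<lambda>n. indicator near (b + (- 1 / real (Suc n)) * y) * v (b + (- 1 / real (Suc n)) * y) * std_normal_density y)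
      \<longlonglongrightarrow> v b * std_normal_density y"
    proof (intro AE_I2 tendsto_mult tendsto_const)
      fix y
      have "(\<lambda>n. b + (- 1 * (1 / real (Suc n))) * y) \<longlonglongrightarrow> b + (- 1 * 0) * y"
        by (intro tendsto_intros LIMSEQ_Suc[OF lim_1_over_n])
      then have l: "(\<lambda>n. b + (- 1 / real (Suc n)) * y) \<longlonglongrightarrow> b" by simp
      moreover have "isCont v b" using c by (simp add: continuous_on_eq_continuous_at)
      ultimately have v: "(\<lambda>n. v (b + (- 1 / real (Suc n)) * y)) \<longlonglongrightarrow> v b"
        by (rule isCont_tendsto_compose[rotated])
      have "\<forall>\<^sub>F n in sequentially. b + (- 1 / real (Suc n)) * y \<in> {b - 1<..<b + 1}"
        by (rule topological_tendstoD[OF l]) auto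
      then have "\<forall>\<^sub>F n in sequentially. v (b + (- 1 / real (Suc n)) * y)
        = indicator near (b + (- 1 / real (Suc n)) * y) * v (b + (- 1 / real (Suc n)) * y)"
        by eventually_elim (auto simp: near_def)
      with v show "(\<lambda>n. indicator near (b + (- 1 / real (Suc n)) * y) * v (b + (- 1 / real (Suc n)) * y)) \<longlonglongrightarrow> v b"
        by (rule Lim_transform_eventually)
    qed
    show "AE y in lborel. norm (indicator near (b + (- 1 / real (Suc n)) * y) * v (b + (- 1 / real (Suc n)) * y) * std_normal_density y)
      \<le> B * std_normal_density y" for n
    proof (rule AE_I2)
      fix y
      have "\<bar>indicator near x * v x\<bar> \<le> B" for x
        using B[of x] B[of b] by (auto simp: near_def split: split_indicator)
      then show "norm (indicator near (b + (- 1 / real (Suc n)) * y) * v (b + (- 1 / real (Suc n)) * y) * std_normal_density y)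
        \<le> B * std_normal_density y"
        unfolding real_norm_def abs_mult[of _ "std_normal_density y"]
        by (simp add: normal_density_nonneg mult_right_mono)
    qed
  qed (use nint in auto)
  then have near_lim: "(\<lambda>n. LINT x|lborel. indicator near x * (v x * p n x)) \<longlonglongrightarrow> v b"
    using nint by simp
  \<comment> \<open>The same constant bounds the far part for every \<open>n\<close>; only the
    prefactor \<open>2 / Suc n\<close> changes.\<close>
  define K where "K = (LINT x|lborel. \<bar>v x * std_normal_density (b - x)\<bar>)"
  have far_lim: "(\<lambda>n. LINT x|lborel. indicator (- near) x * (v x * p n x)) \<longlonglongrightarrow> 0"
  proof (rule Lim_null_comparison)
    show "(\<lambda>n. 2 / real (Suc n) * K) \<longlonglongrightarrow> 0"
      by (intro tendsto_mult_left_zero LIMSEQ_Suc[OF lim_const_over_n[of 2]])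
    show "\<forall>\<^sub>F n in sequentially. norm (LINT x|lborel. indicator (- near) x * (v x * p n x)) \<le> 2 / real (Suc n) * K"
    proof (intro always_eventually allI)
      fix n
      have "norm (LINT x|lborel. indicator (- near) x * (v x * p n x))
        \<le> (LINT x|lborel. norm (indicator (- near) x * (v x * p n x)))"
        by (rule integral_norm_bound)
      also have "\<dots> \<le> (LINT x|lborel. 2 / real (Suc n) * \<bar>v x * std_normal_density (b - x)\<bar>)"
      proof (rule integral_mono_AE)
        show "integrable lborel (\<lambda>x. norm (indicator (- near) x * (v x * p n x)))"
          by (intro integrable_norm integrable_real_mult_indicator[OF _ intp, simplified mult.commute]) measurable
        show "integrable lborel (\<lambda>x. 2 / real (Suc n) * \<bar>v x * std_normal_density (b - x)\<bar>)"
          using int[of 1] by (intro integrable_mult_right integrable_abs) simp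
        show "AE x in lborel. norm (indicator (- near) x * (v x * p n x)) \<le> 2 / real (Suc n) * \<bar>v x * std_normal_density (b - x)\<bar>"
        proof (rule AE_I2)
          fix x
          show "norm (indicator (- near) x * (v x * p n x)) \<le> 2 / real (Suc n) * \<bar>v x * std_normal_density (b - x)\<bar>"
          proof (cases "x \<in> near")
            case False
            then have "1 \<le> \<bar>b - x\<bar>" by (auto simp: near_def)
            then have "p n x \<le> 2 / real (Suc n) * std_normal_density (b - x)"
              unfolding p_def by (intro gaussian_scaled_le) auto
            then have "\<bar>v x\<bar> * p n x \<le> \<bar>v x\<bar> * (2 / real (Suc n) * std_normal_density (b - x))"
              by (rule mult_left_mono) simp
            then show ?thesis
              using False p0[of n x] by (simp add: abs_mult normal_density_nonneg mult_ac)
          qed simp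
        qed
      qed
      also have "\<dots> = 2 / real (Suc n) * K" unfolding K_def by simp
      finally show "norm (LINT x|lborel. indicator (- near) x * (v x * p n x)) \<le> 2 / real (Suc n) * K" .
    qed
  qed
  have split: "(LINT x|lborel. v x * p n x) = (LINT x|lborel. indicator near x * (v x * p n x))
     + (LINT x|lborel. indicator (- near) x * (v x * p n x))" for n
  proof -
    have "integrable lborel (\<lambda>x. indicator A x * (v x * p n x))" if "A \<in> sets borel" for A
      using integrable_real_mult_indicator[OF _ intp[of n], of A] that by (simp add: mult.commute)
    then have "(LINT x|lborel. indicator near x * (v x * p n x)) + (LINT x|lborel. indicator (- near) x * (v x * p n x))
      = (LINT x|lborel. indicator near x * (v x * p n x) + indicator (- near) x * (v x * p n x))"
      by simp
    also have "\<dots> = (LINT x|lborel. v x * p n x)"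
      by (intro Bochner_Integration.integral_cong) (auto split: split_indicator)
    finally show ?thesis by simp
  qed
  show ?thesis
    using tendsto_add[OF near_lim far_lim] unfolding split[symmetric] by (simp add: p_def)
qed

section \<open>Pairing truncated transforms with test functions\<close>

lemma trunc_fourier_bounded:
  assumes "in_L2 v"
  shows "cmod (trunc_fourier R v \<xi>) \<le> (LINT x:{-R..R}|lborel. \<bar>v x\<bar>)"
proof -
  have "cmod (trunc_fourier R v \<xi>)
    \<le> (LINT x|lborel. norm (indicator {-R..R} x *\<^sub>R (exp (- \<i> * of_real (x * \<xi>)) * complex_of_real (v x))))"
    unfolding trunc_fourier_def set_lebesgue_integral_def by (rule integral_norm_bound)
  also have "\<dots> = (LINT x:{-R..R}|lborel. \<bar>v x\<bar>)"
    unfolding set_lebesgue_integral_def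
    by (intro Bochner_Integration.integral_cong) (auto simp: norm_mult split: split_indicator)
  finally show ?thesis .
qed

text \<open>On \<open>[-R, R]\<close> the function \<open>v\<close> is integrable, so the double
  integral converges absolutely and Fubini passes the transform from \<open>v\<close> to
  \<open>k\<close>.\<close>

lemma trunc_fourier_pairing:
  assumes v: "in_L2 v" and k: "integrable lborel k"
  shows "(LINT \<xi>|lborel. trunc_fourier R v \<xi> * k \<xi>)
    = (LINT x:{-R..R}|lborel. of_real (v x) * (LINT \<xi>|lborel. exp (- \<i> * of_real (x * \<xi>)) * k \<xi>))"
proof -
  have [measurable]: "v \<in> borel_measurable borel" "k \<in> borel_measurable borel"
    using in_L2_measurable[OF v] borel_measurable_integrable[OF k] by auto
  define F where "F x \<xi> = indicator {-R..R} x *\<^sub>R (exp (- \<i> * of_real (x * \<xi>)) * complex_of_real (v x)) * k \<xi>" for x \<xi>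
  have mF: "case_prod F \<in> borel_measurable (lborel \<Otimes>\<^sub>M lborel)"
    unfolding F_def by measurable
  have iv: "integrable lborel (\<lambda>x. indicator {-R..R} x *\<^sub>R \<bar>v x\<bar>)"
    using integrable_abs[OF in_L2_set_integrable[OF v, of R, unfolded set_integrable_def]]
    by (simp add: abs_mult)
  have nF: "norm (F x \<xi>) = (indicator {-R..R} x *\<^sub>R \<bar>v x\<bar>) * norm (k \<xi>)" for x \<xi>
    by (simp add: F_def norm_mult)
  have int: "integrable (lborel \<Otimes>\<^sub>M lborel) (case_prod F)"
  proof (rule lborel_pair.Fubini_integrable)
    show "integrable lborel (\<lambda>x. LINT \<xi>|lborel. norm (case (x, \<xi>) of (x, \<xi>) \<Rightarrow> F x \<xi>))"
      using iv by (simp add: nF)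
    show "AE x in lborel. integrable lborel (\<lambda>\<xi>. case (x, \<xi>) of (x, \<xi>) \<Rightarrow> F x \<xi>)"
    proof (rule AE_I2)
      fix x
      have "integrable lborel (F x)"
      proof (rule Bochner_Integration.integrable_bound)
        show "integrable lborel (\<lambda>\<xi>. (indicator {-R..R} x *\<^sub>R \<bar>v x\<bar>) * norm (k \<xi>))"
          using k by (intro integrable_mult_right integrable_norm)
        show "F x \<in> borel_measurable lborel" unfolding F_def by measurable
      qed (simp add: nF)
      then show "integrable lborel (\<lambda>\<xi>. case (x, \<xi>) of (x, \<xi>) \<Rightarrow> F x \<xi>)" by simp
    qed
  qed (rule mF)
  have swap: "(LINT \<xi>|lborel. LINT x|lborel. F x \<xi>) = (LINT x|lborel. LINT \<xi>|lborel. F x \<xi>)"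
    by (rule lborel_pair.Fubini_integral[OF int])
  have Fx: "(LINT x|lborel. F x \<xi>) = trunc_fourier R v \<xi> * k \<xi>" for \<xi>
    unfolding F_def trunc_fourier_def set_lebesgue_integral_def by (rule integral_mult_left_zero)
  have "(LINT \<xi>|lborel. F x \<xi>) = indicator {-R..R} x *\<^sub>R
      (of_real (v x) * (LINT \<xi>|lborel. exp (- \<i> * of_real (x * \<xi>)) * k \<xi>))" for x
  proof -
    have "(LINT \<xi>|lborel. F x \<xi>) = (LINT \<xi>|lborel. (indicator {-R..R} x *\<^sub>R complex_of_real (v x)) * (exp (- \<i> * of_real (x * \<xi>)) * k \<xi>))"
      unfolding F_def by (simp add: scaleR_conv_of_real mult_ac)
    also have "\<dots> = (indicator {-R..R} x *\<^sub>R complex_of_real (v x)) * (LINT \<xi>|lborel. exp (- \<i> * of_real (x * \<xi>)) * k \<xi>)"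
      by (rule integral_mult_right_zero)
    finally show ?thesis by simp
  qed
  then show ?thesis using swap unfolding Fx set_lebesgue_integral_def by simp
qed

text \<open>The three conditions on \<open>k\<close> have separate roles: integrability pairs it
  with the bounded truncated transform, boundedness pairs it with the integrable \<open>g\<close>,
  and square integrability allows Cauchy-Schwarz. The estimate stays in \<open>ennreal\<close>,
  where the \<open>L^2\<close> distances are allowed to be infinite.\<close>

lemma L2_fourier_pairing_tendsto:
  assumes v: "L2_fourier v g" and g: "integrable lborel g"
    and k: "integrable lborel k" "in_L2 k" "\<And>\<xi>. cmod (k \<xi>) \<le> B"
  shows "((\<lambda>R. LINT \<xi>|lborel. trunc_fourier R v \<xi> * k \<xi>) \<longlongrightarrow> (LINT \<xi>|lborel. g \<xi> * k \<xi>)) at_top"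
proof -
  have L2: "in_L2 v" "in_L2 g" using v by (auto simp: L2_fourier_iff)
  have [measurable]: "v \<in> borel_measurable borel" "k \<in> borel_measurable borel" "g \<in> borel_measurable borel"
    using L2 k(2) by (auto dest: in_L2_measurable)
  let ?I = "\<lambda>f. \<integral>\<^sup>+x. ennreal ((cmod (f x))\<^sup>2) \<partial>lborel"
  have ik: "integrable lborel (\<lambda>\<xi>. trunc_fourier R v \<xi> * k \<xi>)" for R
  proof (rule Bochner_Integration.integrable_bound[of _ "\<lambda>\<xi>. (LINT x:{-R..R}|lborel. \<bar>v x\<bar>) * cmod (k \<xi>)"])
    show "AE \<xi> in lborel. norm (trunc_fourier R v \<xi> * k \<xi>) \<le> norm ((LINT x:{-R..R}|lborel. \<bar>v x\<bar>) * cmod (k \<xi>))"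
      using trunc_fourier_bounded[OF L2(1), of R]
      by (intro AE_I2) (auto simp: norm_mult abs_mult intro!: mult_right_mono intro: order_trans[OF _ abs_ge_self])
  qed (use k(1) in auto)
  have ig: "integrable lborel (\<lambda>\<xi>. g \<xi> * k \<xi>)"
  proof (rule Bochner_Integration.integrable_bound[of _ "\<lambda>\<xi>. B * cmod (g \<xi>)"])
    show "AE \<xi> in lborel. norm (g \<xi> * k \<xi>) \<le> norm (B * cmod (g \<xi>))"
      using k(3) by (intro AE_I2)
        (auto simp: norm_mult abs_mult mult.commute[of "\<bar>B\<bar>"] intro!: mult_left_mono intro: order_trans[OF _ abs_ge_self])
  qed (use g in auto)
  \<comment> \<open>In \<open>ennreal\<close>, multiplying a null sequence by a factor gives a null
    sequence only for a finite factor.\<close>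
  have fin: "?I k < top"
    using k(2) unfolding in_L2_def by (simp add: integrable_iff_bounded)
  have le: "ennreal ((cmod ((LINT \<xi>|lborel. trunc_fourier R v \<xi> * k \<xi>) - (LINT \<xi>|lborel. g \<xi> * k \<xi>)))\<^sup>2)
    \<le> ?I k * ?I (\<lambda>\<xi>. g \<xi> - trunc_fourier R v \<xi>)" for R
  proof -
    have "(LINT \<xi>|lborel. trunc_fourier R v \<xi> * k \<xi>) - (LINT \<xi>|lborel. g \<xi> * k \<xi>)
      = (LINT \<xi>|lborel. (trunc_fourier R v \<xi> * k \<xi> - g \<xi> * k \<xi>))"
      using ik[of R] ig by simp
    then have "ennreal (cmod ((LINT \<xi>|lborel. trunc_fourier R v \<xi> * k \<xi>) - (LINT \<xi>|lborel. g \<xi> * k \<xi>)))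
      \<le> (\<integral>\<^sup>+\<xi>. norm (trunc_fourier R v \<xi> * k \<xi> - g \<xi> * k \<xi>) \<partial>lborel)"
      using integral_norm_bound_ennreal[OF Bochner_Integration.integrable_diff[OF ik[of R] ig]] by simp
    also have "\<dots> = (\<integral>\<^sup>+\<xi>. ennreal (cmod (k \<xi>)) * ennreal (cmod (g \<xi> - trunc_fourier R v \<xi>)) \<partial>lborel)"
      unfolding left_diff_distrib[symmetric] norm_mult norm_minus_commute[of "trunc_fourier _ _ _"]
      by (simp add: ennreal_mult mult.commute)
    finally have "(ennreal (cmod ((LINT \<xi>|lborel. trunc_fourier R v \<xi> * k \<xi>) - (LINT \<xi>|lborel. g \<xi> * k \<xi>))))\<^sup>2
      \<le> (\<integral>\<^sup>+\<xi>. ennreal (cmod (k \<xi>)) * ennreal (cmod (g \<xi> - trunc_fourier R v \<xi>)) \<partial>lborel)\<^sup>2"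
      by (intro power_mono) auto
    also have "\<dots> \<le> ?I k * ?I (\<lambda>\<xi>. g \<xi> - trunc_fourier R v \<xi>)"
      using Cauchy_Schwarz_nn_integral[of "\<lambda>\<xi>. ennreal (cmod (k \<xi>))" lborel "\<lambda>\<xi>. ennreal (cmod (g \<xi> - trunc_fourier R v \<xi>))"]
      by (simp add: ennreal_power)
    finally show ?thesis by (simp add: ennreal_power)
  qed
  have "((\<lambda>R. ?I k * ?I (\<lambda>\<xi>. g \<xi> - trunc_fourier R v \<xi>)) \<longlongrightarrow> ?I k * 0) at_top"
    using v fin by (intro ennreal_tendsto_cmult) (auto simp: L2_fourier_iff)
  then have up: "((\<lambda>R. ?I k * ?I (\<lambda>\<xi>. g \<xi> - trunc_fourier R v \<xi>)) \<longlongrightarrow> ennreal 0) at_top" by simp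
  define D where "D R = (LINT \<xi>|lborel. trunc_fourier R v \<xi> * k \<xi>) - (LINT \<xi>|lborel. g \<xi> * k \<xi>)" for R
  have "((\<lambda>R. ennreal ((cmod (D R))\<^sup>2)) \<longlongrightarrow> ennreal 0) at_top"
    by (rule tendsto_sandwich[OF _ _ tendsto_const up])
      (unfold D_def, use le in \<open>simp_all only: ennreal_0 zero_le eventually_True\<close>)
  then have "((\<lambda>R. (cmod (D R))\<^sup>2) \<longlongrightarrow> 0) at_top"
    by (subst (asm) tendsto_ennreal_iff) auto
  from tendsto_real_sqrt[OF this] have "((\<lambda>R. cmod (D R)) \<longlongrightarrow> 0) at_top" by simp
  then have "(D \<longlongrightarrow> 0) at_top" by (simp add: tendsto_norm_zero_iff)
  then show ?thesis unfolding D_def[abs_def] by (rule LIM_zero_cancel)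
qed

text \<open>Two successive limits. Against the damped character \<open>k n\<close>, the truncated
  transform of \<open>v\<close> gives a Gaussian average of \<open>v\<close> around
  \<open>b\<close>; letting \<open>R\<close> grow replaces the truncated transform by
  \<open>g\<close>, and letting \<open>n\<close> grow removes the damping on one side and
  concentrates the average at \<open>b\<close> on the other.\<close>

theorem fourier_inversion:
  assumes v: "L2_fourier v g" "continuous_on UNIV v" and g: "integrable lborel g"
  shows "(LINT \<xi>|lborel. g \<xi> * exp (\<i> * of_real (b * \<xi>))) = of_real (2 * pi * v b)"
proof -
  have L2: "in_L2 v" "in_L2 g" using v by (auto simp: L2_fourier_iff)
  have [measurable]: "v \<in> borel_measurable borel" "g \<in> borel_measurable borel"
    using L2 by (auto dest: in_L2_measurable)
  \<comment> \<open>A character damped by a Gaussian of width \<open>Suc n\<close>; its own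
    transform is the narrow Gaussian \<open>p n\<close> centred at \<open>b\<close>, up to the
    factor \<open>sqrt (2 * pi)\<close>.\<close>
  define k where "k n \<xi> = exp (\<i> * of_real (b * \<xi>)) * complex_of_real (std_normal_density (\<xi> / real (Suc n)))" for n \<xi>
  define p where "p n x = real (Suc n) * std_normal_density (real (Suc n) * (b - x))" for n x
  have [measurable]: "k n \<in> borel_measurable borel" "p n \<in> borel_measurable borel" for n
    unfolding k_def p_def by measurable
  have nk: "norm (k n \<xi>) = std_normal_density (0 + 1 / real (Suc n) * \<xi>)" for n \<xi>
    by (simp add: k_def norm_mult normal_density_nonneg)
  have L2n: "in_L2 (\<lambda>\<xi>. std_normal_density (0 + 1 / real (Suc n) * \<xi>))" for n
    by (rule in_L2_gaussian) simp
  have k2: "in_L2 (k n)" for n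
    using L2n[of n] by (simp add: in_L2_def nk del: of_nat_Suc)
  have k1: "integrable lborel (k n)" for n
  proof (rule Bochner_Integration.integrable_bound)
    show "integrable lborel (\<lambda>\<xi>. std_normal_density (0 + 1 / real (Suc n) * \<xi>))"
      using std_normal_density_integral
      by (intro lborel_integrable_real_affine) (auto simp: has_bochner_integral_iff)
    show "AE x in lborel. norm (k n x) \<le> norm (std_normal_density (0 + 1 / real (Suc n) * x))"
      by (simp only: nk) (simp add: abs_of_nonneg normal_density_nonneg)
  qed measurable
  have k3: "cmod (k n \<xi>) \<le> 1" for n \<xi> unfolding nk by (rule std_normal_density_le_1)
  have intp: "integrable lborel (\<lambda>x. v x * p n x)" for n
  proof -
    have "integrable lborel (\<lambda>x. v x * std_normal_density (real (Suc n) * b + (- real (Suc n)) * x))"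
      by (intro in_L2_mult_integrable L2 in_L2_gaussian) simp
    then have "integrable lborel (\<lambda>x. real (Suc n) * (v x * std_normal_density (real (Suc n) * b + (- real (Suc n)) * x)))"
      by (rule integrable_mult_right)
    then show ?thesis by (simp add: p_def right_diff_distrib mult.left_commute del: of_nat_Suc)
  qed
  have pair: "(LINT \<xi>|lborel. trunc_fourier R v \<xi> * k n \<xi>)
      = of_real (sqrt (2 * pi) * (LINT x:{-R..R}|lborel. v x * p n x))" for R n
  proof -
    have "(LINT \<xi>|lborel. exp (- \<i> * of_real (x * \<xi>)) * k n \<xi>) = of_real (sqrt (2 * pi) * p n x)" for x
    proof -
      have "exp (- \<i> * of_real (x * \<xi>)) * k n \<xi>
        = exp (\<i> * of_real ((b - x) * \<xi>)) * of_real (std_normal_density (\<xi> / real (Suc n)))" for \<xi>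
        unfolding k_def mult.assoc[symmetric] exp_add[symmetric] by (simp add: algebra_simps)
      then show ?thesis using gaussian_fourier[of "real (Suc n)" "b - x"] by (simp add: p_def)
    qed
    then have "(LINT \<xi>|lborel. trunc_fourier R v \<xi> * k n \<xi>)
      = (LINT x:{-R..R}|lborel. complex_of_real (sqrt (2 * pi) * (v x * p n x)))"
      unfolding trunc_fourier_pairing[OF L2(1) k1] by (simp add: mult_ac)
    also have "\<dots> = (LINT x|lborel. complex_of_real (sqrt (2 * pi) * (indicator {-R..R} x *\<^sub>R (v x * p n x))))"
      unfolding set_lebesgue_integral_def
      by (intro Bochner_Integration.integral_cong) (auto split: split_indicator)
    also have "\<dots> = of_real (sqrt (2 * pi) * (LINT x:{-R..R}|lborel. v x * p n x))"
      unfolding set_lebesgue_integral_def integral_complex_of_real integral_mult_right_zero by (rule refl)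
    finally show ?thesis .
  qed
  have A: "(LINT \<xi>|lborel. g \<xi> * k n \<xi>) = of_real (sqrt (2 * pi) * (LINT x|lborel. v x * p n x))" for n
  proof (rule LIMSEQ_unique)
    show "(\<lambda>m. LINT \<xi>|lborel. trunc_fourier (real m) v \<xi> * k n \<xi>) \<longlonglongrightarrow> (LINT \<xi>|lborel. g \<xi> * k n \<xi>)"
      by (rule filterlim_compose[OF L2_fourier_pairing_tendsto[OF v(1) g k1 k2 k3] filterlim_real_sequentially])
    have "(\<lambda>m. LINT x:{-real m..real m}|lborel. v x * p n x) \<longlonglongrightarrow> (LINT x|lborel. v x * p n x)"
      unfolding set_lebesgue_integral_def
    proof (rule integral_dominated_convergence[where w = "\<lambda>x. \<bar>v x * p n x\<bar>"])
      show "AE x in lborel. (\<lambda>m. indicator {-real m..real m} x *\<^sub>R (v x * p n x)) \<longlonglongrightarrow> v x * p n x"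
      proof (rule AE_I2, rule tendsto_eventually)
        fix x
        show "\<forall>\<^sub>F m in sequentially. indicator {-real m..real m} x *\<^sub>R (v x * p n x) = v x * p n x"
          using eventually_ge_at_top[of "nat \<lceil>\<bar>x\<bar>\<rceil>"]
        proof eventually_elim
          case (elim m)
          then have "\<bar>x\<bar> \<le> real m" by linarith
          then show ?case by (simp add: abs_le_iff)
        qed
      qed
      show "AE x in lborel. norm (indicator {-real m..real m} x *\<^sub>R (v x * p n x)) \<le> \<bar>v x * p n x\<bar>" for m
        by (intro AE_I2) (auto split: split_indicator)
    qed (use intp[of n] in auto)
    then show "(\<lambda>m. LINT \<xi>|lborel. trunc_fourier (real m) v \<xi> * k n \<xi>)
      \<longlonglongrightarrow> of_real (sqrt (2 * pi) * (LINT x|lborel. v x * p n x))"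
      unfolding pair by (intro tendsto_of_real tendsto_mult_left)
  qed
  \<comment> \<open>The damping tends to \<open>std_normal_density 0 = 1 / sqrt (2 * pi)\<close>;
    together with the factor from \<open>gaussian_fourier\<close> this produces
    \<open>2 * pi\<close>.\<close>
  have "(\<lambda>n. LINT \<xi>|lborel. g \<xi> * k n \<xi>) \<longlonglongrightarrow> (LINT \<xi>|lborel. g \<xi> * (exp (\<i> * of_real (b * \<xi>)) * of_real (1 / sqrt (2 * pi))))"
  proof (rule integral_dominated_convergence[where w = "\<lambda>\<xi>. cmod (g \<xi>)"])
    show "AE \<xi> in lborel. (\<lambda>n. g \<xi> * k n \<xi>) \<longlonglongrightarrow> g \<xi> * (exp (\<i> * of_real (b * \<xi>)) * of_real (1 / sqrt (2 * pi)))"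
    proof (rule AE_I2)
      fix \<xi> :: real
      have "(\<lambda>n. \<xi> / real (Suc n)) \<longlonglongrightarrow> 0" by (rule LIMSEQ_Suc[OF lim_const_over_n])
      moreover have "isCont std_normal_density 0" unfolding std_normal_density_def by simp
      ultimately have "(\<lambda>n. std_normal_density (\<xi> / real (Suc n))) \<longlonglongrightarrow> std_normal_density 0"
        by (rule isCont_tendsto_compose[rotated])
      then have "(\<lambda>n. std_normal_density (\<xi> / real (Suc n))) \<longlonglongrightarrow> 1 / sqrt (2 * pi)"
        by (simp add: std_normal_density_def)
      then show "(\<lambda>n. g \<xi> * k n \<xi>) \<longlonglongrightarrow> g \<xi> * (exp (\<i> * of_real (b * \<xi>)) * of_real (1 / sqrt (2 * pi)))"
        unfolding k_def by (intro tendsto_mult tendsto_const tendsto_of_real)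
    qed
    show "AE \<xi> in lborel. norm (g \<xi> * k n \<xi>) \<le> cmod (g \<xi>)" for n
      using k3[of n] by (intro AE_I2) (simp add: norm_mult mult_left_le)
  qed (use g in auto)
  moreover have "(\<lambda>n. LINT \<xi>|lborel. g \<xi> * k n \<xi>) \<longlonglongrightarrow> of_real (sqrt (2 * pi) * v b)"
    unfolding A p_def
    by (intro tendsto_of_real tendsto_mult_left gaussian_mollifier_tendsto v L2)
  ultimately have "(LINT \<xi>|lborel. g \<xi> * (exp (\<i> * of_real (b * \<xi>)) * of_real (1 / sqrt (2 * pi))))
      = of_real (sqrt (2 * pi) * v b)" by (rule LIMSEQ_unique)
  then have "(LINT \<xi>|lborel. g \<xi> * exp (\<i> * of_real (b * \<xi>))) * of_real (1 / sqrt (2 * pi)) = complex_of_real (sqrt (2 * pi) * v b)"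
    by (simp add: mult.assoc[symmetric])
  then have "(LINT \<xi>|lborel. g \<xi> * exp (\<i> * of_real (b * \<xi>))) * of_real (1 / sqrt (2 * pi)) * of_real (sqrt (2 * pi))
      = complex_of_real (sqrt (2 * pi) * v b) * of_real (sqrt (2 * pi))" by simp
  moreover have "complex_of_real (1 / sqrt (2 * pi)) * of_real (sqrt (2 * pi)) = 1"
    unfolding of_real_mult[symmetric] by simp
  moreover have "complex_of_real (sqrt (2 * pi) * v b) * of_real (sqrt (2 * pi)) = of_real (2 * pi * v b)"
    unfolding of_real_mult[symmetric] by (simp add: mult.commute mult.left_commute)
  ultimately show ?thesis by (simp add: mult.assoc)
qed

section \<open>Sobolev embedding\<close>

lemma integrable_inverse_1_plus_square_UNIV: "integrable lborel (\<lambda>x::real. inverse (1 + x\<^sup>2))"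
proof -
  have "einterval (-\<infinity>) \<infinity> = UNIV" by (auto simp: einterval_def)
  then show ?thesis using integrable_inverse_1_plus_square by (simp add: set_integrable_def)
qed

text \<open>Young's inequality with a free parameter \<open>l\<close>, obtained by expanding
  \<open>(l - a * q)^2 \<ge> 0\<close> for \<open>a = 1 + \<xi>^2\<close> and \<open>q\<close> the
  left side. For \<open>k \<le> 3\<close> the square of \<open>q\<close> costs \<open>a^3\<close>,
  one further \<open>a\<close> pairs with the integrable \<open>1 / a\<close>, and the total
  \<open>a^4\<close> is absorbed by \<open>a powr s\<close> exactly because
  \<open>s \<ge> 4\<close>.\<close>

lemma weighted_fourier_bound:
  fixes \<xi> s l :: real
  assumes s: "s \<ge> 4" and k: "k \<le> 3" and l: "l > 0" and G: "G \<ge> 0"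
  shows "\<bar>\<xi>\<bar> ^ k * G \<le> l / 2 * inverse (1 + \<xi>\<^sup>2) + 1 / (2 * l) * ((1 + \<xi>\<^sup>2) powr s * G\<^sup>2)"
proof -
  define a where "a = 1 + \<xi>\<^sup>2"
  have a: "a \<ge> 1" by (simp add: a_def)
  define q where "q = \<bar>\<xi>\<bar> ^ k * G"
  have "(\<bar>\<xi>\<bar> ^ k)\<^sup>2 = (\<xi>\<^sup>2) ^ k" by (simp add: power_mult[symmetric] mult.commute power_even_abs)
  also have "\<dots> \<le> a ^ k" by (intro power_mono) (auto simp: a_def)
  also have "\<dots> \<le> a ^ 3" using a k by (intro power_increasing)
  finally have "q\<^sup>2 \<le> a ^ 3 * G\<^sup>2" unfolding q_def power_mult_distrib by (intro mult_right_mono) auto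
  then have "a * q\<^sup>2 \<le> a * (a ^ 3 * G\<^sup>2)" using a by (intro mult_left_mono) auto
  also have "\<dots> = a powr 4 * G\<^sup>2" using a by (simp add: powr_numeral eval_nat_numeral)
  also have "\<dots> \<le> a powr s * G\<^sup>2" using a s by (intro mult_right_mono powr_mono) auto
  finally have 1: "a * q\<^sup>2 \<le> a powr s * G\<^sup>2" .
  have "0 \<le> (l - a * q)\<^sup>2 / (2 * l * a)" using a l by simp
  also have "\<dots> = l / 2 * inverse a + 1 / (2 * l) * (a * q\<^sup>2) - q"
    using a l by (simp add: field_simps power2_eq_square)
  finally have "q \<le> l / 2 * inverse a + 1 / (2 * l) * (a * q\<^sup>2)" by simp
  also have "\<dots> \<le> l / 2 * inverse a + 1 / (2 * l) * (a powr s * G\<^sup>2)"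
    using 1 l by (intro add_left_mono mult_left_mono) auto
  finally show ?thesis unfolding q_def a_def .
qed

lemma weighted_fourier_integrable:
  fixes g :: "real \<Rightarrow> complex"
  assumes s: "s \<ge> 4" and k: "k \<le> 3" and [measurable]: "g \<in> borel_measurable borel"
    and g: "integrable lborel (\<lambda>x. (1 + x\<^sup>2) powr s * (cmod (g x))\<^sup>2)"
  shows "integrable lborel (\<lambda>\<xi>. \<bar>\<xi>\<bar> ^ k * cmod (g \<xi>))"
    and "(LINT \<xi>|lborel. \<bar>\<xi>\<bar> ^ k * cmod (g \<xi>)) \<le> ((LINT \<xi>|lborel. inverse (1 + \<xi>\<^sup>2)) + 1) / 2
      * sqrt (LINT \<xi>|lborel. (1 + \<xi>\<^sup>2) powr s * (cmod (g \<xi>))\<^sup>2)"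
proof -
  define c where "c = (LINT \<xi>|lborel. inverse (1 + \<xi>\<^sup>2 :: real))"
  have c: "c \<ge> 0" unfolding c_def by (intro integral_nonneg_AE) auto
  define W where "W = (LINT \<xi>|lborel. (1 + \<xi>\<^sup>2) powr s * (cmod (g \<xi>))\<^sup>2)"
  have W: "W \<ge> 0" unfolding W_def by (intro integral_nonneg_AE) auto
  have dom: "integrable lborel (\<lambda>\<xi>. l / 2 * inverse (1 + \<xi>\<^sup>2) + 1 / (2 * l) * ((1 + \<xi>\<^sup>2) powr s * (cmod (g \<xi>))\<^sup>2))" for l
    by (intro Bochner_Integration.integrable_add integrable_mult_right integrable_inverse_1_plus_square_UNIV g)
  show int: "integrable lborel (\<lambda>\<xi>. \<bar>\<xi>\<bar> ^ k * cmod (g \<xi>))"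
  proof (rule Bochner_Integration.integrable_bound[OF dom[of 1]])
    show "AE \<xi> in lborel. norm (\<bar>\<xi>\<bar> ^ k * cmod (g \<xi>))
      \<le> norm (1 / 2 * inverse (1 + \<xi>\<^sup>2) + 1 / (2 * 1) * ((1 + \<xi>\<^sup>2) powr s * (cmod (g \<xi>))\<^sup>2))"
    proof (rule AE_I2)
      fix \<xi> :: real
      have "norm (\<bar>\<xi>\<bar> ^ k * cmod (g \<xi>)) = \<bar>\<xi>\<bar> ^ k * cmod (g \<xi>)" by (simp add: abs_mult)
      also have "\<dots> \<le> 1 / 2 * inverse (1 + \<xi>\<^sup>2) + 1 / (2 * 1) * ((1 + \<xi>\<^sup>2) powr s * (cmod (g \<xi>))\<^sup>2)"
        by (rule weighted_fourier_bound[OF s k]) auto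
      finally show "norm (\<bar>\<xi>\<bar> ^ k * cmod (g \<xi>))
        \<le> norm (1 / 2 * inverse (1 + \<xi>\<^sup>2) + 1 / (2 * 1) * ((1 + \<xi>\<^sup>2) powr s * (cmod (g \<xi>))\<^sup>2))"
        unfolding real_norm_def by linarith
    qed
  qed measurable
  have le: "(LINT \<xi>|lborel. \<bar>\<xi>\<bar> ^ k * cmod (g \<xi>)) \<le> l / 2 * c + 1 / (2 * l) * W" if "l > 0" for l
  proof -
    have "(LINT \<xi>|lborel. \<bar>\<xi>\<bar> ^ k * cmod (g \<xi>))
      \<le> (LINT \<xi>|lborel. l / 2 * inverse (1 + \<xi>\<^sup>2) + 1 / (2 * l) * ((1 + \<xi>\<^sup>2) powr s * (cmod (g \<xi>))\<^sup>2))"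
      by (intro integral_mono[OF int dom] weighted_fourier_bound[OF s k that]) auto
    also have "\<dots> = l / 2 * c + 1 / (2 * l) * W"
      unfolding c_def W_def using g integrable_inverse_1_plus_square_UNIV
      by (subst Bochner_Integration.integral_add) auto
    finally show ?thesis .
  qed
  have "(LINT \<xi>|lborel. \<bar>\<xi>\<bar> ^ k * cmod (g \<xi>)) \<le> (c + 1) / 2 * sqrt W"
  proof (rule field_le_epsilon)
    fix e :: real assume e: "e > 0"
    \<comment> \<open>Balancing the two terms suggests \<open>l = sqrt W\<close>, which is not
      admissible when \<open>W = 0\<close>. The excess is sized so that it costs exactly
      \<open>e\<close> after multiplication by \<open>(c + 1) / 2\<close>.\<close>
    define l where "l = sqrt W + 2 * e / (c + 1)"
    have r: "0 < 2 * e / (c + 1)" using e c by simp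
    have sW: "sqrt W \<ge> 0" using W by simp
    have l: "l > 0" using r sW unfolding l_def by linarith
    have "W = sqrt W * sqrt W" using W by simp
    also have "\<dots> \<le> l * l" using r sW unfolding l_def by (intro mult_mono) linarith+
    finally have "1 / (2 * l) * W \<le> 1 / (2 * l) * (l * l)" using l by (intro mult_left_mono) auto
    then have "l / 2 * c + 1 / (2 * l) * W \<le> (c + 1) / 2 * l" using l by (simp add: field_simps)
    also have "(c + 1) / 2 * l = (c + 1) / 2 * sqrt W + (c + 1) / 2 * (2 * e / (c + 1))"
      by (simp only: l_def distrib_left)
    also have "(c + 1) / 2 * (2 * e / (c + 1)) = e" using c by simp
    finally show "(LINT \<xi>|lborel. \<bar>\<xi>\<bar> ^ k * cmod (g \<xi>)) \<le> (c + 1) / 2 * sqrt W + e" using le[OF l] by linarith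
  qed
  then show "(LINT \<xi>|lborel. \<bar>\<xi>\<bar> ^ k * cmod (g \<xi>)) \<le> ((LINT \<xi>|lborel. inverse (1 + \<xi>\<^sup>2)) + 1) / 2
      * sqrt (LINT \<xi>|lborel. (1 + \<xi>\<^sup>2) powr s * (cmod (g \<xi>))\<^sup>2)" unfolding c_def W_def .
qed

text \<open>The constant of \<open>weighted_fourier_integrable\<close> divided by the
  \<open>2 * pi\<close> of the inversion formula.\<close>

definition sobolev_const :: real where
  "sobolev_const = ((LINT \<xi>|lborel. inverse (1 + \<xi>\<^sup>2 :: real)) + 1) / (4 * pi)"

text \<open>Inversion represents \<open>v\<close> by an absolutely convergent integral. Each space
  derivative brings down a factor \<open>\<i> * \<xi>\<close>, and up to three such factors remain
  integrable by the weighted bound, which also supplies the sup estimate.\<close>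

theorem sobolev_embedding:
  assumes s: "s \<ge> 4" and v: "in_Hs s v" "continuous_on UNIV v"
  obtains V :: "nat \<Rightarrow> real \<Rightarrow> real" where "V 0 = v"
    "\<And>k x. k < 3 \<Longrightarrow> (V k has_real_derivative V (Suc k) x) (at x)"
    "\<And>k x. k \<le> 3 \<Longrightarrow> \<bar>V k x\<bar> \<le> sobolev_const * Hs_norm s v"
proof -
  obtain g where g: "L2_fourier v g" "integrable lborel (\<lambda>x. (1 + x\<^sup>2) powr s * (cmod (g x))\<^sup>2)"
    "Hs_norm s v = sqrt (LINT x|lborel. (1 + x\<^sup>2) powr s * (cmod (g x))\<^sup>2)"
    by (rule Hs_norm_eq[OF v(1)])
  have m [measurable]: "g \<in> borel_measurable borel"
    using g by (auto simp: L2_fourier_iff dest: in_L2_measurable)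
  note w = weighted_fourier_integrable[OF s _ m g(2), folded g(3)]
  \<comment> \<open>Since \<open>v\<close> is real, the real part of the inversion integrand
    suffices, and differentiation in \<open>x\<close> stays in real calculus with sine and
    cosine.\<close>
  define K where "K k x \<xi> = Re ((\<i> * of_real \<xi>) ^ k * g \<xi> * exp (\<i> * of_real (x * \<xi>)))" for k x \<xi>
  have [measurable]: "K k x \<in> borel_measurable lborel" for k x unfolding K_def by measurable
  have Kle: "\<bar>K k x \<xi>\<bar> \<le> \<bar>\<xi>\<bar> ^ k * cmod (g \<xi>)" for k x \<xi>
    unfolding K_def by (rule order_trans[OF abs_Re_le_cmod]) (simp add: norm_mult norm_power)
  have Kint: "integrable lborel (K k x)" if "k \<le> 3" for k x
    by (rule Bochner_Integration.integrable_bound[OF w(1)[OF that]])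
      (use Kle in \<open>auto simp: abs_mult\<close>)
  have Kd: "((\<lambda>x. K k x \<xi>) has_real_derivative K (Suc k) x \<xi>) (at x)" for k x \<xi>
  proof -
    define z where "z = (\<i> * of_real \<xi>) ^ k * g \<xi>"
    have "((\<lambda>x. Re z * cos (x * \<xi>) - Im z * sin (x * \<xi>)) has_real_derivative
        Re z * (- sin (x * \<xi>) * \<xi>) - Im z * (cos (x * \<xi>) * \<xi>)) (at x)"
      by (auto intro!: derivative_eq_intros)
    moreover have "K k x \<xi> = Re z * cos (x * \<xi>) - Im z * sin (x * \<xi>)" for x
      by (simp add: K_def z_def[symmetric] Re_exp Im_exp)
    moreover have "K (Suc k) x \<xi> = Re z * (- sin (x * \<xi>) * \<xi>) - Im z * (cos (x * \<xi>) * \<xi>)"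
    proof -
      have "(\<i> * of_real \<xi>) ^ Suc k * g \<xi> = (\<i> * of_real \<xi>) * z" by (simp only: z_def power_Suc mult.assoc)
      then show ?thesis unfolding K_def by (simp only:) (simp add: Re_exp Im_exp algebra_simps)
    qed
    ultimately show ?thesis by simp
  qed
  define V where "V k x = (LINT \<xi>|lborel. K k x \<xi>) / (2 * pi)" for k x
  have "V 0 x = v x" for x
  proof -
    have i0: "integrable lborel (\<lambda>\<xi>. g \<xi>)"
      using w(1)[of 0] by (simp add: integrable_norm_iff)
    have "integrable lborel (\<lambda>\<xi>. g \<xi> * exp (\<i> * of_real (x * \<xi>)))"
      by (rule Bochner_Integration.integrable_bound[OF i0]) (auto simp: norm_mult)
    from integral_Re[OF this] have "(LINT \<xi>|lborel. K 0 x \<xi>) = Re (LINT \<xi>|lborel. g \<xi> * exp (\<i> * of_real (x * \<xi>)))"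
      by (simp add: K_def)
    also have "\<dots> = 2 * pi * v x" unfolding fourier_inversion[OF g(1) v(2) i0] by simp
    finally show ?thesis by (simp add: V_def)
  qed
  then have "V 0 = v" by auto
  moreover have "(V k has_real_derivative V (Suc k) x) (at x)" if "k < 3" for k x
    unfolding V_def[abs_def]
    by (intro DERIV_cdivide has_real_derivative_integral[where b = "\<lambda>\<xi>. \<bar>\<xi>\<bar> ^ Suc k * cmod (g \<xi>)"] Kint Kd Kle w(1))
      (use that in auto)
  moreover have "\<bar>V k x\<bar> \<le> sobolev_const * Hs_norm s v" if "k \<le> 3" for k x
  proof -
    have "\<bar>LINT \<xi>|lborel. K k x \<xi>\<bar> \<le> (LINT \<xi>|lborel. \<bar>K k x \<xi>\<bar>)" by (rule integral_abs_bound)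
    also have "\<dots> \<le> (LINT \<xi>|lborel. \<bar>\<xi>\<bar> ^ k * cmod (g \<xi>))"
      by (intro integral_mono integrable_abs Kint w(1) Kle that)
    also note w(2)[OF that]
    finally show ?thesis by (simp add: V_def sobolev_const_def field_simps)
  qed
  ultimately show ?thesis by (rule that)
qed

text \<open>A value above \<open>e\<close> far out would force \<open>|v| \<ge> e / 2\<close> on an
  interval of length \<open>d\<close> fixed by the Lipschitz constant, and hence a definite amount
  of \<open>L^2\<close> mass in a tail that has less.\<close>

lemma L2_Lipschitz_tendsto_0:
  fixes v :: "real \<Rightarrow> real"
  assumes L2: "in_L2 v" and lip: "\<And>x y. \<bar>v x - v y\<bar> \<le> L * \<bar>x - y\<bar>" and e: "e > 0"
  obtains R where "\<And>x. R \<le> \<bar>x\<bar> \<Longrightarrow> \<bar>v x\<bar> \<le> e"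
proof -
  have int: "integrable lborel (\<lambda>x. (v x)\<^sup>2)" using L2 by (simp add: in_L2_def)
  \<comment> \<open>Over a distance \<open>d\<close> the function changes by at most
    \<open>e / 2\<close>; adding 1 to \<open>|L|\<close> keeps the quotient defined for
    \<open>L = 0\<close>.\<close>
  define d where "d = e / (2 * (\<bar>L\<bar> + 1))"
  have d: "d > 0" "\<bar>L\<bar> * d \<le> e / 2" using e by (auto simp: d_def field_simps)
  have "(\<lambda>n. LINT x|lborel. indicator {x. real n \<le> \<bar>x\<bar>} x * (v x)\<^sup>2) \<longlonglongrightarrow> integral\<^sup>L lborel (\<lambda>x::real. 0 :: real)"
  proof (rule integral_dominated_convergence[where w = "\<lambda>x. (v x)\<^sup>2"])
    show "AE x in lborel. (\<lambda>n. indicator {x. real n \<le> \<bar>x\<bar>} x * (v x)\<^sup>2) \<longlonglongrightarrow> 0"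
    proof (rule AE_I2, rule tendsto_eventually)
      fix x :: real
      show "\<forall>\<^sub>F n in sequentially. indicator {x. real n \<le> \<bar>x\<bar>} x * (v x)\<^sup>2 = 0"
        using eventually_gt_at_top[of "nat \<lceil>\<bar>x\<bar>\<rceil>"]
      proof eventually_elim
        case (elim n)
        then have "\<not> real n \<le> \<bar>x\<bar>" by linarith
        then show ?case by simp
      qed
    qed
    show "AE x in lborel. norm (indicator {x. real n \<le> \<bar>x\<bar>} x * (v x)\<^sup>2) \<le> (v x)\<^sup>2" for n
      by (intro AE_I2) (auto split: split_indicator)
    show "(\<lambda>x. indicator {x. real n \<le> \<bar>x\<bar>} x * (v x)\<^sup>2) \<in> borel_measurable lborel" for n
      using in_L2_measurable[OF L2] by measurable
  qed (use int in auto)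
  then have "(\<lambda>n. LINT x|lborel. indicator {x. real n \<le> \<bar>x\<bar>} x * (v x)\<^sup>2) \<longlonglongrightarrow> 0" by simp
  then have "\<forall>\<^sub>F n in sequentially. (LINT x|lborel. indicator {x. real n \<le> \<bar>x\<bar>} x * (v x)\<^sup>2) < d * (e / 2)\<^sup>2"
    by (rule order_tendstoD) (use d e in simp)
  then obtain n where n: "(LINT x|lborel. indicator {x. real n \<le> \<bar>x\<bar>} x * (v x)\<^sup>2) < d * (e / 2)\<^sup>2"
    by (auto simp: eventually_sequentially)
  \<comment> \<open>The extra \<open>d\<close> keeps the interval \<open>{x..x + d}\<close> inside
    the tail also for negative \<open>x\<close>, where it extends towards the origin.\<close>
  have "\<bar>v x\<bar> \<le> e" if x: "real n + d \<le> \<bar>x\<bar>" for x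
  proof (rule ccontr)
    assume big: "\<not> \<bar>v x\<bar> \<le> e"
    have vy: "e / 2 \<le> \<bar>v y\<bar>" "real n \<le> \<bar>y\<bar>" if "y \<in> {x..x + d}" for y
    proof -
      have xy: "\<bar>x - y\<bar> \<le> d" using that by auto
      have "L * \<bar>x - y\<bar> \<le> \<bar>L\<bar> * d" using xy by (intro mult_mono) auto
      then show "e / 2 \<le> \<bar>v y\<bar>" using lip[of x y] d big by linarith
      show "real n \<le> \<bar>y\<bar>" using xy x by linarith
    qed
    have "d * (e / 2)\<^sup>2 = (LINT y|lborel. indicator {x..x + d} y * (e / 2)\<^sup>2)"
      using d by simp
    also have "\<dots> \<le> (LINT x|lborel. indicator {x. real n \<le> \<bar>x\<bar>} x * (v x)\<^sup>2)"
    proof (rule integral_mono)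
      show "integrable lborel (\<lambda>y. indicator {x..x + d} y * (e / 2)\<^sup>2)"
        by (intro integrable_mult_left integrable_real_indicator) (auto simp: emeasure_lborel_Icc_eq)
      show "integrable lborel (\<lambda>x. indicator {x. real n \<le> \<bar>x\<bar>} x * (v x)\<^sup>2)"
        by (rule Bochner_Integration.integrable_bound[OF int])
          (use in_L2_measurable[OF L2] in \<open>auto split: split_indicator\<close>)
      fix y
      have "(e / 2)\<^sup>2 \<le> (v y)\<^sup>2" if "y \<in> {x..x + d}"
        using power_mono[OF vy(1)[OF that], of 2] e by simp
      then show "indicator {x..x + d} y * (e / 2)\<^sup>2 \<le> indicator {x. real n \<le> \<bar>x\<bar>} y * (v y)\<^sup>2"
        using vy(2)[of y] by (auto split: split_indicator)
    qed
    finally show False using n by simp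
  qed
  then show ?thesis by (rule that)
qed

section \<open>Functions continuous in time with values in a Sobolev space\<close>

text \<open>Compactness of the time interval as a Bolzano induction: local parameters are merged by
  taking maxima, which monotonicity in \<open>M\<close> permits. It is applied with \<open>M\<close>
  a bound on derivatives and with \<open>M\<close> a decay radius.\<close>

lemma uniform_on_Icc:
  fixes Q :: "real \<Rightarrow> real \<Rightarrow> bool"
  assumes mono: "\<And>M M' t. Q M t \<Longrightarrow> M \<le> M' \<Longrightarrow> Q M' t"
    and local: "\<And>t. t \<in> {a..b} \<Longrightarrow> \<exists>M d. d > 0 \<and> (\<forall>r\<in>{a..b}. \<bar>r - t\<bar> < d \<longrightarrow> Q M r)"
    and "a \<le> b"
  shows "\<exists>M. \<forall>t\<in>{a..b}. Q M t"
proof -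
  \<comment> \<open>The apparently redundant intersection is the shape needed for the induction:
    small intervals around an endpoint may stick out of \<open>{a..b}\<close>.\<close>
  have "\<exists>M. \<forall>t\<in>{a..b} \<inter> {a..b}. Q M t"
    using \<open>a \<le> b\<close>
  proof (induction rule: Bolzano[where P = "\<lambda>c d. \<exists>M. \<forall>t\<in>{a..b} \<inter> {c..d}. Q M t"])
    case (trans x y z)
    then obtain M M' where M: "\<forall>t\<in>{a..b} \<inter> {x..y}. Q M t" "\<forall>t\<in>{a..b} \<inter> {y..z}. Q M' t"
      by blast
    have "\<forall>t\<in>{a..b} \<inter> {x..z}. Q (max M M') t"
    proof
      fix t assume t: "t \<in> {a..b} \<inter> {x..z}"
      then show "Q (max M M') t"
        using M mono[of M t "max M M'"] mono[of M' t "max M M'"] by (cases "t \<le> y") auto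
    qed
    then show ?case by blast
  next
    case (local x)
    then obtain M d where d: "d > 0" "\<forall>r\<in>{a..b}. \<bar>r - x\<bar> < d \<longrightarrow> Q M r"
      using assms(2)[of x] by auto
    show ?case
    proof (intro exI conjI allI impI)
      fix p q assume "p \<le> x \<and> x \<le> q \<and> q - p < d"
      then show "\<forall>t\<in>{a..b} \<inter> {p..q}. Q M t" using d(2) by auto
    qed (rule d(1))
  qed
  then show ?thesis by simp
qed

text \<open>A \<open>C^3\<close> bound with one constant for all orders. The scheme works with
  second derivatives; the third is carried along because it makes the second one continuous.\<close>

definition smooth_bounded :: "real \<Rightarrow> (real \<Rightarrow> real) \<Rightarrow> bool" where
  "smooth_bounded M v \<longleftrightarrow> (\<exists>V. V 0 = v \<and>
    (\<forall>k<3. \<forall>x. (V k has_real_derivative V (Suc k) x) (at x)) \<and> (\<forall>k\<le>3. \<forall>x. \<bar>V k x\<bar> \<le> M))"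

lemma smooth_boundedE:
  assumes "smooth_bounded M v"
  obtains V where "V 0 = v" "\<And>k x. k < 3 \<Longrightarrow> (V k has_real_derivative V (Suc k) x) (at x)"
    "\<And>k x. k \<le> 3 \<Longrightarrow> \<bar>V k x\<bar> \<le> M"
  using assms unfolding smooth_bounded_def by blast

lemma in_Hs_smooth_bounded:
  assumes "s \<ge> 4" "in_Hs s v" "continuous_on UNIV v"
  shows "smooth_bounded (sobolev_const * Hs_norm s v) v"
proof (rule sobolev_embedding[OF assms])
  fix V assume "V 0 = v" "\<And>k x. k < 3 \<Longrightarrow> (V k has_real_derivative V (Suc k) x) (at x)"
    "\<And>k x. k \<le> 3 \<Longrightarrow> \<bar>V k x\<bar> \<le> sobolev_const * Hs_norm s v"
  then show ?thesis unfolding smooth_bounded_def by (intro exI[of _ V]) simp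
qed

lemma sobolev_sup:
  assumes "s \<ge> 4" "in_Hs s v" "continuous_on UNIV v"
  shows "\<bar>v x\<bar> \<le> sobolev_const * Hs_norm s v"
proof (rule smooth_boundedE[OF in_Hs_smooth_bounded[OF assms]])
  fix V :: "nat \<Rightarrow> real \<Rightarrow> real" assume V: "V 0 = v" "\<And>k x. k \<le> 3 \<Longrightarrow> \<bar>V k x\<bar> \<le> sobolev_const * Hs_norm s v"
  show ?thesis using V(2)[of 0 x] unfolding V(1) by simp
qed

text \<open>The sup norm is controlled by the \<open>H^s\<close> norm, so convergence of difference
  quotients in \<open>H^s\<close> is uniform in space and in particular holds at each
  \<open>x\<close>.\<close>

lemma Hs_derivative_pointwise:
  assumes s: "s \<ge> 4" and w: "Hs_continuous s T w" "Hs_continuous s T w'" "Hs_derivative s T w w'"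
    and c: "\<And>t. t \<in> {0..T} \<Longrightarrow> continuous_on UNIV (w t)" "\<And>t. t \<in> {0..T} \<Longrightarrow> continuous_on UNIV (w' t)"
    and t: "t \<in> {0..T}"
  shows "((\<lambda>r. w r x) has_real_derivative w' t x) (at t within {0..T})"
  unfolding has_field_derivative_iff
proof (rule LIM_zero_cancel, rule Lim_null_comparison)
  let ?N = "\<lambda>r. Hs_norm s (\<lambda>x. (w r x - w t x) / (r - t) - w' t x)"
  have "(?N \<longlongrightarrow> 0) (at t within {0..T})" using w(3) t by (simp add: Hs_derivative_def)
  from tendsto_mult_right_zero[OF this]
  show "((\<lambda>r. sobolev_const * ?N r) \<longlongrightarrow> 0) (at t within {0..T})" .
  show "\<forall>\<^sub>F r in at t within {0..T}. norm ((w r x - w t x) / (r - t) - w' t x) \<le> sobolev_const * ?N r"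
    unfolding eventually_at_filter
  proof (rule always_eventually, intro allI impI)
    fix r assume r: "r \<noteq> t" "r \<in> {0..T}"
    have Hs: "in_Hs s (w r)" "in_Hs s (w t)" "in_Hs s (w' t)"
      using w r t by (auto simp: Hs_continuous_def)
    have "in_Hs s (\<lambda>x. 1 / (r - t) * (w r x - w t x) - w' t x)"
      by (intro in_Hs_diff in_Hs_scale Hs)
    then have "in_Hs s (\<lambda>x. (w r x - w t x) / (r - t) - w' t x)" by simp
    moreover have "continuous_on UNIV (\<lambda>x. (w r x - w t x) / (r - t) - w' t x)"
      using r by (intro continuous_intros c t) auto
    ultimately show "norm ((w r x - w t x) / (r - t) - w' t x) \<le> sobolev_const * ?N r"
      using sobolev_sup[OF s, of "\<lambda>x. (w r x - w t x) / (r - t) - w' t x" x] by simp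
  qed
qed

text \<open>The limit defining continuity is punctured, so \<open>r = t\<close> is excluded here and
  treated as a separate case where the lemma is applied.\<close>

lemma Hs_continuous_near:
  assumes w: "Hs_continuous s T w" and t: "t \<in> {0..T}" and e: "e > 0"
  obtains d where "d > 0"
    "\<And>r. r \<in> {0..T} \<Longrightarrow> r \<noteq> t \<Longrightarrow> \<bar>r - t\<bar> < d \<Longrightarrow> sobolev_const * Hs_norm s (\<lambda>x. w r x - w t x) \<le> e"
proof -
  have "((\<lambda>r. Hs_norm s (\<lambda>x. w r x - w t x)) \<longlongrightarrow> 0) (at t within {0..T})"
    using w t by (simp add: Hs_continuous_def)
  then have "((\<lambda>r. sobolev_const * Hs_norm s (\<lambda>x. w r x - w t x)) \<longlongrightarrow> 0) (at t within {0..T})"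
    by (rule tendsto_mult_right_zero)
  from order_tendstoD(2)[OF this e]
  obtain d where "d > 0"
    "\<And>r. r \<in> {0..T} \<Longrightarrow> r \<noteq> t \<Longrightarrow> dist r t < d \<Longrightarrow> sobolev_const * Hs_norm s (\<lambda>x. w r x - w t x) < e"
    unfolding eventually_at by blast
  then show ?thesis using that[of d] by (auto simp: dist_real_def intro: less_imp_le)
qed

lemma smooth_bounded_mono:
  assumes "smooth_bounded M v" "M \<le> M'"
  shows "smooth_bounded M' v"
proof (rule smooth_boundedE[OF assms(1)])
  fix V assume "V 0 = v" "\<And>k x. k < 3 \<Longrightarrow> (V k has_real_derivative V (Suc k) x) (at x)"
    and V: "\<And>k x. k \<le> 3 \<Longrightarrow> \<bar>V k x\<bar> \<le> M"
  moreover have "\<bar>V k x\<bar> \<le> M'" if "k \<le> 3" for k x using V[OF that, of x] assms(2) by linarith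
  ultimately show ?thesis unfolding smooth_bounded_def by (intro exI[of _ V]) simp
qed

lemma smooth_bounded_add:
  assumes "smooth_bounded M v" "smooth_bounded M' w"
  shows "smooth_bounded (M + M') (\<lambda>x. v x + w x)"
proof -
  obtain V where V: "V 0 = v" "\<And>k x. k < 3 \<Longrightarrow> (V k has_real_derivative V (Suc k) x) (at x)"
    "\<And>k x. k \<le> 3 \<Longrightarrow> \<bar>V k x\<bar> \<le> M"
    using assms(1) unfolding smooth_bounded_def by blast
  obtain W where W: "W 0 = w" "\<And>k x. k < 3 \<Longrightarrow> (W k has_real_derivative W (Suc k) x) (at x)"
    "\<And>k x. k \<le> 3 \<Longrightarrow> \<bar>W k x\<bar> \<le> M'"
    using assms(2) unfolding smooth_bounded_def by blast
  show ?thesis unfolding smooth_bounded_def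
  proof (intro exI[of _ "\<lambda>k x. V k x + W k x"] conjI allI impI)
    show "((\<lambda>x. V k x + W k x) has_real_derivative V (Suc k) x + W (Suc k) x) (at x)" if "k < 3" for k x
      by (intro DERIV_add V W that)
    show "\<bar>V k x + W k x\<bar> \<le> M + M'" if "k \<le> 3" for k x
      using V(3)[OF that, of x] W(3)[OF that, of x] by linarith
  qed (simp add: V W)
qed

lemma in_Hs_decay:
  assumes s: "s \<ge> 4" and v: "in_Hs s v" "continuous_on UNIV v" and e: "e > 0"
  obtains R where "\<And>x. R \<le> \<bar>x\<bar> \<Longrightarrow> \<bar>v x\<bar> \<le> e"
proof -
  obtain V where V: "V 0 = v" "\<And>k x. k < 3 \<Longrightarrow> (V k has_real_derivative V (Suc k) x) (at x)"
    "\<And>k x. k \<le> 3 \<Longrightarrow> \<bar>V k x\<bar> \<le> sobolev_const * Hs_norm s v"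
    using in_Hs_smooth_bounded[OF s v] unfolding smooth_bounded_def by blast
  have "norm (v x - v y) \<le> sobolev_const * Hs_norm s v * norm (x - y)" for x y
    by (rule field_differentiable_bound[of UNIV v "V 1"]) (use V(2)[of 0] V(1) V(3)[of 1] in auto)
  then have lip: "\<bar>v x - v y\<bar> \<le> sobolev_const * Hs_norm s v * \<bar>x - y\<bar>" for x y by simp
  have "in_L2 v" using v(1) by (auto simp: in_Hs_def L2_fourier_iff)
  from L2_Lipschitz_tendsto_0[OF this lip e] show ?thesis using that by blast
qed

text \<open>Near each time the increment has \<open>C^3\<close> size at most 1, so the bound at
  \<open>t\<close> enlarged by 1 serves a whole neighbourhood; compactness does the rest.\<close>

lemma Hs_continuous_uniform_bound:
  assumes s: "s \<ge> 4" and T: "T \<ge> 0" and w: "Hs_continuous s T w"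
    and c: "\<And>t. t \<in> {0..T} \<Longrightarrow> continuous_on UNIV (w t)"
  obtains M where "\<And>t. t \<in> {0..T} \<Longrightarrow> smooth_bounded M (w t)"
proof -
  have "\<exists>M. \<forall>t\<in>{0..T}. smooth_bounded M (w t)"
  proof (rule uniform_on_Icc[OF smooth_bounded_mono _ T])
    fix t assume t: "t \<in> {0..T}"
    have Hs: "in_Hs s (w r)" if "r \<in> {0..T}" for r using w that by (simp add: Hs_continuous_def)
    obtain d where d: "d > 0"
      "\<And>r. r \<in> {0..T} \<Longrightarrow> r \<noteq> t \<Longrightarrow> \<bar>r - t\<bar> < d \<Longrightarrow> sobolev_const * Hs_norm s (\<lambda>x. w r x - w t x) \<le> 1"
      using Hs_continuous_near[OF w t zero_less_one] by blast
    define M where "M = sobolev_const * Hs_norm s (w t)"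
    have t_b: "smooth_bounded M (w t)"
      unfolding M_def by (rule in_Hs_smooth_bounded[OF s Hs[OF t] c[OF t]])
    have "smooth_bounded (M + 1) (w r)" if r: "r \<in> {0..T}" "\<bar>r - t\<bar> < d" for r
    proof (cases "r = t")
      case True
      then show ?thesis using t_b smooth_bounded_mono[of M "w t" "M + 1"] by simp
    next
      case False
      have "smooth_bounded (sobolev_const * Hs_norm s (\<lambda>x. w r x - w t x)) (\<lambda>x. w r x - w t x)"
        by (intro in_Hs_smooth_bounded[OF s] in_Hs_diff Hs r t continuous_on_diff c)
      from smooth_bounded_mono[OF this d(2)[OF r(1) False r(2)]]
      show ?thesis using smooth_bounded_add[OF t_b] by fastforce
    qed
    then show "\<exists>M d. d > 0 \<and> (\<forall>r\<in>{0..T}. \<bar>r - t\<bar> < d \<longrightarrow> smooth_bounded M (w r))"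
      using d(1) by blast
  qed
  then show ?thesis using that by blast
qed

text \<open>A radius for \<open>e / 2\<close> at time \<open>t\<close> is a radius for
  \<open>e\<close> at neighbouring times, whose profiles differ by at most \<open>e / 2\<close> in
  sup norm. The resulting \<open>R\<close> determines how far the grid has to reach.\<close>

lemma Hs_continuous_uniform_decay:
  assumes s: "s \<ge> 4" and T: "T \<ge> 0" and w: "Hs_continuous s T w"
    and c: "\<And>t. t \<in> {0..T} \<Longrightarrow> continuous_on UNIV (w t)" and e: "e > 0"
  obtains R where "\<And>t x. t \<in> {0..T} \<Longrightarrow> R \<le> \<bar>x\<bar> \<Longrightarrow> \<bar>w t x\<bar> \<le> e"
proof -
  have "\<exists>R. \<forall>t\<in>{0..T}. \<forall>x. R \<le> \<bar>x\<bar> \<longrightarrow> \<bar>w t x\<bar> \<le> e"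
  proof (rule uniform_on_Icc[OF _ _ T])
    fix t assume t: "t \<in> {0..T}"
    have Hs: "in_Hs s (w r)" if "r \<in> {0..T}" for r using w that by (simp add: Hs_continuous_def)
    have e2: "e / 2 > 0" using e by simp
    obtain d where d: "d > 0"
      "\<And>r. r \<in> {0..T} \<Longrightarrow> r \<noteq> t \<Longrightarrow> \<bar>r - t\<bar> < d \<Longrightarrow> sobolev_const * Hs_norm s (\<lambda>x. w r x - w t x) \<le> e / 2"
      using Hs_continuous_near[OF w t e2] by blast
    obtain R where R: "\<And>x. R \<le> \<bar>x\<bar> \<Longrightarrow> \<bar>w t x\<bar> \<le> e / 2"
      using in_Hs_decay[OF s Hs[OF t] c[OF t] e2] by blast
    have "\<bar>w r x\<bar> \<le> e" if r: "r \<in> {0..T}" "\<bar>r - t\<bar> < d" and x: "R \<le> \<bar>x\<bar>" for r x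
    proof (cases "r = t")
      case True
      then show ?thesis using R[OF x] e by simp
    next
      case False
      have "\<bar>w r x - w t x\<bar> \<le> sobolev_const * Hs_norm s (\<lambda>x. w r x - w t x)"
        by (intro sobolev_sup[OF s] in_Hs_diff Hs r t continuous_on_diff c)
      then show ?thesis using R[OF x] d(2)[OF r(1) False r(2)] by linarith
    qed
    then show "\<exists>R d. d > 0 \<and> (\<forall>r\<in>{0..T}. \<bar>r - t\<bar> < d \<longrightarrow> (\<forall>x. R \<le> \<bar>x\<bar> \<longrightarrow> \<bar>w r x\<bar> \<le> e))"
      using d(1) by blast
  qed (meson order_trans)
  then show ?thesis using that by blast
qed

section \<open>Stability and consistency of the discrete convolution\<close>

text \<open>At every \<open>x\<close> at most two hats are nonzero: \<open>\<theta>\<close> is the position of \<open>x\<close> inside its grid cell.\<close>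

lemma hat_sum:
  fixes c :: "int \<Rightarrow> real" and x :: real
  assumes h: "h > 0" and J: "finite J"
  defines "k \<equiv> \<lfloor>x / h\<rfloor>" and "\<theta> \<equiv> x / h - \<lfloor>x / h\<rfloor>"
  shows "(\<Sum>j\<in>J. c j / h * hat h (x - of_int j * h))
    = (1 - \<theta>) * (if k \<in> J then c k else 0) + \<theta> * (if k + 1 \<in> J then c (k + 1) else 0)"
proof -
  have \<theta>: "0 \<le> \<theta>" "\<theta> < 1" unfolding \<theta>_def by linarith+
  have "x / h = of_int k + \<theta>" by (simp add: \<theta>_def k_def)
  then have x: "x = (of_int k + \<theta>) * h" using h by (simp add: field_simps)
  have hj: "hat h (x - of_int j * h) = h * max 0 (1 - \<bar>of_int (k - j) + \<theta>\<bar>)" for j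
  proof -
    have "x - of_int j * h = (of_int (k - j) + \<theta>) * h" unfolding x by (simp add: algebra_simps)
    then have "\<bar>x - of_int j * h\<bar> = h * \<bar>of_int (k - j) + \<theta>\<bar>" using h by (simp add: abs_mult)
    then show ?thesis using h unfolding hat_def by (simp add: max_mult_distrib_left right_diff_distrib)
  qed
  have "hat h (x - of_int j * h) = 0" if "j \<noteq> k" "j \<noteq> k + 1" for j
  proof -
    have "k - j \<ge> 1 \<or> k - j \<le> -2" using that by linarith
    then have "real_of_int (k - j) \<ge> 1 \<or> real_of_int (k - j) \<le> -2" by linarith
    then have "1 \<le> \<bar>of_int (k - j) + \<theta>\<bar>" using \<theta> by linarith
    then show ?thesis unfolding hj by simp
  qed
  then have "(\<Sum>j\<in>J. c j / h * hat h (x - of_int j * h)) = (\<Sum>j\<in>{k, k + 1} \<inter> J. c j / h * hat h (x - of_int j * h))"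
    by (intro sum.mono_neutral_right J) auto
  also have "\<dots> = (\<Sum>j\<in>{k, k + 1}. if j \<in> J then c j / h * hat h (x - of_int j * h) else 0)"
    by (rule sum.inter_restrict) simp
  also have "\<dots> = (1 - \<theta>) * (if k \<in> J then c k else 0) + \<theta> * (if k + 1 \<in> J then c (k + 1) else 0)"
  proof -
    have "hat h (x - of_int k * h) = h * (1 - \<theta>)" "hat h (x - of_int (k + 1) * h) = h * \<theta>"
      unfolding hj using \<theta> by auto
    then show ?thesis using h by (simp del: of_int_add)
  qed
  finally show ?thesis .
qed

text \<open>The functions \<open>hat h / h\<close> centred at the grid points form a partition of
  unity, so the sum is a convex combination of two coefficients, either of which is replaced by zero
  if its index is outside \<open>J\<close>.\<close>

lemma hat_sum_bound:
  assumes h: "h > 0" and J: "finite J" and c: "\<And>j. j \<in> J \<Longrightarrow> \<bar>c j\<bar> \<le> B" and B: "B \<ge> 0"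
  shows "\<bar>\<Sum>j\<in>J. c j / h * hat h (x - of_int j * h)\<bar> \<le> B"
proof -
  define \<theta> where "\<theta> = x / h - \<lfloor>x / h\<rfloor>"
  have \<theta>: "0 \<le> \<theta>" "\<theta> \<le> 1" unfolding \<theta>_def by linarith+
  define p q where "p = (if \<lfloor>x / h\<rfloor> \<in> J then c \<lfloor>x / h\<rfloor> else 0)"
    and "q = (if \<lfloor>x / h\<rfloor> + 1 \<in> J then c (\<lfloor>x / h\<rfloor> + 1) else 0)"
  have pq: "\<bar>p\<bar> \<le> B" "\<bar>q\<bar> \<le> B" using c B by (auto simp: p_def q_def)
  have "\<bar>(1 - \<theta>) * p + \<theta> * q\<bar> \<le> (1 - \<theta>) * \<bar>p\<bar> + \<theta> * \<bar>q\<bar>"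
    using abs_triangle_ineq[of "(1 - \<theta>) * p" "\<theta> * q"] \<theta> by (simp add: abs_mult)
  also have "\<dots> \<le> (1 - \<theta>) * B + \<theta> * B" using \<theta> pq by (intro add_mono mult_left_mono) auto
  finally show ?thesis unfolding hat_sum[OF h J] p_def q_def \<theta>_def by (simp add: algebra_simps)
qed

text \<open>Two sources of error: interpolating linearly between exact values costs
  \<open>K * h^2\<close>, and replacing nodal values outside \<open>J\<close> by zero costs a convex
  combination of numbers of size at most \<open>\<epsilon>\<close>.\<close>

lemma interpolation_error:
  fixes w :: "real \<Rightarrow> real"
  assumes h: "h > 0" and J: "finite J" and \<epsilon>: "\<And>j. j \<notin> J \<Longrightarrow> \<bar>w (of_int j * h)\<bar> \<le> \<epsilon>" "\<epsilon> \<ge> 0"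
    and w: "\<And>x. (w has_real_derivative w1 x) (at x)" "\<And>x. (w1 has_real_derivative w2 x) (at x)"
    and K: "\<And>x. \<bar>w2 x\<bar> \<le> K"
  shows "\<bar>(\<Sum>j\<in>J. w (of_int j * h) / h * hat h (x - of_int j * h)) - w x\<bar> \<le> K * h\<^sup>2 + \<epsilon>"
proof -
  define k where "k = \<lfloor>x / h\<rfloor>"
  define \<theta> where "\<theta> = x / h - \<lfloor>x / h\<rfloor>"
  have \<theta>: "0 \<le> \<theta>" "\<theta> < 1" unfolding \<theta>_def by linarith+
  have K0: "K \<ge> 0" using K[of 0] by linarith
  define a where "a = of_int k * h"
  have xa: "x = a + \<theta> * h" using h unfolding a_def k_def \<theta>_def by (simp add: field_simps)
  have ah: "of_int (k + 1) * h = a + h" by (simp add: a_def algebra_simps)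
  define p q where "p = (if k \<in> J then w a else 0)" and "q = (if k + 1 \<in> J then w (a + h) else 0)"
  have "\<bar>p - w a\<bar> \<le> \<epsilon>" using \<epsilon>(1)[of k] \<epsilon>(2) by (auto simp: p_def a_def)
  moreover have "\<bar>q - w (a + h)\<bar> \<le> \<epsilon>" using \<epsilon>(1)[of "k + 1"] \<epsilon>(2) ah by (auto simp: q_def)
  ultimately have "(1 - \<theta>) * \<bar>p - w a\<bar> + \<theta> * \<bar>q - w (a + h)\<bar> \<le> (1 - \<theta>) * \<epsilon> + \<theta> * \<epsilon>"
    using \<theta> by (intro add_mono mult_left_mono) auto
  also have "(1 - \<theta>) * \<epsilon> + \<theta> * \<epsilon> = \<epsilon>" by (simp add: algebra_simps)
  finally have "(1 - \<theta>) * \<bar>p - w a\<bar> + \<theta> * \<bar>q - w (a + h)\<bar> \<le> \<epsilon>" .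
  moreover have "\<bar>(1 - \<theta>) * (p - w a) + \<theta> * (q - w (a + h))\<bar> \<le> (1 - \<theta>) * \<bar>p - w a\<bar> + \<theta> * \<bar>q - w (a + h)\<bar>"
    by (rule order_trans[OF abs_triangle_ineq]) (use \<theta> in \<open>simp add: abs_mult\<close>)
  ultimately have 1: "\<bar>(1 - \<theta>) * (p - w a) + \<theta> * (q - w (a + h))\<bar> \<le> \<epsilon>" by linarith
  have 2: "\<bar>(1 - \<theta>) * w a + \<theta> * w (a + h) - w x\<bar> \<le> K * h\<^sup>2"
  \<comment> \<open>At a grid point the interval from \<open>a\<close> to \<open>x\<close> is
    degenerate and the mean value theorem does not apply; there the interpolant is exact.\<close>
  proof (cases "\<theta> = 0")
    case True
    then show ?thesis using xa K0 by simp
  next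
    case False
    then have th: "0 < \<theta> * h" "\<theta> * h \<le> h" using \<theta> h by (auto simp: mult_le_cancel_right2)
    obtain y where y: "a < y" "y < a + \<theta> * h" "w (a + \<theta> * h) - w a = (a + \<theta> * h - a) * w1 y"
      using MVT2[of a "a + \<theta> * h" w w1] w(1) th by auto
    obtain z where z: "a < z" "z < a + h" "w (a + h) - w a = (a + h - a) * w1 z"
      using MVT2[of a "a + h" w w1] w(1) h by auto
    have "norm (w1 z - w1 y) \<le> K * norm (z - y)"
      by (rule field_differentiable_bound[of UNIV w1 w2]) (use w(2) K in auto)
    also have "norm (z - y) \<le> h" unfolding real_norm_def using y z th by linarith
    then have "K * norm (z - y) \<le> K * h" using K0 by (rule mult_left_mono)
    finally have "\<bar>w1 z - w1 y\<bar> \<le> K * h" by simp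
    then have "(\<theta> * h) * \<bar>w1 z - w1 y\<bar> \<le> h * (K * h)" using th h by (intro mult_mono) auto
    moreover have "(1 - \<theta>) * w a + \<theta> * w (a + h) - w x = (\<theta> * h) * (w1 z - w1 y)"
    proof -
      have "(1 - \<theta>) * w a + \<theta> * w (a + h) - w x = \<theta> * (w (a + h) - w a) - (w (a + \<theta> * h) - w a)"
        unfolding xa by (simp add: algebra_simps)
      then show ?thesis unfolding y(3) z(3) by (simp add: algebra_simps)
    qed
    ultimately show ?thesis using th \<theta> by (simp add: abs_mult power2_eq_square mult_ac)
  qed
  have "(\<Sum>j\<in>J. w (of_int j * h) / h * hat h (x - of_int j * h)) = (1 - \<theta>) * p + \<theta> * q"
  proof -
    have "x / h - of_int k = \<theta>" by (simp add: \<theta>_def k_def)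
    then show ?thesis
      using hat_sum[OF h J, of "\<lambda>j. w (of_int j * h)" x]
      unfolding k_def[symmetric] a_def[symmetric] ah p_def q_def by simp
  qed
  then have "(\<Sum>j\<in>J. w (of_int j * h) / h * hat h (x - of_int j * h)) - w x
    = ((1 - \<theta>) * w a + \<theta> * w (a + h) - w x) + ((1 - \<theta>) * (p - w a) + \<theta> * (q - w (a + h)))"
    by (simp add: algebra_simps)
  then show ?thesis using 1 2 by linarith
qed

text \<open>An upper bound for the total variation of \<open>\<beta>''\<close>, attained when
  \<open>\<mu>\<close> and \<open>\<nu>\<close> are mutually singular.\<close>

definition total_mass :: "real measure \<Rightarrow> real measure \<Rightarrow> real" where
  "total_mass \<mu> \<nu> = measure \<mu> UNIV + measure \<nu> UNIV"

lemma total_mass_nonneg: "total_mass \<mu> \<nu> \<ge> 0"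
  by (simp add: total_mass_def)

lemma finite_borel_integral_bound:
  fixes g :: "real \<Rightarrow> real"
  assumes M: "finite_borel M" and g: "g \<in> borel_measurable borel" "\<And>x. \<bar>g x\<bar> \<le> B"
  shows "\<bar>LINT x|M. g x\<bar> \<le> measure M UNIV * B"
proof -
  have sp: "space M = UNIV" using M sets_eq_imp_space_eq[of M borel] by (simp add: finite_borel_def)
  have "\<bar>LINT x|M. g x\<bar> \<le> (LINT x|M. \<bar>g x\<bar>)" by (rule integral_abs_bound)
  also have "\<dots> \<le> (LINT x|M. B)"
    using g by (intro integral_mono integrable_abs finite_borel_integrable[OF M, of _ B]
        finite_borel_integrable[OF M, of _ "\<bar>B\<bar>"]) auto
  also have "\<dots> = measure M UNIV * B" by (simp add: sp)
  finally show ?thesis .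
qed

lemma diff_integral_bound:
  assumes "finite_borel \<mu>" "finite_borel \<nu>" "g \<in> borel_measurable borel" "\<And>x. \<bar>g x\<bar> \<le> B"
  shows "\<bar>diff_integral \<mu> \<nu> g\<bar> \<le> total_mass \<mu> \<nu> * B"
  using finite_borel_integral_bound[OF assms(1,3,4)] finite_borel_integral_bound[OF assms(2,3,4)]
  unfolding diff_integral_def total_mass_def by (simp add: distrib_right)

text \<open>The quadrature weight \<open>h\<close> and the \<open>1 / h^2\<close> of the second
  difference leave the factor \<open>1 / h\<close>, precisely the normalisation that turns the hats
  into interpolation functions. The discrete convolution is therefore exact for the
  interpolant.\<close>

lemma discrete_conv_eq:
  assumes \<beta>: "continuous_on UNIV \<beta>" and M: "finite_borel \<mu>" "finite_borel \<nu>"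
    "second_distributional_derivative \<beta> \<mu> \<nu>" and h: "h > 0" and J: "finite J"
  shows "(\<Sum>j\<in>J. h * DpDm h (grid h \<beta>) (i - j) * c j)
    = diff_integral \<mu> \<nu> (\<lambda>z. \<Sum>j\<in>J. c j / h * hat h ((of_int i * h - z) - of_int j * h))"
proof -
  have D: "h * DpDm h (grid h \<beta>) (i - j) * c j
    = c j / h * diff_integral \<mu> \<nu> (\<lambda>z. hat h ((of_int i * h - z) - of_int j * h))" for j
  proof -
    have shift: "of_int (i - j + 1) * h = of_int (i - j) * h + h" "of_int (i - j - 1) * h = of_int (i - j) * h - h"
      by (simp_all add: algebra_simps)
    have arg: "(\<lambda>z. hat h (of_int (i - j) * h - z)) = (\<lambda>z. hat h ((of_int i * h - z) - of_int j * h))"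
      by (simp add: algebra_simps)
    have "DpDm h (grid h \<beta>) (i - j) = diff_integral \<mu> \<nu> (\<lambda>z. hat h ((of_int i * h - z) - of_int j * h)) / h\<^sup>2"
      unfolding DpDm_def grid_def shift second_difference_eq_hat[OF \<beta> M h] arg ..
    then show ?thesis using h by (simp add: power2_eq_square)
  qed
  have int: "integrable M (\<lambda>z. c j / h * hat h ((of_int i * h - z) - of_int j * h))" if "finite_borel M" for M j
    by (intro integrable_mult_right finite_borel_integrable[OF that, of _ h])
      (use h hat_nonneg hat_le in \<open>auto simp: abs_of_nonneg\<close>)
  show ?thesis
    unfolding D diff_integral_def right_diff_distrib sum_subtractf
    using int[OF M(1)] int[OF M(2)] by (simp add: Bochner_Integration.integral_sum)
qed

text \<open>Testing the kernel with its own signs turns the row sum into the integral of an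
  interpolant with values in \<open>[-1, 1]\<close>. The bound depends neither on \<open>h\<close>
  nor on \<open>J\<close>, which is the stability of the scheme.\<close>

lemma discrete_kernel_row_sum:
  assumes \<beta>: "continuous_on UNIV \<beta>" and M: "finite_borel \<mu>" "finite_borel \<nu>"
    "second_distributional_derivative \<beta> \<mu> \<nu>" and h: "h > 0" and J: "finite J"
  shows "(\<Sum>j\<in>J. \<bar>h * DpDm h (grid h \<beta>) (i - j)\<bar>) \<le> total_mass \<mu> \<nu>"
proof -
  define c where "c j = sgn (h * DpDm h (grid h \<beta>) (i - j))" for j
  have "(\<Sum>j\<in>J. \<bar>h * DpDm h (grid h \<beta>) (i - j)\<bar>) = (\<Sum>j\<in>J. h * DpDm h (grid h \<beta>) (i - j) * c j)"
    unfolding c_def by (simp only: abs_sgn)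
  also have "\<dots> = diff_integral \<mu> \<nu> (\<lambda>z. \<Sum>j\<in>J. c j / h * hat h ((of_int i * h - z) - of_int j * h))"
    by (rule discrete_conv_eq[OF assms])
  also have "\<dots> \<le> total_mass \<mu> \<nu> * 1"
  proof (rule order_trans[OF abs_ge_self], rule diff_integral_bound[OF M(1,2)])
    show "\<bar>\<Sum>j\<in>J. c j / h * hat h ((of_int i * h - z) - of_int j * h)\<bar> \<le> 1" for z
      by (rule hat_sum_bound[OF h J]) (auto simp: c_def abs_sgn_eq)
  qed measurable
  finally show ?thesis by simp
qed

text \<open>The discrete and the continuous operator integrate against the same measure, so their
  difference is the integral of the interpolation error of \<open>w\<close>. Its order comes from
  \<open>w\<close> alone, and \<open>\<beta>''\<close> enters only through its mass.\<close>

lemma consistency_error: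
  assumes \<beta>: "continuous_on UNIV \<beta>" and M: "finite_borel \<mu>" "finite_borel \<nu>"
    "second_distributional_derivative \<beta> \<mu> \<nu>" and h: "h > 0" and J: "finite J"
    and \<epsilon>: "\<And>j. j \<notin> J \<Longrightarrow> \<bar>w (of_int j * h)\<bar> \<le> \<epsilon>" "\<epsilon> \<ge> 0"
    and w: "\<And>x. (w has_real_derivative w1 x) (at x)" "\<And>x. (w1 has_real_derivative w2 x) (at x)"
    and K: "\<And>x. \<bar>w2 x\<bar> \<le> K" and B: "\<And>x. \<bar>w x\<bar> \<le> B"
  shows "\<bar>(\<Sum>j\<in>J. h * DpDm h (grid h \<beta>) (i - j) * w (of_int j * h))
    - diff_integral \<mu> \<nu> (\<lambda>z. w (of_int i * h - z))\<bar> \<le> total_mass \<mu> \<nu> * (K * h\<^sup>2 + \<epsilon>)"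
proof -
  define g where "g z = (\<Sum>j\<in>J. w (of_int j * h) / h * hat h ((of_int i * h - z) - of_int j * h))" for z
  have B0: "B \<ge> 0" using B[of 0] by linarith
  have [measurable]: "w \<in> borel_measurable borel"
    using w(1) by (intro borel_measurable_continuous_onI DERIV_imp_continuous_on)
  have [measurable]: "g \<in> borel_measurable borel" unfolding g_def by measurable
  have gB: "\<bar>g z\<bar> \<le> B" for z unfolding g_def by (rule hat_sum_bound[OF h J B B0])
  have "(\<Sum>j\<in>J. h * DpDm h (grid h \<beta>) (i - j) * w (of_int j * h)) - diff_integral \<mu> \<nu> (\<lambda>z. w (of_int i * h - z))
    = diff_integral \<mu> \<nu> g - diff_integral \<mu> \<nu> (\<lambda>z. w (of_int i * h - z))"
    unfolding discrete_conv_eq[OF \<beta> M h J] g_def[abs_def] ..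
  also have "\<dots> = diff_integral \<mu> \<nu> (\<lambda>z. g z - w (of_int i * h - z))"
  proof -
    have "integrable M g" "integrable M (\<lambda>z. w (of_int i * h - z))" if "finite_borel M" for M
      by (rule finite_borel_integrable[OF that _ gB], measurable)
        (rule finite_borel_integrable[OF that _ B], measurable)
    then show ?thesis using M(1,2) unfolding diff_integral_def by simp
  qed
  finally have eq: "(\<Sum>j\<in>J. h * DpDm h (grid h \<beta>) (i - j) * w (of_int j * h))
    - diff_integral \<mu> \<nu> (\<lambda>z. w (of_int i * h - z)) = diff_integral \<mu> \<nu> (\<lambda>z. g z - w (of_int i * h - z))" .
  show ?thesis unfolding eq
  proof (rule diff_integral_bound[OF M(1,2)])
    show "\<bar>g z - w (of_int i * h - z)\<bar> \<le> K * h\<^sup>2 + \<epsilon>" for z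
      unfolding g_def by (rule interpolation_error[OF h J \<epsilon> w K])
  qed measurable
qed

section \<open>Second-order systems\<close>

lemma mean_value_within:
  fixes g :: "real \<Rightarrow> real"
  assumes "a < b" "\<And>x. x \<in> {a..b} \<Longrightarrow> (g has_real_derivative g' x) (at x within S)" "{a..b} \<subseteq> S"
  obtains z where "a < z" "z < b" "g b - g a = (b - a) * g' z"
proof -
  have "\<exists>z\<in>{a<..<b}. g b - g a = (*) (g' z) (b - a)"
  proof (rule mvt_simple[OF assms(1)])
    fix x assume "a \<le> x" "x \<le> b"
    then have "(g has_real_derivative g' x) (at x within {a..b})"
      using assms(2)[of x] assms(3) has_field_derivative_subset by auto
    then show "(g has_derivative (*) (g' x)) (at x within {a..b})"
      by (rule has_field_derivative_imp_has_derivative)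
  qed
  then show ?thesis using that by (auto simp: mult.commute)
qed

text \<open>The barrier \<open>\<eta> * exp (l * t)\<close> has second derivative \<open>l^2\<close>
  times itself. Its gap \<open>p\<close> to \<open>e\<close> starts with positive value and positive
  slope, the slope cannot decrease, and so both stay positive. The hypothesis concerns only times
  strictly between 0 and \<open>t\<close>, which makes the first-contact argument possible.\<close>

lemma second_order_one_sided:
  fixes e e' e'' :: "real \<Rightarrow> real"
  assumes e: "\<And>t. t \<in> {0..T} \<Longrightarrow> (e has_real_derivative e' t) (at t within {0..T})"
    and e': "\<And>t. t \<in> {0..T} \<Longrightarrow> (e' has_real_derivative e'' t) (at t within {0..T})"
    and init: "e 0 = 0" "e' 0 = 0"
    and \<eta>: "\<eta> > 0" and l: "l > 0" and t: "t \<in> {0..T}"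
    and bound: "\<And>r. 0 < r \<Longrightarrow> r < t \<Longrightarrow> e'' r \<le> l\<^sup>2 * \<eta> * exp (l * r)"
  shows "e t < \<eta> * exp (l * t)" "e' t < \<eta> * l * exp (l * t)"
proof -
  define p where "p r = \<eta> * exp (l * r) - e r" for r
  define p' where "p' r = \<eta> * l * exp (l * r) - e' r" for r
  define p'' where "p'' r = l\<^sup>2 * \<eta> * exp (l * r) - e'' r" for r
  have sub: "{0..r} \<subseteq> {0..T}" if "r \<le> t" for r using that t by auto
  have dp: "(p has_real_derivative p' r) (at r within {0..T})" if "r \<in> {0..T}" for r
    unfolding p_def p'_def by (auto intro!: derivative_eq_intros e that)
  have dp': "(p' has_real_derivative p'' r) (at r within {0..T})" if "r \<in> {0..T}" for r
    unfolding p'_def p''_def by (auto intro!: derivative_eq_intros e' that simp: power2_eq_square)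
  have p'_pos: "p' r > 0" if r: "0 \<le> r" "r \<le> t" for r
  proof (cases "r = 0")
    case True
    then show ?thesis using init \<eta> l by (simp add: p'_def)
  next
    case False
    then obtain z where z: "0 < z" "z < r" "p' r - p' 0 = (r - 0) * p'' z"
      using mean_value_within[of 0 r p' p'' "{0..T}"] dp' sub[OF r(2)] r by (metis less_eq_real_def subsetD)
    have "p'' z \<ge> 0" using bound[of z] z r unfolding p''_def by auto
    then have "p' r \<ge> p' 0" using z r by (metis diff_ge_0_iff_ge diff_zero mult_nonneg_nonneg)
    moreover have "p' 0 > 0" using init \<eta> l by (simp add: p'_def)
    ultimately show ?thesis by simp
  qed
  show "e' t < \<eta> * l * exp (l * t)" using p'_pos[of t] t by (simp add: p'_def)
  have "p t > 0"
  proof (cases "t = 0")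
    case True
    then show ?thesis using init \<eta> by (simp add: p_def)
  next
    case False
    then have "0 < t" using t by simp
    then obtain z where z: "0 < z" "z < t" "p t - p 0 = (t - 0) * p' z"
      using mean_value_within[of 0 t p p' "{0..T}"] dp sub[of t] by (metis order_refl subsetD)
    have "(t - 0) * p' z > 0" using p'_pos[of z] z by simp
    moreover have "p 0 > 0" using init \<eta> by (simp add: p_def)
    ultimately show ?thesis using z by linarith
  qed
  then show "e t < \<eta> * exp (l * t)" by (simp add: p_def)
qed

lemma second_order_bound:
  fixes e e' e'' :: "real \<Rightarrow> real"
  assumes e: "\<And>t. t \<in> {0..T} \<Longrightarrow> (e has_real_derivative e' t) (at t within {0..T})"
    and e': "\<And>t. t \<in> {0..T} \<Longrightarrow> (e' has_real_derivative e'' t) (at t within {0..T})"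
    and init: "e 0 = 0" "e' 0 = 0"
    and \<eta>: "\<eta> > 0" and l: "l > 0" and t: "t \<in> {0..T}"
    and bound: "\<And>r. 0 < r \<Longrightarrow> r < t \<Longrightarrow> \<bar>e'' r\<bar> \<le> l\<^sup>2 * \<eta> * exp (l * r)"
  shows "\<bar>e t\<bar> < \<eta> * exp (l * t)" "\<bar>e' t\<bar> < \<eta> * l * exp (l * t)"
proof -
  have 1: "e t < \<eta> * exp (l * t)" "e' t < \<eta> * l * exp (l * t)"
    using second_order_one_sided[OF e e' init \<eta> l t] bound by (meson abs_le_D1)+
  have "(- e t) < \<eta> * exp (l * t)" "(- e' t) < \<eta> * l * exp (l * t)"
    using second_order_one_sided[of T "\<lambda>t. - e t" "\<lambda>t. - e' t" "\<lambda>t. - e'' t" \<eta> l t] DERIV_minus[OF e] DERIV_minus[OF e'] init \<eta> l t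
      bound[THEN abs_le_D2] by simp_all
  with 1 show "\<bar>e t\<bar> < \<eta> * exp (l * t)" "\<bar>e' t\<bar> < \<eta> * l * exp (l * t)" by (simp_all add: abs_less_iff)
qed

text \<open>A first-contact argument: the bound on \<open>e''\<close> may use that all components still lie below
  \<open>\<eta> exp (l t)\<close>, so it closes even for a merely locally Lipschitz nonlinearity.\<close>

lemma second_order_system_comparison:
  fixes e e' e'' :: "real \<Rightarrow> 'i \<Rightarrow> real"
  assumes J: "finite J"
    and e: "\<And>t i. i \<in> J \<Longrightarrow> t \<in> {0..T} \<Longrightarrow> ((\<lambda>r. e r i) has_real_derivative e' t i) (at t within {0..T})"
    and e': "\<And>t i. i \<in> J \<Longrightarrow> t \<in> {0..T} \<Longrightarrow> ((\<lambda>r. e' r i) has_real_derivative e'' t i) (at t within {0..T})"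
    and init: "\<And>i. i \<in> J \<Longrightarrow> e 0 i = 0" "\<And>i. i \<in> J \<Longrightarrow> e' 0 i = 0"
    and \<eta>: "\<eta> > 0" and l: "l > 0"
    and bound: "\<And>t i. 0 < t \<Longrightarrow> t \<le> T \<Longrightarrow> i \<in> J \<Longrightarrow> (\<And>j. j \<in> J \<Longrightarrow> \<bar>e t j\<bar> \<le> \<eta> * exp (l * t))
      \<Longrightarrow> \<bar>e'' t i\<bar> \<le> l\<^sup>2 * \<eta> * exp (l * t)"
    and t: "t \<in> {0..T}" and i: "i \<in> J"
  shows "\<bar>e t i\<bar> < \<eta> * exp (l * t)" "\<bar>e' t i\<bar> < \<eta> * l * exp (l * t)"
proof -
  define S where "S = (\<Union>j\<in>J. {0..T} \<inter> (\<lambda>t. \<bar>e t j\<bar> - \<eta> * exp (l * t)) -` {0..})"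
  have "closed S" unfolding S_def
  proof (intro closed_UN J ballI continuous_closed_preimage closed_atLeastAtMost closed_atLeast)
    fix j assume "j \<in> J"
    then have "continuous_on {0..T} (\<lambda>r. e r j)"
      using DERIV_continuous_on[of "{0..T}" "\<lambda>r. e r j" "\<lambda>r. e' r j"] e by blast
    then show "continuous_on {0..T} (\<lambda>t. \<bar>e t j\<bar> - \<eta> * exp (l * t))" by (intro continuous_intros)
  qed
  \<comment> \<open>Up to a time with no earlier contact the barrier holds, so \<open>bound\<close>
    applies before \<open>r\<close>; the strict inequality is then gained at \<open>r\<close>
    itself.\<close>
  have below: "\<bar>e r j\<bar> < \<eta> * exp (l * r) \<and> \<bar>e' r j\<bar> < \<eta> * l * exp (l * r)"
    if r: "r \<in> {0..T}" and j: "j \<in> J" and no: "\<And>q. q < r \<Longrightarrow> q \<notin> S" for r j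
  proof -
    have "\<bar>e'' q j\<bar> \<le> l\<^sup>2 * \<eta> * exp (l * q)" if q: "0 < q" "q < r" for q
    proof (rule bound)
      show "\<bar>e q k\<bar> \<le> \<eta> * exp (l * q)" if "k \<in> J" for k
        using no[OF q(2)] that q r by (auto simp: S_def not_le intro: less_imp_le)
    qed (use q r j in auto)
    then show ?thesis
      using second_order_bound[of T "\<lambda>r. e r j" "\<lambda>r. e' r j" "\<lambda>r. e'' r j" \<eta> l r] e e' j init \<eta> l r by blast
  qed
  have "S = {}"
  proof (rule ccontr)
    assume ne: "S \<noteq> {}"
    have bb: "bdd_below S" by (rule bdd_belowI[of _ 0]) (auto simp: S_def)
    \<comment> \<open>Closedness makes the infimum an actual first contact time, at which
      \<open>below\<close> contradicts contact.\<close>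
    have m: "Inf S \<in> S" by (rule closed_contains_Inf[OF ne bb \<open>closed S\<close>])
    then obtain j where j: "j \<in> J" "Inf S \<in> {0..T}" "\<bar>e (Inf S) j\<bar> \<ge> \<eta> * exp (l * Inf S)"
      by (auto simp: S_def)
    have "q \<notin> S" if "q < Inf S" for q using cInf_lower[OF _ bb, of q] that by auto
    then show False using below[OF j(2) j(1)] j(3) by auto
  qed
  then show "\<bar>e t i\<bar> < \<eta> * exp (l * t)" "\<bar>e' t i\<bar> < \<eta> * l * exp (l * t)"
    using below[OF t i] by auto
qed

section \<open>Picard iteration for globally Lipschitz systems\<close>

lemma geometric_Cauchy_limit:
  fixes x :: "nat \<Rightarrow> real"
  assumes "\<And>n. \<bar>x (Suc n) - x n\<bar> \<le> E * (1 / 2) ^ n"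
  obtains y where "\<And>n. \<bar>x n - y\<bar> \<le> 2 * E * (1 / 2) ^ n"
proof -
  have E: "E \<ge> 0" using assms[of 0] by (simp add: order_trans[OF abs_ge_zero])
  have step: "\<bar>x (n + k) - x n\<bar> \<le> 2 * E * (1 / 2) ^ n * (1 - (1 / 2) ^ k)" for n k
  proof (induction k)
    case (Suc k)
    have "\<bar>x (n + Suc k) - x n\<bar> \<le> \<bar>x (Suc (n + k)) - x (n + k)\<bar> + \<bar>x (n + k) - x n\<bar>" by simp
    also have "\<dots> \<le> E * (1 / 2) ^ (n + k) + 2 * E * (1 / 2) ^ n * (1 - (1 / 2) ^ k)"
      using assms[of "n + k"] Suc by (rule add_mono)
    also have "\<dots> = 2 * E * (1 / 2) ^ n * (1 - (1 / 2) ^ Suc k)" by (simp add: power_add algebra_simps)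
    finally show ?case .
  qed simp
  have tail: "\<bar>x m - x n\<bar> \<le> 2 * E * (1 / 2) ^ n" if "n \<le> m" for m n
  proof -
    have "2 * E * (1 / 2) ^ n * (1 - (1 / 2) ^ (m - n)) \<le> 2 * E * (1 / 2) ^ n"
      using E by (intro mult_left_le) auto
    then show ?thesis using step[of n "m - n"] that by simp
  qed
  have lim0: "(\<lambda>n. 2 * E * (1 / 2) ^ n) \<longlonglongrightarrow> 0"
    using tendsto_mult_right_zero[OF LIMSEQ_realpow_zero[of "1 / 2"], of "2 * E"] by simp
  have "Cauchy x"
  proof (rule metric_CauchyI)
    fix e :: real assume "e > 0"
    then have "\<forall>\<^sub>F n in sequentially. 2 * E * (1 / 2) ^ n < e / 2" using lim0 by (intro order_tendstoD(2)) auto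
    then obtain n where n: "2 * E * (1 / 2) ^ n < e / 2" by (auto simp: eventually_sequentially)
    have "dist (x p) (x q) < e" if "n \<le> p" "n \<le> q" for p q
      using tail[OF that(1)] tail[OF that(2)] n unfolding dist_real_def by linarith
    then show "\<exists>M. \<forall>m\<ge>M. \<forall>n\<ge>M. dist (x m) (x n) < e" by blast
  qed
  then obtain y where y: "x \<longlonglongrightarrow> y" using Cauchy_convergent_iff convergent_def by blast
  have "\<bar>x n - y\<bar> \<le> 2 * E * (1 / 2) ^ n" for n
  proof (rule tendsto_upperbound)
    show "(\<lambda>m. \<bar>x n - x m\<bar>) \<longlonglongrightarrow> \<bar>x n - y\<bar>" by (intro tendsto_intros y)
    show "\<forall>\<^sub>F m in sequentially. \<bar>x n - x m\<bar> \<le> 2 * E * (1 / 2) ^ n"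
      using eventually_ge_at_top[of n] by eventually_elim (subst abs_minus_commute, rule tail)
  qed simp
  then show ?thesis by (rule that)
qed

text \<open>Picard iteration measured in the sup norm with weight \<open>exp (- l * t)\<close>. For
  \<open>l\<close> large enough the integral operator halves distances on all of
  \<open>[0, T]\<close> at once, so no subdivision of the time interval is required.\<close>

lemma Lipschitz_second_order_system_solution:
  fixes A :: "'i \<Rightarrow> 'i \<Rightarrow> real" and F :: "real \<Rightarrow> real" and p q :: "'i \<Rightarrow> real"
  assumes J: "finite J" and T: "T \<ge> 0"
    and row: "\<And>i. i \<in> J \<Longrightarrow> (\<Sum>j\<in>J. \<bar>A i j\<bar>) \<le> a"
    and lip: "\<And>x y. \<bar>F x - F y\<bar> \<le> L * \<bar>x - y\<bar>"
  obtains v v' :: "real \<Rightarrow> 'i \<Rightarrow> real" where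
    "\<And>i. v 0 i = p i" "\<And>i. v' 0 i = q i"
    "\<And>t i. i \<in> J \<Longrightarrow> t \<in> {0..T} \<Longrightarrow> ((\<lambda>r. v r i) has_real_derivative v' t i) (at t within {0..T})"
    "\<And>t i. i \<in> J \<Longrightarrow> t \<in> {0..T} \<Longrightarrow> ((\<lambda>r. v' r i) has_real_derivative (\<Sum>j\<in>J. A i j * F (v t j))) (at t within {0..T})"
proof -
  define G where "G w t i = (\<Sum>j\<in>J. A i j * F (w t j))" for w :: "real \<Rightarrow> 'i \<Rightarrow> real" and t i
  define \<Phi>' where "\<Phi>' w t i = q i + integral {0..t} (\<lambda>r. G w r i)" for w t i
  define \<Phi> where "\<Phi> w t i = p i + integral {0..t} (\<lambda>s. \<Phi>' w s i)" for w t i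
  define adm where "adm w \<longleftrightarrow> (\<forall>i\<in>J. continuous_on {0..T} (\<lambda>t. w t i))" for w :: "real \<Rightarrow> 'i \<Rightarrow> real"
  have init: "\<Phi> w 0 i = p i" "\<Phi>' w 0 i = q i" for w i by (simp_all add: \<Phi>_def \<Phi>'_def)
  have L0: "L \<ge> 0" using lip[of 0 1] by (simp add: order_trans[OF abs_ge_zero])
  have contF: "continuous_on UNIV F"
  proof (rule continuous_on_subset[OF lipschitz_on_continuous_on[of L UNIV F]])
    show "L-lipschitz_on UNIV F" using lip L0 by (intro lipschitz_onI) (auto simp: dist_real_def)
  qed simp
  have contG: "continuous_on {0..T} (\<lambda>t. G w t i)" if "adm w" for w i
    unfolding G_def using that
    by (auto simp: adm_def intro!: continuous_intros continuous_on_compose2[OF contF])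
  have d2: "((\<lambda>r. \<Phi>' w r i) has_real_derivative G w t i) (at t within {0..T})" if "adm w" "t \<in> {0..T}" for w t i
  proof -
    have "((\<lambda>t. integral {0..t} (\<lambda>r. G w r i)) has_real_derivative G w t i) (at t within {0..T})"
      by (rule integral_has_real_derivative[OF contG[OF that(1)] that(2)])
    then show ?thesis unfolding \<Phi>'_def by (auto intro!: derivative_eq_intros)
  qed
  have d1: "((\<lambda>r. \<Phi> w r i) has_real_derivative \<Phi>' w t i) (at t within {0..T})" if "adm w" "t \<in> {0..T}" for w t i
  proof -
    have "continuous_on {0..T} (\<lambda>t. \<Phi>' w t i)"
      by (rule DERIV_continuous_on[where D = "\<lambda>t. G w t i"], rule d2[OF that(1)])
    from integral_has_real_derivative[OF this that(2)] show ?thesis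
      unfolding \<Phi>_def by (auto intro!: derivative_eq_intros)
  qed
  have adm\<Phi>: "adm (\<Phi> w)" if "adm w" for w
    unfolding adm_def
  proof
    fix i
    show "continuous_on {0..T} (\<lambda>t. \<Phi> w t i)"
      by (rule DERIV_continuous_on[where D = "\<lambda>t. \<Phi>' w t i"], rule d1[OF that])
  qed
  \<comment> \<open>The factor 2 yields contraction by one half: the bound
    \<open>(|a| * L + 1) * D\<close> on the second derivative of the difference is exactly
    \<open>l^2 * (D / 2)\<close>, so the comparison lemma applies with \<open>D / 2\<close>.\<close>
  define l where "l = sqrt (2 * (\<bar>a\<bar> * L + 1))"
  have l2: "l\<^sup>2 = 2 * (\<bar>a\<bar> * L + 1)" using L0 by (simp add: l_def)
  have l: "l > 0" using L0 by (simp add: l_def add_nonneg_pos)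
  have contract: "\<bar>\<Phi> w t i - \<Phi> z t i\<bar> \<le> D / 2 * exp (l * t)"
    if w: "adm w" "adm z" and D: "D > 0" "\<And>r j. r \<in> {0..T} \<Longrightarrow> j \<in> J \<Longrightarrow> \<bar>w r j - z r j\<bar> \<le> D * exp (l * r)"
      and t: "t \<in> {0..T}" and i: "i \<in> J" for w z D t i
  proof -
    have "\<bar>\<Phi> w t i - \<Phi> z t i\<bar> < D / 2 * exp (l * t)"
    proof (rule second_order_bound(1)[where e' = "\<lambda>t. \<Phi>' w t i - \<Phi>' z t i" and e'' = "\<lambda>t. G w t i - G z t i" and T = T])
      fix r assume r: "0 < r" "r < t"
      have "\<bar>G w r i - G z r i\<bar> = \<bar>\<Sum>j\<in>J. A i j * (F (w r j) - F (z r j))\<bar>"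
        by (simp add: G_def sum_subtractf right_diff_distrib)
      also have "\<dots> \<le> (\<Sum>j\<in>J. \<bar>A i j\<bar> * (L * (D * exp (l * r))))"
      proof (rule order_trans[OF sum_abs], rule sum_mono)
        fix j assume j: "j \<in> J"
        have "\<bar>F (w r j) - F (z r j)\<bar> \<le> L * (D * exp (l * r))"
          by (rule order_trans[OF lip mult_left_mono[OF D(2) L0]]) (use r t j in auto)
        then show "\<bar>A i j * (F (w r j) - F (z r j))\<bar> \<le> \<bar>A i j\<bar> * (L * (D * exp (l * r)))"
          by (simp add: abs_mult mult_left_mono)
      qed
      also have "\<dots> = (\<Sum>j\<in>J. \<bar>A i j\<bar>) * (L * (D * exp (l * r)))" by (simp add: sum_distrib_right)
      also have "\<dots> \<le> \<bar>a\<bar> * (L * (D * exp (l * r)))"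
        using row[OF i] L0 D(1) by (intro mult_right_mono) auto
      also have "\<dots> \<le> (\<bar>a\<bar> * L + 1) * (D * exp (l * r))"
        using D(1) by (simp add: algebra_simps)
      also have "\<dots> = l\<^sup>2 * (D / 2) * exp (l * r)" unfolding l2 by simp
      finally show "\<bar>G w r i - G z r i\<bar> \<le> l\<^sup>2 * (D / 2) * exp (l * r)" .
    qed (use init D l t w in \<open>auto intro!: DERIV_diff d1 d2\<close>)
    then show ?thesis by simp
  qed
  define z where "z n = (\<Phi> ^^ n) (\<lambda>_ _. 0)" for n
  have zS: "z (Suc n) = \<Phi> (z n)" for n by (simp add: z_def)
  have admz: "adm (z n)" for n
  proof (induction n)
    case 0
    then show ?case by (simp add: z_def adm_def)
  qed (simp add: zS adm\<Phi>)
  obtain D where D: "D > 0" "\<And>t i. t \<in> {0..T} \<Longrightarrow> i \<in> J \<Longrightarrow> \<bar>z 1 t i\<bar> \<le> D"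
  proof -
    have "\<exists>B. \<forall>t\<in>{0..T}. \<bar>z 1 t i\<bar> \<le> B" if "i \<in> J" for i
    proof -
      have "compact ((\<lambda>t. z 1 t i) ` {0..T})"
        using admz[of 1] that by (intro compact_continuous_image) (auto simp: adm_def)
      then show ?thesis by (auto dest!: compact_imp_bounded simp: bounded_iff)
    qed
    then obtain B where B: "\<And>i t. i \<in> J \<Longrightarrow> t \<in> {0..T} \<Longrightarrow> \<bar>z 1 t i\<bar> \<le> B i" by metis
    have "\<bar>z 1 t i\<bar> \<le> 1 + (\<Sum>j\<in>J. \<bar>B j\<bar>)" if "t \<in> {0..T}" "i \<in> J" for t i
      using B[OF that(2,1)] member_le_sum[of i J "\<lambda>j. \<bar>B j\<bar>"] that J by force
    moreover have "1 + (\<Sum>j\<in>J. \<bar>B j\<bar>) > 0" by (intro add_pos_nonneg sum_nonneg) auto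
    ultimately show ?thesis by (rule that[rotated])
  qed
  have diff: "\<bar>z (Suc n) t i - z n t i\<bar> \<le> D * (1 / 2) ^ n * exp (l * t)" if "t \<in> {0..T}" "i \<in> J" for n t i
    using that
  proof (induction n arbitrary: t i)
    case 0
    have "D * 1 \<le> D * exp (l * t)" using D l 0 by (intro mult_left_mono) auto
    then show ?case using D(2)[OF 0] by (simp add: z_def)
  next
    case (Suc n)
    have "\<bar>\<Phi> (z (Suc n)) t i - \<Phi> (z n) t i\<bar> \<le> D * (1 / 2) ^ n / 2 * exp (l * t)"
      by (rule contract[OF admz admz _ Suc.IH Suc.prems]) (use D in auto)
    then show ?case by (simp add: zS)
  qed
  have exl: "\<exists>y. \<forall>n. \<bar>z n t i - y\<bar> \<le> 2 * (D * exp (l * t)) * (1 / 2) ^ n" if "t \<in> {0..T}" "i \<in> J" for t i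
    using geometric_Cauchy_limit[of "\<lambda>n. z n t i" "D * exp (l * t)"] diff[OF that] by (metis mult.assoc mult.commute)
  \<comment> \<open>The limit is chosen pointwise, but the error estimate contains an explicit rate
    that is uniform on \<open>[0, T]\<close>, and this gives continuity of \<open>v\<close>.\<close>
  define v where "v t i = (SOME y. \<forall>n. \<bar>z n t i - y\<bar> \<le> 2 * (D * exp (l * t)) * (1 / 2) ^ n)" for t i
  have v: "\<bar>z n t i - v t i\<bar> \<le> 2 * D * (1 / 2) ^ n * exp (l * t)" if "t \<in> {0..T}" "i \<in> J" for n t i
    using someI_ex[OF exl[OF that]] unfolding v_def[symmetric] by (simp add: mult_ac)
  have lim0: "(\<lambda>n. c * (1 / 2) ^ n) \<longlonglongrightarrow> 0" for c :: real
    using tendsto_mult_right_zero[OF LIMSEQ_realpow_zero[of "1 / 2"], of c] by simp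
  have admv: "adm v" unfolding adm_def
  proof
    fix i assume i: "i \<in> J"
    show "continuous_on {0..T} (\<lambda>t. v t i)"
    proof (rule uniform_limit_theorem[where F = sequentially])
      show "\<forall>\<^sub>F n in sequentially. continuous_on {0..T} (\<lambda>t. z n t i)"
        using admz i by (simp add: adm_def)
      show "uniform_limit {0..T} (\<lambda>n t. z n t i) (\<lambda>t. v t i) sequentially"
      proof (rule uniform_limitI)
        fix e :: real assume e: "e > 0"
        have "\<forall>\<^sub>F n in sequentially. (2 * D * exp (l * T)) * (1 / 2) ^ n < e"
          using lim0 e by (rule order_tendstoD(2))
        then show "\<forall>\<^sub>F n in sequentially. \<forall>t\<in>{0..T}. dist (z n t i) (v t i) < e"
        proof eventually_elim
          case (elim n)
          show ?case
          proof
            fix t assume t: "t \<in> {0..T}"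
            have "2 * D * (1 / 2) ^ n * exp (l * t) \<le> 2 * D * (1 / 2) ^ n * exp (l * T)"
              using t l D by (intro mult_left_mono) auto
            then show "dist (z n t i) (v t i) < e"
              using v[OF t i, of n] elim by (simp add: dist_real_def mult_ac)
          qed
        qed
      qed
    qed simp
  qed
  have fixpoint: "v t i = \<Phi> v t i" if t: "t \<in> {0..T}" and i: "i \<in> J" for t i
  proof -
    have "\<bar>v t i - \<Phi> v t i\<bar> \<le> (2 * D * exp (l * t)) * (1 / 2) ^ n" for n
    proof -
      have "\<bar>\<Phi> (z n) t i - \<Phi> v t i\<bar> \<le> 2 * D * (1 / 2) ^ n / 2 * exp (l * t)"
        by (rule contract[OF admz admv _ v t i]) (use D in auto)
      moreover have "\<bar>z (Suc n) t i - v t i\<bar> \<le> 2 * D * (1 / 2) ^ Suc n * exp (l * t)" by (rule v[OF t i])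
      ultimately show ?thesis unfolding zS by (simp add: mult_ac)
    qed
    then have "\<bar>v t i - \<Phi> v t i\<bar> \<le> 0"
      by (intro tendsto_lowerbound[OF lim0]) (auto intro!: always_eventually)
    then show ?thesis by simp
  qed
  have Gv: "G (\<Phi> v) t i = G v t i" if "t \<in> {0..T}" for t i
    unfolding G_def using fixpoint[OF that] by simp
  show ?thesis
  \<comment> \<open>\<open>\<Phi> v\<close> has the right initial values and derivatives by
    construction. It coincides with \<open>v\<close> on \<open>[0, T]\<close> for indices in
    \<open>J\<close>, which are the only values entering the right-hand side.\<close>
  proof (rule that[of "\<Phi> v" "\<Phi>' v"])
    show "((\<lambda>r. \<Phi>' v r i) has_real_derivative (\<Sum>j\<in>J. A i j * F (\<Phi> v t j))) (at t within {0..T})"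
      if "i \<in> J" "t \<in> {0..T}" for t i
      using d2[OF admv that(2), of i] Gv[OF that(2), of i] by (simp add: G_def)
  qed (use init d1[OF admv] in auto)
qed

section \<open>Convergence of the truncated scheme\<close>

text \<open>\<open>f\<close> acts on the exact values and \<open>F\<close> on the discrete ones, so
  the estimate covers the original and the clamped system alike. In \<open>l^2 = a * L + 1\<close>
  the term \<open>a * L\<close> pays for the coupling and 1 for the residual. Smallness of
  \<open>\<eta> * exp (l * T)\<close> keeps the discrete values within distance one of the exact
  ones, where the Lipschitz comparison is available.\<close>

lemma semidiscrete_error:
  fixes x x' x'' v v' :: "real \<Rightarrow> 'i \<Rightarrow> real" and A :: "'i \<Rightarrow> 'i \<Rightarrow> real"
  assumes J: "finite J"
    and x: "\<And>t i. i \<in> J \<Longrightarrow> t \<in> {0..T} \<Longrightarrow> ((\<lambda>r. x r i) has_real_derivative x' t i) (at t within {0..T})"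
      "\<And>t i. i \<in> J \<Longrightarrow> t \<in> {0..T} \<Longrightarrow> ((\<lambda>r. x' r i) has_real_derivative x'' t i) (at t within {0..T})"
    and v: "\<And>t i. i \<in> J \<Longrightarrow> t \<in> {0..T} \<Longrightarrow> ((\<lambda>r. v r i) has_real_derivative v' t i) (at t within {0..T})"
      "\<And>t i. i \<in> J \<Longrightarrow> t \<in> {0..T} \<Longrightarrow>
        ((\<lambda>r. v' r i) has_real_derivative (\<Sum>j\<in>J. A i j * F (v t j))) (at t within {0..T})"
    and init: "\<And>i. i \<in> J \<Longrightarrow> v 0 i = x 0 i" "\<And>i. i \<in> J \<Longrightarrow> v' 0 i = x' 0 i"
    and residual: "\<And>t i. 0 < t \<Longrightarrow> t \<le> T \<Longrightarrow> i \<in> J \<Longrightarrow> \<bar>x'' t i - (\<Sum>j\<in>J. A i j * f (x t j))\<bar> \<le> \<eta>"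
    and row: "\<And>i. i \<in> J \<Longrightarrow> (\<Sum>j\<in>J. \<bar>A i j\<bar>) \<le> a"
    and M: "\<And>t i. t \<in> {0..T} \<Longrightarrow> i \<in> J \<Longrightarrow> \<bar>x t i\<bar> \<le> M"
    and lip: "\<And>p q. \<bar>p\<bar> \<le> M \<Longrightarrow> \<bar>p - q\<bar> \<le> 1 \<Longrightarrow> \<bar>f p - F q\<bar> \<le> L * \<bar>p - q\<bar>"
    and l: "l\<^sup>2 = a * L + 1" "l > 0" and a: "a \<ge> 0" and L: "L \<ge> 0"
    and \<eta>: "\<eta> > 0" "\<eta> * exp (l * T) \<le> 1"
    and t: "t \<in> {0..T}" and i: "i \<in> J"
  shows "\<bar>x t i - v t i\<bar> < \<eta> * exp (l * t)" "\<bar>x' t i - v' t i\<bar> < \<eta> * l * exp (l * t)"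
proof -
  define e'' where "e'' t i = x'' t i - (\<Sum>j\<in>J. A i j * F (v t j))" for t i
  have key: "\<bar>e'' t i\<bar> \<le> l\<^sup>2 * \<eta> * exp (l * t)"
    if t: "0 < t" "t \<le> T" and i: "i \<in> J" and e: "\<And>j. j \<in> J \<Longrightarrow> \<bar>x t j - v t j\<bar> \<le> \<eta> * exp (l * t)" for t i
  proof -
    \<comment> \<open>The current height of the barrier. It dominates \<open>\<eta>\<close>, so the
      residual can be charged to it, and it is at most 1, so \<open>lip\<close> applies.\<close>
    define m where "m = \<eta> * exp (l * t)"
    have m: "\<eta> \<le> m" "0 < m" "m \<le> 1"
    proof -
      show "\<eta> \<le> m" "0 < m" using \<eta> l t by (simp_all add: m_def)
      have "m \<le> \<eta> * exp (l * T)" using \<eta> l t by (simp add: m_def)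
      then show "m \<le> 1" using \<eta> by simp
    qed
    have "\<bar>\<Sum>j\<in>J. A i j * (f (x t j) - F (v t j))\<bar> \<le> (\<Sum>j\<in>J. \<bar>A i j\<bar> * (L * m))"
    proof (rule order_trans[OF sum_abs], rule sum_mono)
      fix j assume j: "j \<in> J"
      have ej: "\<bar>x t j - v t j\<bar> \<le> m" using e[OF j] by (simp add: m_def)
      have "\<bar>f (x t j) - F (v t j)\<bar> \<le> L * \<bar>x t j - v t j\<bar>"
        by (rule lip) (use M[of t j] t j ej m in auto)
      also have "\<dots> \<le> L * m" using ej L by (rule mult_left_mono)
      finally show "\<bar>A i j * (f (x t j) - F (v t j))\<bar> \<le> \<bar>A i j\<bar> * (L * m)"
        by (simp add: abs_mult mult_left_mono)
    qed
    also have "\<dots> = (\<Sum>j\<in>J. \<bar>A i j\<bar>) * (L * m)" by (simp add: sum_distrib_right)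
    also have "\<dots> \<le> a * (L * m)" using row[OF i] L m by (intro mult_right_mono) auto
    finally have 1: "\<bar>\<Sum>j\<in>J. A i j * (f (x t j) - F (v t j))\<bar> \<le> a * (L * m)" .
    have "e'' t i = (x'' t i - (\<Sum>j\<in>J. A i j * f (x t j))) + (\<Sum>j\<in>J. A i j * (f (x t j) - F (v t j)))"
      by (simp add: e''_def right_diff_distrib sum_subtractf)
    then have "\<bar>e'' t i\<bar> \<le> m + a * (L * m)"
      using residual[OF t i] 1 m by linarith
    also have "\<dots> = l\<^sup>2 * \<eta> * exp (l * t)" unfolding l m_def by (simp add: algebra_simps)
    finally show ?thesis .
  qed
  show "\<bar>x t i - v t i\<bar> < \<eta> * exp (l * t)"
    by (rule second_order_system_comparison(1)[where e = "\<lambda>t i. x t i - v t i" and e' = "\<lambda>t i. x' t i - v' t i"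
          and e'' = e'' and J = J and T = T])
      (use J init \<eta> l key t i in \<open>auto intro!: DERIV_diff x v simp: e''_def[symmetric]\<close>, auto simp: e''_def intro!: DERIV_diff x v)
  show "\<bar>x' t i - v' t i\<bar> < \<eta> * l * exp (l * t)"
    by (rule second_order_system_comparison(2)[where e = "\<lambda>t i. x t i - v t i" and e' = "\<lambda>t i. x' t i - v' t i"
          and e'' = e'' and J = J and T = T])
      (use J init \<eta> l key t i in \<open>auto intro!: DERIV_diff x v simp: e''_def[symmetric]\<close>, auto simp: e''_def intro!: DERIV_diff x v)
qed

text \<open>The chain rule bounds the composition and its two derivatives by \<open>B\<close>,
  \<open>B * M\<close> and \<open>B * M^2 + B * M\<close>; the single constant
  \<open>B * (1 + M)^2\<close> dominates all three.\<close>

lemma smooth_bounded_compose: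
  assumes v: "smooth_bounded M v"
    and f: "\<And>y. (f has_real_derivative f1 y) (at y)" "\<And>y. (f1 has_real_derivative f2 y) (at y)"
    and f2: "continuous_on UNIV f2"
    and B: "\<And>y. \<bar>y\<bar> \<le> M \<Longrightarrow> \<bar>f y\<bar> \<le> B" "\<And>y. \<bar>y\<bar> \<le> M \<Longrightarrow> \<bar>f1 y\<bar> \<le> B" "\<And>y. \<bar>y\<bar> \<le> M \<Longrightarrow> \<bar>f2 y\<bar> \<le> B"
  obtains w1 w2 where "\<And>x. ((\<lambda>x. f (v x)) has_real_derivative w1 x) (at x)"
    "\<And>x. (w1 has_real_derivative w2 x) (at x)" "continuous_on UNIV w2"
    "\<And>x. \<bar>f (v x)\<bar> \<le> B * (1 + M)\<^sup>2" "\<And>x. \<bar>w1 x\<bar> \<le> B * (1 + M)\<^sup>2" "\<And>x. \<bar>w2 x\<bar> \<le> B * (1 + M)\<^sup>2"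
proof -
  obtain V where V: "V 0 = v" "\<And>k x. k < 3 \<Longrightarrow> (V k has_real_derivative V (Suc k) x) (at x)"
    "\<And>k x. k \<le> 3 \<Longrightarrow> \<bar>V k x\<bar> \<le> M"
    using v unfolding smooth_bounded_def by blast
  have d0: "(v has_real_derivative V 1 x) (at x)" for x using V(2)[of 0 x] by (simp add: V(1))
  have d1: "(V 1 has_real_derivative V 2 x) (at x)" for x using V(2)[of 1 x] by (simp add: numeral_2_eq_2)
  have d2: "(V 2 has_real_derivative V 3 x) (at x)" for x using V(2)[of 2 x] by (simp add: numeral_3_eq_3 numeral_2_eq_2)
  have bv: "\<bar>v x\<bar> \<le> M" "\<bar>V 1 x\<bar> \<le> M" "\<bar>V 2 x\<bar> \<le> M" for x
    using V(3)[of 0 x] V(3)[of 1 x] V(3)[of 2 x] by (simp_all add: V(1))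
  have M: "M \<ge> 0" using bv(1)[of 0] by linarith
  have B0: "B \<ge> 0" using B(1)[of 0] M by simp
  define w1 where "w1 x = f1 (v x) * V 1 x" for x
  define w2 where "w2 x = f2 (v x) * V 1 x * V 1 x + V 2 x * f1 (v x)" for x
  have "((\<lambda>x. f (v x)) has_real_derivative w1 x) (at x)" for x
    unfolding w1_def by (rule DERIV_chain2[OF f(1) d0])
  moreover have "(w1 has_real_derivative w2 x) (at x)" for x
    unfolding w1_def w2_def by (rule DERIV_mult[OF DERIV_chain2[OF f(2) d0] d1])
  moreover have "continuous_on UNIV w2"
    unfolding w2_def using DERIV_imp_continuous_on[OF d0] DERIV_imp_continuous_on[OF d1]
      DERIV_imp_continuous_on[OF d2] DERIV_imp_continuous_on[OF f(2)]
    by (intro continuous_intros continuous_on_compose2[OF f2] continuous_on_compose2[of UNIV f1 UNIV v]) auto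
  moreover have le: "B * 1 \<le> B * (1 + M)\<^sup>2" "B * M \<le> B * (1 + M)\<^sup>2" "B * M * M + M * B \<le> B * (1 + M)\<^sup>2"
    using M B0 by (auto simp: power2_eq_square algebra_simps)
  moreover have "\<bar>f (v x)\<bar> \<le> B * (1 + M)\<^sup>2" for x using B(1)[OF bv(1)] le(1) by (auto intro: order_trans)
  moreover have "\<bar>w1 x\<bar> \<le> B * (1 + M)\<^sup>2" for x
    unfolding w1_def abs_mult using B(2)[OF bv(1), of x] bv(2)[of x] B0 M
    by (intro order_trans[OF mult_mono le(2)]) auto
  moreover have "\<bar>w2 x\<bar> \<le> B * (1 + M)\<^sup>2" for x
  proof -
    have "\<bar>f2 (v x) * V 1 x * V 1 x\<bar> \<le> B * M * M"
      unfolding abs_mult using B(3)[OF bv(1), of x] bv(2)[of x] B0 M by (intro mult_mono) auto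
    moreover have "\<bar>V 2 x * f1 (v x)\<bar> \<le> M * B"
      unfolding abs_mult using B(2)[OF bv(1), of x] bv(3)[of x] B0 M by (intro mult_mono) auto
    ultimately show ?thesis unfolding w2_def using le(3) by linarith
  qed
  ultimately show ?thesis using that by blast
qed

text \<open>The order of quantifiers encodes the \<open>O\<close> notation: \<open>C\<close> and the
  thresholds precede \<open>h\<close> and \<open>\<epsilon>\<close>, while \<open>N\<close> may
  depend on both. Existence is stated separately from the bound because the bound is proved for
  every solution of the truncated system, which avoids singling one out.\<close>

theorem theorem5p2:
  fixes \<beta> f \<phi> \<psi> :: "real \<Rightarrow> real"
    and \<mu> \<nu> :: "real measure"
    and s T :: real
    and u ut utt :: "real \<Rightarrow> real \<Rightarrow> real"
  assumes beta_even: "\<And>x. \<beta> (- x) = \<beta> x"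
    and beta_integral: "(LINT x|lborel. \<beta> x) = 1"
    and beta_W11: "in_W11 \<beta>"
    and beta_cont: "continuous_on UNIV \<beta>"
    and beta_measure: "finite_borel \<mu>" "finite_borel \<nu>" "second_distributional_derivative \<beta> \<mu> \<nu>"
    and s: "s > 9 / 2"
    and T: "T > 0"
    and f: "Ck (nat \<lfloor>s\<rfloor> + 1) f" "f 0 = 0"
    and data: "in_Hs s \<phi>" "continuous_on UNIV \<phi>" "in_Hs s \<psi>" "continuous_on UNIV \<psi>"
    and u_C2: "C2_Hs s T u ut utt"
    and u_cont: "\<And>t. t \<in> {0..T} \<Longrightarrow>
      continuous_on UNIV (u t) \<and> continuous_on UNIV (ut t) \<and> continuous_on UNIV (utt t)"
    and u_eq: "\<And>t x. t \<in> {0<..T} \<Longrightarrow>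
      utt t x = (deriv ^^ 2) (conv \<beta> (\<lambda>y. f (u t y))) x"
    and u_init: "\<And>x. u 0 x = \<phi> x" "\<And>x. ut 0 x = \<psi> x"
  shows "\<exists>C>0. \<exists>h0>0. \<exists>\<epsilon>0>0. \<forall>h \<epsilon>. 0 < h \<and> h < h0 \<and> 0 < \<epsilon> \<and> \<epsilon> < \<epsilon>0 \<longrightarrow>
    (\<exists>N>0.
      (\<exists>v v'. truncated_solution \<beta> f \<phi> \<psi> T h N v v') \<and>
      (\<forall>v v'. truncated_solution \<beta> f \<phi> \<psi> T h N v v' \<longrightarrow>
        (\<forall>t\<in>{0..T}. \<forall>i\<in>{-int N..int N}.
          \<bar>u t (of_int i * h) - v t i\<bar> + \<bar>ut t (of_int i * h) - v' t i\<bar> \<le> C * (h\<^sup>2 + \<epsilon>))))"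
proof -
  have s4: "s \<ge> 4" using s by simp
  have T0: "T \<ge> 0" using T by simp
  have \<beta>_int: "integrable lborel \<beta>" using beta_W11 by (simp add: in_W11_def)
  have Hs: "Hs_continuous s T u" "Hs_continuous s T ut" "Hs_continuous s T utt"
    "Hs_derivative s T u ut" "Hs_derivative s T ut utt"
    using u_C2 by (simp_all add: C2_Hs_def)
  have du: "((\<lambda>r. u r x) has_real_derivative ut t x) (at t within {0..T})" if "t \<in> {0..T}" for t x
    by (rule Hs_derivative_pointwise[OF s4 Hs(1,2,4) _ _ that]) (use u_cont in auto)
  have dut: "((\<lambda>r. ut r x) has_real_derivative utt t x) (at t within {0..T})" if "t \<in> {0..T}" for t x
    by (rule Hs_derivative_pointwise[OF s4 Hs(2,3,5) _ _ that]) (use u_cont in auto)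
  obtain M where M: "\<And>t. t \<in> {0..T} \<Longrightarrow> smooth_bounded M (u t)"
    using Hs_continuous_uniform_bound[OF s4 T0 Hs(1)] u_cont by blast
  have uM: "\<bar>u t x\<bar> \<le> M" if "t \<in> {0..T}" for t x
    using M[OF that] unfolding smooth_bounded_def by (metis le0)
  have M0: "M \<ge> 0" using uM[of 0 0] T0 by auto
  have "2 \<le> nat \<lfloor>s\<rfloor> + 1" using s by linarith
  then have "Ck (Suc (Suc 0)) f" using Ck_mono[OF f(1)] by (simp add: numeral_2_eq_2)
  then obtain f1 where f1: "\<And>y. (f has_real_derivative f1 y) (at y)" "Ck (Suc 0) f1" using Ck_SucE by blast
  from f1(2) obtain f2 where f2: "\<And>y. (f1 has_real_derivative f2 y) (at y)" "Ck 0 f2" using Ck_SucE by blast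
  have f2c: "continuous_on UNIV f2" by (rule Ck_imp_continuous[OF f2(2)])
  \<comment> \<open>The exact solution lies in \<open>[-M, M]\<close>; the margin 1 is room for the
    numerical solution.\<close>
  obtain B0 where B0: "\<And>y. y \<in> {- (M + 1)..M + 1} \<Longrightarrow> \<bar>f y\<bar> \<le> B0"
    using continuous_on_Icc_bounded[OF DERIV_imp_continuous_on[OF f1(1)]] by metis
  obtain L where L: "\<And>y. y \<in> {- (M + 1)..M + 1} \<Longrightarrow> \<bar>f1 y\<bar> \<le> L"
    using continuous_on_Icc_bounded[OF DERIV_imp_continuous_on[OF f2(1)]] by metis
  obtain B2 where B2: "\<And>y. y \<in> {- (M + 1)..M + 1} \<Longrightarrow> \<bar>f2 y\<bar> \<le> B2"
    using continuous_on_Icc_bounded[OF f2c] by metis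
  have L0: "L \<ge> 0" using L[of 0] M0 by auto
  define K where "K = max B0 (max L B2) * (1 + M)\<^sup>2"
  have K0: "K \<ge> 0" using L0 by (simp add: K_def le_max_iff_disj)
  have comp: "\<exists>w1 w2. (\<forall>x. ((\<lambda>x. f (u t x)) has_real_derivative w1 x) (at x)) \<and>
      (\<forall>x. (w1 has_real_derivative w2 x) (at x)) \<and> continuous_on UNIV w2 \<and>
      (\<forall>x. \<bar>f (u t x)\<bar> \<le> K) \<and> (\<forall>x. \<bar>w1 x\<bar> \<le> K) \<and> (\<forall>x. \<bar>w2 x\<bar> \<le> K)" if t: "t \<in> {0..T}" for t
  proof (rule smooth_bounded_compose[OF M[OF t] f1(1) f2(1) f2c, of "max B0 (max L B2)"])
    fix y assume "\<bar>y\<bar> \<le> M"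
    then have "y \<in> {- (M + 1)..M + 1}" by auto
    from B0[OF this] L[OF this] B2[OF this]
    show "\<bar>f y\<bar> \<le> max B0 (max L B2)" "\<bar>f1 y\<bar> \<le> max B0 (max L B2)" "\<bar>f2 y\<bar> \<le> max B0 (max L B2)" by auto
  qed (unfold K_def, blast)
  have lip: "\<bar>f p - f q\<bar> \<le> L * \<bar>p - q\<bar>" if "p \<in> {- (M + 1)..M + 1}" "q \<in> {- (M + 1)..M + 1}" for p q
  proof -
    have "norm (f p - f q) \<le> L * norm (p - q)"
      by (rule field_differentiable_bound[of "{- (M + 1)..M + 1}" f f1])
        (use f1(1) L that in \<open>auto intro: has_field_derivative_at_within\<close>)
    then show ?thesis by simp
  qed
  \<comment> \<open>Clamping the argument to \<open>[-(M + 1), M + 1]\<close> makes the nonlinearity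
    globally Lipschitz with the constant \<open>L\<close> of that interval.\<close>
  define F where "F y = f (max (- (M + 1)) (min (M + 1) y))" for y
  have F_eq: "F y = f y" if "\<bar>y\<bar> \<le> M + 1" for y using that by (auto simp: F_def max_def min_def)
  have F_lip: "\<bar>F p - F q\<bar> \<le> L * \<bar>p - q\<bar>" for p q
  proof -
    have "\<bar>F p - F q\<bar> \<le> L * \<bar>max (- (M + 1)) (min (M + 1) p) - max (- (M + 1)) (min (M + 1) q)\<bar>"
      unfolding F_def by (rule lip) (use M0 in auto)
    also have "\<dots> \<le> L * \<bar>p - q\<bar>" using L0 by (intro mult_left_mono) (auto simp: max_def min_def)
    finally show ?thesis .
  qed
  define a where "a = total_mass \<mu> \<nu>"
  have a0: "a \<ge> 0" by (simp add: a_def total_mass_nonneg)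
  define l where "l = sqrt (a * L + 1)"
  have l: "l\<^sup>2 = a * L + 1" "l > 0" using a0 L0 by (simp_all add: l_def add_nonneg_pos)
  \<comment> \<open>Consistency costs \<open>a * K\<close> per \<open>h^2\<close> and
    \<open>a * L\<close> per \<open>\<epsilon>\<close>; the added 1 makes the constant positive even
    if \<open>a\<close> vanishes.\<close>
  define \<eta>0 where "\<eta>0 = a * (K + L) + 1"
  have \<eta>0: "\<eta>0 > 0" using a0 K0 L0 by (simp add: \<eta>0_def add_nonneg_pos)
  \<comment> \<open>The summands 1 and \<open>l\<close> account for the errors of the solution and
    of its time derivative.\<close>
  define C where "C = \<eta>0 * (1 + l) * exp (l * T)"
  \<comment> \<open>Since \<open>h^2 \<le> h\<close> for \<open>h \<le> 1\<close>, two quantities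
    below \<open>\<delta>\<close> have \<open>h^2 + \<epsilon>\<close> at most
    \<open>1 / (\<eta>0 * exp (l * T))\<close>, which keeps the error below 1.\<close>
  define \<delta> where "\<delta> = min 1 (1 / (2 * \<eta>0 * exp (l * T)))"
  have \<delta>: "\<delta> > 0" using \<eta>0 by (simp add: \<delta>_def)
  have C: "C > 0" using \<eta>0 l by (simp add: C_def)
  show ?thesis
  proof (rule exI[of _ C], rule conjI[OF C], rule exI[of _ \<delta>], rule conjI[OF \<delta>],
      rule exI[of _ \<delta>], rule conjI[OF \<delta>], intro allI impI)
    fix h \<epsilon> assume h\<epsilon>: "0 < h \<and> h < \<delta> \<and> 0 < \<epsilon> \<and> \<epsilon> < \<delta>"
    then have h: "0 < h" "h \<le> 1" "h < \<delta>" and \<epsilon>: "0 < \<epsilon>" "\<epsilon> \<le> 1" "\<epsilon> < \<delta>" by (auto simp: \<delta>_def)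
    obtain R where R: "\<And>t x. t \<in> {0..T} \<Longrightarrow> R \<le> \<bar>x\<bar> \<Longrightarrow> \<bar>u t x\<bar> \<le> \<epsilon>"
      using Hs_continuous_uniform_decay[OF s4 T0 Hs(1) _ \<epsilon>(1)] u_cont by blast
    \<comment> \<open>Every index beyond \<open>N\<close> has its grid point at distance at least
      \<open>R\<close> from the origin; the added 1 makes \<open>N\<close> positive.\<close>
    define N where "N = nat \<lceil>R / h\<rceil> + 1"
    define J where "J = {- int N..int N}"
    have J: "finite J" by (simp add: J_def)
    have outside: "R \<le> \<bar>of_int j * h\<bar>" if "j \<notin> J" for j
    proof -
      have "int N < \<bar>j\<bar>" using that unfolding J_def atLeastAtMost_iff by linarith
      moreover have "\<lceil>R / h\<rceil> \<le> int N" unfolding N_def by linarith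
      ultimately have "\<lceil>R / h\<rceil> \<le> \<bar>j\<bar>" by linarith
      then have "R / h \<le> \<bar>of_int j\<bar>" by linarith
      then show ?thesis using h by (simp add: divide_le_eq abs_mult)
    qed
    define A where "A i j = h * DpDm h (grid h \<beta>) (i - j)" for i j :: int
    have row: "(\<Sum>j\<in>J. \<bar>A i j\<bar>) \<le> a" for i
      unfolding A_def a_def by (rule discrete_kernel_row_sum[OF beta_cont beta_measure h(1) J])
    define \<eta> where "\<eta> = \<eta>0 * (h\<^sup>2 + \<epsilon>)"
    have \<eta>: "\<eta> > 0" using \<eta>0 \<epsilon>(1) by (simp add: \<eta>_def add_nonneg_pos)
    have h2: "h\<^sup>2 \<le> h" using h by (simp add: power2_eq_square mult_left_le)
    have \<eta>1: "\<eta> * exp (l * T) \<le> 1"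
    proof -
      have "h\<^sup>2 + \<epsilon> \<le> 1 / (\<eta>0 * exp (l * T))" using h2 h(3) \<epsilon>(3) by (simp add: \<delta>_def)
      then have "(\<eta>0 * exp (l * T)) * (h\<^sup>2 + \<epsilon>) \<le> (\<eta>0 * exp (l * T)) * (1 / (\<eta>0 * exp (l * T)))"
        using \<eta>0 by (intro mult_left_mono) auto
      also have "\<dots> = 1" using \<eta>0 by simp
      finally show ?thesis by (simp add: \<eta>_def mult_ac)
    qed
    have residual: "\<bar>utt t (of_int i * h) - (\<Sum>j\<in>J. A i j * f (u t (of_int j * h)))\<bar> \<le> \<eta>"
      if t: "0 < t" "t \<le> T" for t i
    proof -
      have tT: "t \<in> {0..T}" "t \<in> {0<..T}" using t by auto
      obtain w1 w2 where w: "\<And>x. ((\<lambda>x. f (u t x)) has_real_derivative w1 x) (at x)"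
        "\<And>x. (w1 has_real_derivative w2 x) (at x)" "continuous_on UNIV w2"
        "\<And>x. \<bar>f (u t x)\<bar> \<le> K" "\<And>x. \<bar>w1 x\<bar> \<le> K" "\<And>x. \<bar>w2 x\<bar> \<le> K"
        using comp[OF tT(1)] by blast
      have eq: "utt t (of_int i * h) = diff_integral \<mu> \<nu> (\<lambda>z. f (u t (of_int i * h - z)))"
        unfolding u_eq[OF tT(2)] by (rule conv_second_deriv[OF beta_cont \<beta>_int beta_measure w])
      \<comment> \<open>Because \<open>f 0 = 0\<close>, the Lipschitz bound turns smallness of
        \<open>u\<close> outside the grid into smallness of \<open>f u\<close>.\<close>
      have tail: "\<bar>f (u t (of_int j * h))\<bar> \<le> L * \<epsilon>" if "j \<notin> J" for j
      proof -
        have "\<bar>u t (of_int j * h)\<bar> \<le> \<epsilon>" by (rule R[OF tT(1) outside[OF that]])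
        moreover have "\<bar>f (u t (of_int j * h)) - f 0\<bar> \<le> L * \<bar>u t (of_int j * h) - 0\<bar>"
          by (rule lip) (use uM[OF tT(1), of "of_int j * h"] M0 in auto)
        ultimately show ?thesis using f(2) mult_left_mono[OF _ L0, of "\<bar>u t (of_int j * h)\<bar>" \<epsilon>] by simp
      qed
      have "\<bar>(\<Sum>j\<in>J. A i j * f (u t (of_int j * h))) - diff_integral \<mu> \<nu> (\<lambda>z. f (u t (of_int i * h - z)))\<bar>
        \<le> a * (K * h\<^sup>2 + L * \<epsilon>)"
        unfolding A_def a_def
        by (rule consistency_error[OF beta_cont beta_measure h(1) J tail _ w(1,2,6,4)]) (use L0 \<epsilon> in auto)
      also have "\<dots> \<le> a * ((K + L) * (h\<^sup>2 + \<epsilon>))"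
        using a0 K0 L0 \<epsilon> by (intro mult_left_mono) (auto simp: algebra_simps)
      also have "\<dots> \<le> \<eta>" using \<epsilon>(1) by (simp add: \<eta>_def \<eta>0_def algebra_simps)
      finally show ?thesis unfolding eq by (simp add: abs_minus_commute)
    qed
    \<comment> \<open>The nonlinearity \<open>g\<close> is left open: it becomes the clamped
      \<open>F\<close> in the existence part and \<open>f\<close> itself in the error bound.\<close>
    have err: "\<bar>u t (of_int i * h) - v t i\<bar> < \<eta> * exp (l * t) \<and> \<bar>ut t (of_int i * h) - v' t i\<bar> < \<eta> * l * exp (l * t)"
      if v: "\<And>t i. i \<in> J \<Longrightarrow> t \<in> {0..T} \<Longrightarrow> ((\<lambda>r. v r i) has_real_derivative v' t i) (at t within {0..T})"
        "\<And>t i. i \<in> J \<Longrightarrow> t \<in> {0..T} \<Longrightarrow>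
          ((\<lambda>r. v' r i) has_real_derivative (\<Sum>j\<in>J. A i j * g (v t j))) (at t within {0..T})"
        and init: "\<And>i. i \<in> J \<Longrightarrow> v 0 i = grid h \<phi> i" "\<And>i. i \<in> J \<Longrightarrow> v' 0 i = grid h \<psi> i"
        and g: "\<And>y. \<bar>y\<bar> \<le> M + 1 \<Longrightarrow> g y = f y"
        and t: "t \<in> {0..T}" and i: "i \<in> J" for v v' g t i
    proof -
      have gl: "\<bar>f p - g q\<bar> \<le> L * \<bar>p - q\<bar>" if "\<bar>p\<bar> \<le> M" "\<bar>p - q\<bar> \<le> 1" for p q
      proof -
        have q: "\<bar>q\<bar> \<le> M + 1" using that by linarith
        show ?thesis unfolding g[OF q] by (rule lip) (use that q in auto)
      qed
      note e = semidiscrete_error[where x = "\<lambda>t i. u t (of_int i * h)" and x' = "\<lambda>t i. ut t (of_int i * h)"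
          and x'' = "\<lambda>t i. utt t (of_int i * h)" and f = f and M = M and L = L and a = a,
          OF J du dut v _ _ residual row uM gl l a0 L0 \<eta> \<eta>1 t i]
      show ?thesis using e init by (simp add: grid_def u_init)
    qed
    show "\<exists>N>0. (\<exists>v v'. truncated_solution \<beta> f \<phi> \<psi> T h N v v') \<and>
      (\<forall>v v'. truncated_solution \<beta> f \<phi> \<psi> T h N v v' \<longrightarrow>
        (\<forall>t\<in>{0..T}. \<forall>i\<in>{-int N..int N}.
          \<bar>u t (of_int i * h) - v t i\<bar> + \<bar>ut t (of_int i * h) - v' t i\<bar> \<le> C * (h\<^sup>2 + \<epsilon>)))"
    proof (intro exI[of _ N] conjI allI impI)
      show "N > 0" by (simp add: N_def)
      show "\<exists>v v'. truncated_solution \<beta> f \<phi> \<psi> T h N v v'"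
      proof (rule Lipschitz_second_order_system_solution[where p = "grid h \<phi>" and q = "grid h \<psi>", OF J T0 row F_lip])
        fix v v' :: "real \<Rightarrow> int \<Rightarrow> real"
        assume v: "\<And>i. v 0 i = grid h \<phi> i" "\<And>i. v' 0 i = grid h \<psi> i"
          "\<And>t i. i \<in> J \<Longrightarrow> t \<in> {0..T} \<Longrightarrow> ((\<lambda>r. v r i) has_real_derivative v' t i) (at t within {0..T})"
          "\<And>t i. i \<in> J \<Longrightarrow> t \<in> {0..T} \<Longrightarrow>
            ((\<lambda>r. v' r i) has_real_derivative (\<Sum>j\<in>J. A i j * F (v t j))) (at t within {0..T})"
        \<comment> \<open>The error bound, already available for the clamped system, places its
          solution within 1 of \<open>u\<close>, hence where the clamp is inactive.\<close>
        have "F (v t j) = f (v t j)" if t: "t \<in> {0..T}" and j: "j \<in> J" for t j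
        proof (rule F_eq)
          have "\<bar>u t (of_int j * h) - v t j\<bar> < \<eta> * exp (l * t)"
            using err[OF v(3,4,1,2) F_eq t j] by blast
          also have "\<dots> \<le> \<eta> * exp (l * T)" using \<eta> l t by simp
          finally show "\<bar>v t j\<bar> \<le> M + 1" using \<eta>1 uM[OF t, of "of_int j * h"] by linarith
        qed
        then have "(\<Sum>j\<in>J. A i j * F (v t j)) = (\<Sum>j\<in>J. A i j * f (v t j))" if "t \<in> {0..T}" for t i
          using that by (intro sum.cong) auto
        then have "truncated_solution \<beta> f \<phi> \<psi> T h N v v'"
          unfolding truncated_solution_def using v(1,2) v(3,4)[unfolded J_def] by (simp add: J_def A_def)
        then show ?thesis by blast
      qed
    next
      fix v v'
      assume "truncated_solution \<beta> f \<phi> \<psi> T h N v v'"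
      then have v: "\<And>i. i \<in> J \<Longrightarrow> v 0 i = grid h \<phi> i" "\<And>i. i \<in> J \<Longrightarrow> v' 0 i = grid h \<psi> i"
        "\<And>t i. i \<in> J \<Longrightarrow> t \<in> {0..T} \<Longrightarrow> ((\<lambda>r. v r i) has_real_derivative v' t i) (at t within {0..T})"
        "\<And>t i. i \<in> J \<Longrightarrow> t \<in> {0..T} \<Longrightarrow>
          ((\<lambda>r. v' r i) has_real_derivative (\<Sum>j\<in>J. A i j * f (v t j))) (at t within {0..T})"
        unfolding truncated_solution_def J_def A_def by blast+
      show "\<forall>t\<in>{0..T}. \<forall>i\<in>{-int N..int N}.
          \<bar>u t (of_int i * h) - v t i\<bar> + \<bar>ut t (of_int i * h) - v' t i\<bar> \<le> C * (h\<^sup>2 + \<epsilon>)"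
      proof (intro ballI)
        fix t i assume t: "t \<in> {0..T}" and i: "i \<in> {-int N..int N}"
        have "\<bar>u t (of_int i * h) - v t i\<bar> + \<bar>ut t (of_int i * h) - v' t i\<bar> \<le> \<eta> * exp (l * t) + \<eta> * l * exp (l * t)"
          using err[OF v(3,4,1,2) refl t i[folded J_def]] by linarith
        also have "\<dots> = \<eta> * (1 + l) * exp (l * t)" by (simp add: algebra_simps)
        also have "\<dots> \<le> \<eta> * (1 + l) * exp (l * T)" using \<eta> l t by (intro mult_left_mono) auto
        also have "\<dots> = C * (h\<^sup>2 + \<epsilon>)" by (simp add: C_def \<eta>_def)
        finally show "\<bar>u t (of_int i * h) - v t i\<bar> + \<bar>ut t (of_int i * h) - v' t i\<bar> \<le> C * (h\<^sup>2 + \<epsilon>)" .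
      qed
    qed
  qed
qed

end
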